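(* Let $\eta>0$, let $f:\mathcal X\to\mathbb R^d$ have $\ell_1$-sensitivity $\Delta_1$ (i.e. $\|f(x)-f(x')\|_1\le\Delta_1$ for all $x\sim x'$), let $(T_n)_{n\ge1}$ be a sequence of time functions with values in $[\eta,\infty)$, and let $\mathrm{LNR}$ be the Laplace noise reduction mechanism associated with $f$ and $(T_n)_{n\ge1}$. If $N$ is a stopping function, then the algorithm $x\mapsto\mathrm{LNR}_{1:N(x)}(x)$ is $(\Delta_1/T_{N(\cdot)}(\cdot),0)$-ex-post private; that is, for all neighbors $x\sim x'$, the privacy loss $\mathcal L$ between $\mathrm{LNR}_{1:N(x)}(x)$ and $\mathrm{LNR}_{1:N(x')}(x')$ satisfies $$\mathbb P\left(\mathcal L>\frac{\Delta_1}{T_{N(x)}(x)}\right)=0.$$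
   Context: $\mathcal X$ is a set of databases with an arbitrary neighboring relation $\sim$. Privacy loss: for a randomized algorithm $A$ on $\mathcal X$ with values in a measurable space and $x\sim x'$, let $p^x,p^{x'}$ be the densities of the laws of $A(x),A(x')$ with respect to a common reference measure (e.g. the sum of the two laws). The privacy loss between $A(x)$ and $A(x')$ is the random variable $\mathcal L(x,x')=\log\frac{p^x(A(x))}{p^{x'}(A(x))}$ (defined up to almost sure equality). For a function $\mathcal E$ of the output with values in $\mathbb R_{\ge0}$, $A$ is $(\mathcal E,\delta)$-ex-post private if $\mathbb P(\mathcal L(x,x')>\mathcal E(A(x)))\le\delta$ for all $x\sim x'$. Laplace process: $\mathrm{Lap}(s)$ denotes the univariate centered Laplace distribution with density $\frac1{2s}e^{-|y|/s}$. The univariate process is built as follows: $(P_t)_{t\ge\eta}$ is an inhomogeneous Poisson process with intensity $\lambda(t)=2/t$ and $P_\eta=0$; $\mathcal T_0:=\eta$ and $\mathcal T_n:=\inf\{t\ge\eta:P_t\ge n\}$ for $n\ge1$; and $Z_t:=\sum_{n=0}^{P_t}Y_n$, where, conditionally on the jump times, the $Y_n$ are independent with $Y_n\sim\mathrm{Lap}(\mathcal T_n)$. In dimension $d$, $(Z_t)_{t\ge\eta}$ is the $\mathbb R^d$-valued process whose coordinates are independent copies of this univariate process. Time functions: a sequence of (measurable) functions $T_n:(\mathbb R^d)^{n-1}\to\mathbb R_{>0}$, $n\ge1$ (so $T_1$ is a constant), with $T_{n+1}(\beta_1,\dots,\beta_n)\le T_n(\beta_1,\dots,\beta_{n-1})$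 for all $n\ge1$ and all $\beta_1,\dots,\beta_n\in\mathbb R^d$. Laplace noise reduction mechanism: $\mathrm{LNR}(x)=(\mathrm{LNR}_n(x))_{n\ge1}$ with $\mathrm{LNR}_n(x)=f(x)+Z_{T_n(x)}$, where recursively $T_n(x):=T_n(\mathrm{LNR}_1(x),\dots,\mathrm{LNR}_{n-1}(x))$; $\mathrm{LNR}_{1:n}(x)=(\mathrm{LNR}_1(x),\dots,\mathrm{LNR}_n(x))$. Stopping function: a function $N:(\mathbb R^d)^\infty\to\mathbb N=\{1,2,\dots\}$ such that for every $x$, $N(x):=N(\mathrm{LNR}(x))$ is a stopping time with respect to the filtration $\sigma(\mathrm{LNR}_i(x):i\le n)$, $n\ge1$. $\mathrm{LNR}_{1:N(x)}(x)$ is regarded as a random element of $\bigsqcup_{n\ge1}(\mathbb R^d)^n$.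
   Formalization: The stopping function N is additionally assumed measurable on the sequence space; without this the claim can fail on a general probability space, where a non-measurable N can tell two neighbors apart. *)

theory Defs
  imports "HOL-Probability.Probability"
begin

section \<open>Privacy loss and ex-post privacy\<close>

text \<open>The sum of two measures on the same measurable space, used as the common reference
  measure for the densities.\<close>

definition measure_sum :: "'b measure \<Rightarrow> 'b measure \<Rightarrow> 'b measure" where
  "measure_sum \<mu> \<nu> = measure_of (space \<mu>) (sets \<mu>) (\<lambda>A. emeasure \<mu> A + emeasure \<nu> A)"

text \<open>Logarithm on the extended half-line. It is applied to a quotient of densities in
  \<^typ>\<open>ennreal\<close>, where \<open>p / 0 = \<infinity>\<close> for \<open>p > 0\<close>; the loss is thus \<open>\<infinity>\<close> at outputs where only
  the second density vanishes.\<close>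

definition elog :: "ennreal \<Rightarrow> ereal" where
  "elog r = (if r = 0 then - \<infinity> else if r = \<infinity> then \<infinity> else ereal (ln (enn2real r)))"

text \<open>Privacy loss between two random elements \<open>X\<close>, \<open>X'\<close> of \<open>S\<close>, a random variable on \<open>M\<close>.\<close>

definition privacy_loss ::
  "'a measure \<Rightarrow> 'b measure \<Rightarrow> ('a \<Rightarrow> 'b) \<Rightarrow> ('a \<Rightarrow> 'b) \<Rightarrow> 'a \<Rightarrow> ereal" where
  "privacy_loss M S X X' \<omega> =
     (let \<mu> = distr M S X; \<mu>' = distr M S X'; R = measure_sum \<mu> \<mu>';
          p = RN_deriv R \<mu>; p' = RN_deriv R \<mu>'
      in elog (p (X \<omega>) / p' (X \<omega>)))"

text \<open>Measurability is part of the definition because \<^const>\<open>measure\<close> is \<open>0\<close> on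
  non-measurable sets.\<close>

definition ex_post_private ::
  "'a measure \<Rightarrow> 'b measure \<Rightarrow> ('x \<Rightarrow> 'x \<Rightarrow> bool) \<Rightarrow> ('x \<Rightarrow> 'a \<Rightarrow> 'b) \<Rightarrow> ('b \<Rightarrow> real) \<Rightarrow> real \<Rightarrow> bool"
where
  "ex_post_private M S nbr A E \<delta> \<longleftrightarrow>
     (\<forall>x. A x \<in> measurable M S) \<and>
     (\<forall>x x'. nbr x x' \<longrightarrow>
        {\<omega>\<in>space M. privacy_loss M S (A x) (A x') \<omega> > ereal (E (A x \<omega>))} \<in> sets M \<and>
        measure M {\<omega>\<in>space M. privacy_loss M S (A x) (A x') \<omega> > ereal (E (A x \<omega>))} \<le> \<delta>)"

definition l1_sensitivity_le ::
  "('x \<Rightarrow> 'x \<Rightarrow> bool) \<Rightarrow> ('x \<Rightarrow> real ^ 'd) \<Rightarrow> real \<Rightarrow> bool" where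
  "l1_sensitivity_le nbr f \<Delta> \<longleftrightarrow>
     (\<forall>x x'. nbr x x' \<longrightarrow> (\<Sum>i\<in>UNIV. \<bar>f x $ i - f x' $ i\<bar>) \<le> \<Delta>)"

section \<open>The Laplace process\<close>

definition Lap :: "real \<Rightarrow> real measure" where
  "Lap s = density lborel (\<lambda>y. ennreal (1 / (2 * s) * exp (- \<bar>y\<bar> / s)))"

text \<open>An inhomogeneous Poisson process on \<open>[\<eta>, \<infinity>)\<close> with intensity \<open>lam\<close>, started at \<open>0\<close>:
  a right-continuous counting process with independent increments over consecutive intervals,
  the increment over \<open>(s, t]\<close> being Poisson with mean \<open>\<integral> lam\<close> over that interval.
  Natural number subtraction is exact here, as the paths are nondecreasing.\<close>

definition poisson_process ::
  "'a measure \<Rightarrow> real \<Rightarrow> (real \<Rightarrow> real) \<Rightarrow> (real \<Rightarrow> 'a \<Rightarrow> nat) \<Rightarrow> bool" where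
  "poisson_process M \<eta> lam P \<longleftrightarrow>
     (\<forall>t\<ge>\<eta>. P t \<in> measurable M (count_space UNIV)) \<and>
     (\<forall>\<omega>\<in>space M. P \<eta> \<omega> = 0 \<and> mono_on {\<eta>..} (\<lambda>t. P t \<omega>) \<and>
        (\<forall>t\<ge>\<eta>. continuous (at_right t) (\<lambda>s. P s \<omega>))) \<and>
     (\<forall>(t :: nat \<Rightarrow> real) n. \<eta> \<le> t 0 \<and> mono t \<longrightarrow>
        prob_space.indep_vars M (\<lambda>_. count_space UNIV)
          (\<lambda>k \<omega>. P (t (Suc k)) \<omega> - P (t k) \<omega>) {..<n}) \<and>
     (\<forall>s t. \<eta> \<le> s \<and> s < t \<longrightarrow>
        distr M (count_space UNIV) (\<lambda>\<omega>. P t \<omega> - P s \<omega>) =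
          measure_pmf (poisson_pmf (integral {s..t} lam)))"

definition jump_time :: "real \<Rightarrow> (real \<Rightarrow> 'a \<Rightarrow> nat) \<Rightarrow> nat \<Rightarrow> 'a \<Rightarrow> real" where
  "jump_time \<eta> P n \<omega> = (if n = 0 then \<eta> else Inf {t. \<eta> \<le> t \<and> n \<le> P t \<omega>})"

definition generated_sigma ::
  "'a measure \<Rightarrow> ('i \<Rightarrow> 'a \<Rightarrow> 'c :: topological_space) \<Rightarrow> 'i set \<Rightarrow> 'a measure" where
  "generated_sigma M X I =
     sigma (space M) (\<Union>i\<in>I. {X i -` B \<inter> space M | B. B \<in> sets borel})"

text \<open>Conditionally on the jump times, the \<open>Y n\<close> are independent with laws
  \<open>Lap (jump_time n)\<close>: the conditional probability of every finite-dimensional rectangle is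
  the product of the corresponding Laplace probabilities.\<close>

definition laplace_jumps ::
  "'a measure \<Rightarrow> real \<Rightarrow> (real \<Rightarrow> 'a \<Rightarrow> nat) \<Rightarrow> (nat \<Rightarrow> 'a \<Rightarrow> real) \<Rightarrow> bool" where
  "laplace_jumps M \<eta> P Y \<longleftrightarrow>
     (\<forall>n. Y n \<in> borel_measurable M) \<and>
     (\<forall>m B. (\<forall>n. B n \<in> sets borel) \<longrightarrow>
        (AE \<omega> in M.
           real_cond_exp M (generated_sigma M (jump_time \<eta> P) UNIV)
             (indicator {\<omega>\<in>space M. \<forall>n\<le>m. Y n \<omega> \<in> B n}) \<omega>
           = (\<Prod>n\<le>m. measure (Lap (jump_time \<eta> P n \<omega>)) (B n))))"

definition univariate_laplace_process ::
  "'a measure \<Rightarrow> real \<Rightarrow> (real \<Rightarrow> 'a \<Rightarrow> real) \<Rightarrow> bool" where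
  "univariate_laplace_process M \<eta> Z \<longleftrightarrow>
     (\<exists>P Y. poisson_process M \<eta> (\<lambda>t. 2 / t) P \<and> laplace_jumps M \<eta> P Y \<and>
        (\<forall>t\<ge>\<eta>. \<forall>\<omega>\<in>space M. Z t \<omega> = (\<Sum>n\<le>P t \<omega>. Y n \<omega>)))"

definition laplace_process ::
  "'a measure \<Rightarrow> real \<Rightarrow> (real \<Rightarrow> 'a \<Rightarrow> real ^ 'd) \<Rightarrow> bool" where
  "laplace_process M \<eta> Z \<longleftrightarrow>
     (\<forall>i. univariate_laplace_process M \<eta> (\<lambda>t \<omega>. Z t \<omega> $ i)) \<and>
     prob_space.indep_vars M (\<lambda>_. PiM {\<eta>..} (\<lambda>_. borel))
       (\<lambda>i \<omega>. \<lambda>t\<in>{\<eta>..}. Z t \<omega> $ i) UNIV"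

section \<open>The Laplace noise reduction mechanism\<close>

text \<open>An element of \<open>(\<real>\<^sup>d)\<^sup>n\<close> is an extensional function on \<open>{1..n}\<close>, and an infinite sequence
  \<open>(\<beta>\<^sub>n)\<^sub>n\<^sub>\<ge>\<^sub>1\<close> is an extensional function on \<open>{1..}\<close>.\<close>

abbreviation tuples :: "nat \<Rightarrow> (nat \<Rightarrow> real ^ 'd) measure" where
  "tuples n \<equiv> PiM {1..n} (\<lambda>_. borel)"

abbreviation sequences :: "(nat \<Rightarrow> real ^ 'd) measure" where
  "sequences \<equiv> PiM {1..} (\<lambda>_. borel)"

text \<open>The disjoint union of the spaces \<open>(\<real>\<^sup>d)\<^sup>n\<close>, \<open>n \<ge> 1\<close>, with its direct sum
  \<open>\<sigma>\<close>-algebra.\<close>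

definition finite_sequences :: "(nat \<times> (nat \<Rightarrow> real ^ 'd)) measure" where
  "finite_sequences =
     sigma (SIGMA n:{1..}. space (tuples n))
       {A. A \<subseteq> (SIGMA n:{1..}. space (tuples n)) \<and>
           (\<forall>n\<ge>1. {\<beta>. (n, \<beta>) \<in> A} \<in> sets (tuples n))}"

text \<open>\<open>T n\<close> is a function of the first \<open>n - 1\<close> outputs; \<open>T 0\<close> is irrelevant.\<close>

definition time_functions :: "(nat \<Rightarrow> (nat \<Rightarrow> real ^ 'd) \<Rightarrow> real) \<Rightarrow> bool" where
  "time_functions T \<longleftrightarrow>
     (\<forall>n\<ge>1. T n \<in> borel_measurable (tuples (n - 1)) \<and>
        (\<forall>\<beta>\<in>space (tuples (n - 1)). 0 < T n \<beta>)) \<and>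
     (\<forall>n\<ge>1. \<forall>\<beta>\<in>space (tuples n). T (n + 1) \<beta> \<le> T n (restrict \<beta> {1..n - 1}))"

lemma restrict_cong_strong [fundef_cong]:
  "I = J \<Longrightarrow> (\<And>i. i \<in> J \<Longrightarrow> f i = g i) \<Longrightarrow> restrict f I = restrict g J"
  by (auto simp: restrict_def)

text \<open>\<open>lnr f T Z x n \<omega>\<close> is the \<open>n\<close>-th output; only \<open>n \<ge> 1\<close> is meaningful.\<close>

function lnr ::
  "('x \<Rightarrow> real ^ 'd) \<Rightarrow> (nat \<Rightarrow> (nat \<Rightarrow> real ^ 'd) \<Rightarrow> real) \<Rightarrow> (real \<Rightarrow> 'a \<Rightarrow> real ^ 'd) \<Rightarrow>
   'x \<Rightarrow> nat \<Rightarrow> 'a \<Rightarrow> real ^ 'd" where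
  "lnr f T Z x n \<omega> = f x + Z (T n (\<lambda>i\<in>{1..n - 1}. lnr f T Z x i \<omega>)) \<omega>"
  by auto
termination by (relation "Wellfounded.measure (\<lambda>(f, T, Z, x, n, \<omega>). n)") auto

declare lnr.simps [simp del]

definition lnr_time ::
  "('x \<Rightarrow> real ^ 'd) \<Rightarrow> (nat \<Rightarrow> (nat \<Rightarrow> real ^ 'd) \<Rightarrow> real) \<Rightarrow> (real \<Rightarrow> 'a \<Rightarrow> real ^ 'd) \<Rightarrow>
   'x \<Rightarrow> nat \<Rightarrow> 'a \<Rightarrow> real" where
  "lnr_time f T Z x n \<omega> = T n (\<lambda>i\<in>{1..n - 1}. lnr f T Z x i \<omega>)"

definition lnr_seq ::
  "('x \<Rightarrow> real ^ 'd) \<Rightarrow> (nat \<Rightarrow> (nat \<Rightarrow> real ^ 'd) \<Rightarrow> real) \<Rightarrow> (real \<Rightarrow> 'a \<Rightarrow> real ^ 'd) \<Rightarrow>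
   'x \<Rightarrow> 'a \<Rightarrow> nat \<Rightarrow> real ^ 'd" where
  "lnr_seq f T Z x \<omega> = (\<lambda>n\<in>{1..}. lnr f T Z x n \<omega>)"

text \<open>Measurability of \<open>N\<close> on the sequence space does not follow from the stopping time
  property: on a general probability space the ranges of \<open>lnr_seq\<close> for two neighbours can be
  disjoint (non-measurable) sets, and \<open>N\<close> could then tell the two neighbours apart.\<close>

definition stopping_function ::
  "'a measure \<Rightarrow> ('x \<Rightarrow> real ^ 'd) \<Rightarrow> (nat \<Rightarrow> (nat \<Rightarrow> real ^ 'd) \<Rightarrow> real) \<Rightarrow>
   (real \<Rightarrow> 'a \<Rightarrow> real ^ 'd) \<Rightarrow> ((nat \<Rightarrow> real ^ 'd) \<Rightarrow> nat) \<Rightarrow> bool" where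
  "stopping_function M f T Z N \<longleftrightarrow>
     N \<in> measurable sequences (count_space UNIV) \<and>
     (\<forall>\<beta>\<in>space sequences. 1 \<le> N \<beta>) \<and>
     (\<forall>x. stopping_time (\<lambda>n. generated_sigma M (lnr f T Z x) {1..n})
            (\<lambda>\<omega>. N (lnr_seq f T Z x \<omega>)))"

definition lnr_stopped ::
  "('x \<Rightarrow> real ^ 'd) \<Rightarrow> (nat \<Rightarrow> (nat \<Rightarrow> real ^ 'd) \<Rightarrow> real) \<Rightarrow> (real \<Rightarrow> 'a \<Rightarrow> real ^ 'd) \<Rightarrow>
   ((nat \<Rightarrow> real ^ 'd) \<Rightarrow> nat) \<Rightarrow> 'x \<Rightarrow> 'a \<Rightarrow> nat \<times> (nat \<Rightarrow> real ^ 'd)" where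
  "lnr_stopped f T Z N x \<omega> =
     (let n = N (lnr_seq f T Z x \<omega>) in (n, \<lambda>i\<in>{1..n}. lnr f T Z x i \<omega>))"

end

theory Submission
  imports Defs "HOL-Real_Asymp.Real_Asymp"
begin

text \<open>For fixed \<open>s\<close>, the noise \<open>Z\<^sub>s\<close> has law \<open>Lap s\<close> and is independent of the increments
  \<open>(Z\<^sub>t - Z\<^sub>s)\<^sub>t\<^sub>\<ge>\<^sub>s\<close>: the joint characteristic function factorises by the exponential formula for the
  Poisson process. Hence the laws of the whole paths \<open>(f x + Z\<^sub>t)\<^sub>t\<^sub>\<ge>\<^sub>s\<close> and \<open>(f x' + Z\<^sub>t)\<^sub>t\<^sub>\<ge>\<^sub>s\<close> have
  likelihood ratio at most \<open>exp (\<Delta> / s)\<close>.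

  By right-continuity the outputs are measurable functionals of these paths. The times decrease, so on
  \<open>{T\<^sub>n \<ge> s}\<close> the first \<open>n\<close> outputs depend only on the path after time \<open>s\<close>; this gives the bound
  \<open>exp (\<Delta> / s)\<close> on every event contained in \<open>{T\<^sub>N \<ge> s}\<close>, for every \<open>s\<close>, which is equivalent to the
  almost sure bound on the privacy loss.\<close>

section \<open>Laplace distributions\<close>

text \<open>The intensity 2/t makes \<open>Z s\<close> a Laplace variable: 2/x * (1/(1 + u^2 x^2) -
  1) is the derivative of -ln (1 + u^2 x^2), so the jumps in (\<eta>, s] turn the characteristic
  function 1/(1 + u^2 \<eta>^2) of the initial jump into 1/(1 + u^2 s^2). The database affects a
  path after s only through its value at s, a single Laplace variable per coordinate. Two obstacles
  shape the rest. Output times depend on the noise itself, so a comparison at fixed times is not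
  enough: the laws of entire paths are compared, on an uncountable product, and the outputs must be
  measurable functions of a path. And the budget Delta / T_N is random, while a path comparison has
  a fixed s. It is used for tuples whose last time is at least s; on these, raising all times to at
  least s changes no output. Cutting the output space along rational levels then gives the almost
  sure bound.\<close>

lemma exp_halfline:
  fixes t :: real
  defines "f \<equiv> (\<lambda>x::real. indicator {0..} x *\<^sub>R exp ((\<i> * t - 1) * complex_of_real x))"
  shows integrable_exp_halfline: "integrable lborel f"
    and integral_exp_halfline: "integral\<^sup>L lborel f = 1 / (1 - \<i> * t)"
proof -
  have nz: "\<i> * t - 1 \<noteq> 0"
    by (simp add: complex_eq_iff)
  have nf: "norm (f x) = exp (- x) * indicator {0..} x" for x
    by (simp add: f_def indicator_def)
  have "(\<integral>\<^sup>+ x. ennreal (exp (- x)) * indicator {0..} x \<partial>lborel) = 0 - - exp (- 0::real)"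
  proof (rule nn_integral_FTC_atLeast)
    show "((\<lambda>x::real. - exp (- x)) \<longlongrightarrow> 0) at_top"
      by real_asymp
  qed (auto intro!: derivative_eq_intros)
  then have e: "integrable lborel (\<lambda>x::real. exp (- x) * indicator {0..} x)"
    by (intro integrableI_nonneg) (auto simp: ennreal_mult' ennreal_indicator)
  show int: "integrable lborel f"
  proof (rule Bochner_Integration.integrable_bound[OF e])
    show "f \<in> borel_measurable lborel"
      unfolding f_def by measurable
    show "AE x in lborel. norm (f x) \<le> norm (exp (- x) * indicator {0..} x :: real)"
      unfolding nf by (intro AE_I2) simp
  qed
  \<comment> \<open>The fundamental theorem of calculus applies on the compact intervals
    \<open>{0..n}\<close>; the boundary term at n has norm of order exp (-n) and disappears in the
    limit.\<close>
  define g where "g = (\<lambda>(n::nat) x. indicator {0..real n} x *\<^sub>R exp ((\<i> * t - 1) * complex_of_real x))"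
  define F where "F = (\<lambda>x::real. exp ((\<i> * t - 1) * complex_of_real x) / (\<i> * t - 1))"
  have g: "integral\<^sup>L lborel (g n) = F (real n) - F 0" for n
    unfolding g_def
  proof (rule integral_FTC_atLeastAtMost)
    fix x :: real
    have "((\<lambda>z. exp ((\<i> * t - 1) * z) / (\<i> * t - 1)) has_field_derivative
       exp ((\<i> * t - 1) * complex_of_real x)) (at (complex_of_real x))"
      using nz by (auto intro!: derivative_eq_intros)
    then show "(F has_vector_derivative exp ((\<i> * t - 1) * complex_of_real x)) (at x within {0..real n})"
      unfolding F_def by (rule has_vector_derivative_real_field)
  qed (simp, intro continuous_intros)
  have "(\<lambda>n. integral\<^sup>L lborel (g n)) \<longlonglongrightarrow> integral\<^sup>L lborel f"
  proof (rule integral_dominated_convergence[where w = "\<lambda>x. norm (f x)"])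
    show "AE x in lborel. (\<lambda>n. g n x) \<longlonglongrightarrow> f x"
    proof (intro AE_I2 tendsto_eventually)
      fix x :: real
      show "\<forall>\<^sub>F n in sequentially. g n x = f x"
        using eventually_ge_at_top[of "nat \<lceil>x\<rceil>"]
        by eventually_elim (auto simp: g_def f_def indicator_def nat_le_iff ceiling_le_iff)
    qed
    show "integrable lborel (\<lambda>x. norm (f x))"
      by (rule integrable_norm[OF int])
  qed (auto simp: g_def f_def indicator_def)
  moreover have "(\<lambda>n. F (real n) - F 0) \<longlonglongrightarrow> 0 - F 0"
  proof (intro tendsto_diff tendsto_const)
    have "(\<lambda>n. norm (F (real n))) = (\<lambda>n. exp (- real n) / norm (\<i> * t - 1))"
      by (simp add: F_def norm_divide)
    also have "\<dots> \<longlonglongrightarrow> 0"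
      by real_asymp
    finally show "(\<lambda>n. F (real n)) \<longlonglongrightarrow> 0"
      by (simp add: tendsto_norm_zero_iff)
  qed
  ultimately have "integral\<^sup>L lborel f = 0 - F 0"
    unfolding g by (rule LIMSEQ_unique)
  also have "\<dots> = 1 / (1 - \<i> * t)"
    using nz by (simp add: F_def divide_simps)
  finally show "integral\<^sup>L lborel f = 1 / (1 - \<i> * t)" .
qed

lemma sets_Lap [simp, measurable_cong]: "sets (Lap s) = sets borel"
  by (simp add: Lap_def)

lemma space_Lap [simp]: "space (Lap s) = UNIV"
  by (simp add: Lap_def)

text \<open>The scale will be a random jump time. As an integral of a jointly measurable kernel the
  probability is measurable in it.\<close>

lemma borel_measurable_measure_Lap:
  assumes [measurable]: "g \<in> borel_measurable M" "B \<in> sets borel"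
  shows "(\<lambda>x. measure (Lap (g x)) B) \<in> borel_measurable M"
proof -
  have "(\<lambda>x. measure (Lap (g x)) B) =
    (\<lambda>x. enn2real (\<integral>\<^sup>+y. ennreal (1 / (2 * g x) * exp (- \<bar>y\<bar> / g x)) * indicator B y \<partial>lborel))"
    by (simp add: measure_def Lap_def emeasure_density)
  also have "\<dots> \<in> borel_measurable M"
    by measurable
  finally show ?thesis .
qed

text \<open>The density splits at 0 into two exponential half-lines, which contribute 1/(1 - it) and
  1/(1 + it). The value at t = 0 is the total mass and yields \<open>prob_space\<close> as
  well.\<close>

lemma char_Lap_1: "char (Lap 1) t = 1 / (1 + t\<^sup>2)"
  and prob_space_Lap_1: "prob_space (Lap 1)"
proof -
  define f where "f = (\<lambda>t x::real. indicator {0..} x *\<^sub>R exp ((\<i> * complex_of_real t - 1) * complex_of_real x))"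
  \<comment> \<open>Both half-lines contain 0, where the right side counts twice; the identity holds
    only off this null set.\<close>
  have split: "AE x in lborel. exp (- \<bar>x\<bar>) *\<^sub>R iexp (t * x) = f t x + f (- t) (- x)" for t
  proof -
    have "AE x in lborel. x \<noteq> (0::real)"
      by (rule AE_lborel_singleton)
    then show ?thesis
    proof eventually_elim
      case (elim x)
      then show ?case
        by (cases "x > 0") (auto simp: f_def indicator_def scaleR_conv_of_real exp_of_real[symmetric]
            exp_add[symmetric] algebra_simps simp del: exp_of_real)
    qed
  qed
  have i: "integrable lborel (f t)" "integral\<^sup>L lborel (f t) = 1 / (1 - \<i> * t)" for t
    unfolding f_def by (rule exp_halfline)+
  have i': "integrable lborel (\<lambda>x. f t (- x))" "integral\<^sup>L lborel (\<lambda>x. f t (- x)) = 1 / (1 - \<i> * t)" for t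
    using i[of t] lborel_integrable_real_affine[of "f t" "- 1" 0] lborel_integral_real_affine[of "- 1" "f t" 0]
    by auto
  have val: "(\<integral>x. exp (- \<bar>x\<bar>) *\<^sub>R iexp (t * x) \<partial>lborel) = 2 / (1 + t\<^sup>2)" for t
  proof -
    have "(\<integral>x. exp (- \<bar>x\<bar>) *\<^sub>R iexp (t * x) \<partial>lborel) = (\<integral>x. f t x + f (- t) (- x) \<partial>lborel)"
      by (rule integral_cong_AE) (use split[of t] in \<open>auto simp: f_def\<close>)
    also have "\<dots> = 1 / (1 - \<i> * t) + 1 / (1 - \<i> * (- t))"
      by (subst Bochner_Integration.integral_add) (auto simp: i i')
    also have "\<dots> = 2 / (1 + t\<^sup>2)"
    proof -
      have n: "1 - \<i> * t \<noteq> 0" "1 + \<i> * t \<noteq> 0" "complex_of_real (1 + t\<^sup>2) \<noteq> 0"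
        by (auto simp: complex_eq_iff simp flip: of_real_power) (smt (verit) zero_le_power2)
      have "(1 - \<i> * t) * (1 + \<i> * t) = complex_of_real (1 + t\<^sup>2)"
        by (simp add: algebra_simps power2_eq_square)
      then show ?thesis
        using n by (simp add: divide_simps)
    qed
    finally show ?thesis .
  qed
  show c: "char (Lap 1) t = 1 / (1 + t\<^sup>2)" for t
  proof -
    have "char (Lap 1) t = (\<integral>x. (1 / 2) *\<^sub>R (exp (- \<bar>x\<bar>) *\<^sub>R iexp (t * x)) \<partial>lborel)"
      unfolding char_def Lap_def by (subst integral_density) (auto simp: scaleR_conv_of_real)
    also have "\<dots> = (1 / 2) *\<^sub>R (\<integral>x. (exp (- \<bar>x\<bar>) *\<^sub>R iexp (t * x)) \<partial>lborel)"
      by (rule integral_scaleR_right)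
    finally show ?thesis
      unfolding val by (simp add: scaleR_conv_of_real)
  qed
  have intr: "integrable lborel (\<lambda>x::real. exp (- \<bar>x\<bar>))"
  proof -
    have "integrable lborel (\<lambda>x::real. norm (f 0 x + f (- 0) (- x)))"
      by (intro integrable_norm Bochner_Integration.integrable_add i i')
    then show ?thesis
    proof (rule integrable_cong_AE_imp)
      show "AE x in lborel. norm (f 0 x + f (- 0) (- x)) = exp (- \<bar>x\<bar>)"
        using split[of 0]
      proof eventually_elim
        case (elim x)
        show ?case
          unfolding elim[symmetric] by simp
      qed
    qed (simp_all add: f_def)
  qed
  have "complex_of_real (\<integral>x. exp (- \<bar>x\<bar>) \<partial>lborel) = 2"
    using val[of 0] by (simp add: scaleR_conv_of_real flip: integral_complex_of_real)
  then have re: "(\<integral>x. exp (- \<bar>x\<bar>) \<partial>lborel) = (2::real)"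
    by (metis of_real_eq_iff of_real_numeral)
  have "emeasure (Lap 1) UNIV = (\<integral>\<^sup>+x. ennreal (1 / 2 * exp (- \<bar>x\<bar>)) \<partial>lborel)"
    by (simp add: Lap_def emeasure_density)
  also have "\<dots> = 1"
    by (subst nn_integral_eq_integral) (use intr re in auto)
  finally show "prob_space (Lap 1)"
    by (intro prob_spaceI) simp
qed

text \<open>A random scale can thus be written as a factor of a standard Laplace variable, which
  removes the conditioning on the jump times.\<close>

lemma Lap_eq_distr: "0 < s \<Longrightarrow> Lap s = distr (Lap 1) borel (\<lambda>x. s * x)"
proof -
  assume s: "0 < s"
  show ?thesis
  proof (rule measure_eqI)
    fix A assume "A \<in> sets (Lap s)"
    then have [measurable]: "A \<in> sets borel" by simp
    have "emeasure (Lap s) A = (\<integral>\<^sup>+y. ennreal (1 / (2 * s) * exp (- \<bar>y\<bar> / s)) * indicator A y \<partial>lborel)"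
      by (simp add: Lap_def emeasure_density)
    also have "\<dots> = ennreal \<bar>s\<bar> * (\<integral>\<^sup>+y. ennreal (1 / (2 * s) * exp (- \<bar>0 + s * y\<bar> / s)) * indicator A (0 + s * y) \<partial>lborel)"
      by (rule nn_integral_real_affine) (use s in auto)
    also have "\<dots> = (\<integral>\<^sup>+y. ennreal \<bar>s\<bar> * (ennreal (1 / (2 * s) * exp (- \<bar>0 + s * y\<bar> / s)) * indicator A (0 + s * y)) \<partial>lborel)"
      by (rule nn_integral_cmult[symmetric]) measurable
    also have "\<dots> = (\<integral>\<^sup>+y. ennreal (1 / 2 * exp (- \<bar>y\<bar>)) * indicator ((\<lambda>x. s * x) -` A) y \<partial>lborel)"
      using s by (intro nn_integral_cong) (auto simp: ennreal_mult[symmetric] abs_mult indicator_def)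
    also have "\<dots> = emeasure (distr (Lap 1) borel (\<lambda>x. s * x)) A"
      using measurable_sets[of "(\<lambda>x. s * x)" borel borel A]
      by (simp add: emeasure_distr Lap_def emeasure_density)
    finally show "emeasure (Lap s) A = emeasure (distr (Lap 1) borel (\<lambda>x. s * x)) A" .
  qed simp
qed

lemma prob_space_Lap: "0 < s \<Longrightarrow> prob_space (Lap s)"
  by (subst Lap_eq_distr) (assumption, intro prob_space.prob_space_distr prob_space_Lap_1, simp)

lemma char_Lap: "0 < s \<Longrightarrow> char (Lap s) t = 1 / (1 + t\<^sup>2 * s\<^sup>2)"
  using char_Lap_1[of "t * s"]
  by (subst Lap_eq_distr) (simp_all add: char_def integral_distr mult.assoc power_mult_distrib)

text \<open>The only source of the privacy bound: by the triangle inequality, Laplace densities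
  centred at a and b have ratio at most exp (|a - b| / s). The form with integrals is the one needed
  under Fubini, where g depends on the increments of the path.\<close>

lemma nn_integral_Lap_shift:
  assumes s: "0 < s" and [measurable]: "g \<in> borel_measurable borel"
  shows "(\<integral>\<^sup>+z. g (a + z) \<partial>Lap s) \<le> ennreal (exp (\<bar>a - b\<bar> / s)) * (\<integral>\<^sup>+z. g (b + z) \<partial>Lap s)"
proof -
  have shift: "(\<integral>\<^sup>+z. g (c + z) \<partial>Lap s) = (\<integral>\<^sup>+y. ennreal (1 / (2 * s) * exp (- \<bar>y - c\<bar> / s)) * g y \<partial>lborel)" for c
  proof -
    have "(\<integral>\<^sup>+y. ennreal (1 / (2 * s) * exp (- \<bar>y - c\<bar> / s)) * g y \<partial>lborel)
      = ennreal \<bar>1\<bar> * (\<integral>\<^sup>+y. ennreal (1 / (2 * s) * exp (- \<bar>(c + 1 * y) - c\<bar> / s)) * g (c + 1 * y) \<partial>lborel)"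
      by (rule nn_integral_real_affine) auto
    then show ?thesis
      by (simp add: Lap_def nn_integral_density)
  qed
  have "(\<integral>\<^sup>+y. ennreal (1 / (2 * s) * exp (- \<bar>y - a\<bar> / s)) * g y \<partial>lborel)
    \<le> (\<integral>\<^sup>+y. ennreal (exp (\<bar>a - b\<bar> / s)) * (ennreal (1 / (2 * s) * exp (- \<bar>y - b\<bar> / s)) * g y) \<partial>lborel)"
  proof (rule nn_integral_mono)
    fix y
    have "- \<bar>y - a\<bar> / s \<le> \<bar>a - b\<bar> / s + - \<bar>y - b\<bar> / s"
      using s by (simp add: divide_simps)
    then have "exp (- \<bar>y - a\<bar> / s) \<le> exp (\<bar>a - b\<bar> / s) * exp (- \<bar>y - b\<bar> / s)"
      by (simp add: exp_add[symmetric])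
    then have "1 / (2 * s) * exp (- \<bar>y - a\<bar> / s) \<le> exp (\<bar>a - b\<bar> / s) * (1 / (2 * s) * exp (- \<bar>y - b\<bar> / s))"
      using s by (simp add: field_simps)
    then have "ennreal (1 / (2 * s) * exp (- \<bar>y - a\<bar> / s))
       \<le> ennreal (exp (\<bar>a - b\<bar> / s)) * ennreal (1 / (2 * s) * exp (- \<bar>y - b\<bar> / s))"
      using s by (subst ennreal_mult[symmetric]) (auto intro!: ennreal_leI)
    then show "ennreal (1 / (2 * s) * exp (- \<bar>y - a\<bar> / s)) * g y
      \<le> ennreal (exp (\<bar>a - b\<bar> / s)) * (ennreal (1 / (2 * s) * exp (- \<bar>y - b\<bar> / s)) * g y)"
      by (metis mult.assoc mult_right_mono zero_le)
  qed
  also have "\<dots> = ennreal (exp (\<bar>a - b\<bar> / s)) * (\<integral>\<^sup>+y. ennreal (1 / (2 * s) * exp (- \<bar>y - b\<bar> / s)) * g y \<partial>lborel)"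
    by (rule nn_integral_cmult) measurable
  finally show ?thesis
    unfolding shift .
qed

section \<open>Levy uniqueness in several dimensions\<close>

text \<open>Normalising a bounded nonnegative weight g turns it into a probability density, so that
  one-dimensional Levy uniqueness becomes available for weighted integrals.\<close>

lemma tilted_distribution:
  fixes X g :: "'a \<Rightarrow> real"
  assumes "prob_space M" and [measurable]: "X \<in> borel_measurable M" "g \<in> borel_measurable M"
    and g: "\<And>x. 0 \<le> g x" "\<And>x. g x \<le> C" and k: "k = (\<integral>x. g x \<partial>M)" "0 < k"
  defines "D \<equiv> distr (density M (\<lambda>x. ennreal (g x / k))) borel X"
  shows real_distribution_tilted: "real_distribution D"
    and char_tilted: "char D u = (CLINT x|M. iexp (u * X x) * g x) / k"
    and measure_tilted: "B \<in> sets borel \<Longrightarrow> measure D B = (\<integral>x. indicator B (X x) * g x \<partial>M) / k"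
proof -
  interpret prob_space M by fact
  have ig: "integrable M g"
    by (rule integrable_const_bound[of _ C]) (use g in auto)
  have gk: "0 \<le> g x / k" for x
    using g k by simp
  have "emeasure (density M (\<lambda>x. ennreal (g x / k))) (space M) = (\<integral>\<^sup>+x. ennreal (g x / k) \<partial>M)"
    by (subst emeasure_density) (auto intro!: nn_integral_cong)
  also have "\<dots> = ennreal (\<integral>x. g x / k \<partial>M)"
    by (rule nn_integral_eq_integral) (use ig gk in auto)
  also have "\<dots> = 1"
    using k by simp
  finally have P: "prob_space (density M (\<lambda>x. ennreal (g x / k)))"
    by (intro prob_spaceI) simp
  then show "real_distribution D"
    unfolding D_def real_distribution_def real_distribution_axioms_def
    by (auto intro: prob_space.prob_space_distr)
  have "char D u = (CLINT x|M. (g x / k) *\<^sub>R iexp (u * X x))"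
    unfolding D_def char_def by (subst integral_distr, simp, simp, subst integral_density) (auto simp: gk)
  also have "\<dots> = (CLINT x|M. (iexp (u * X x) * g x) / k)"
    by (intro Bochner_Integration.integral_cong) (auto simp: scaleR_conv_of_real)
  also have "\<dots> = (CLINT x|M. iexp (u * X x) * g x) / k"
    by simp
  finally show "char D u = (CLINT x|M. iexp (u * X x) * g x) / k" .
  assume [measurable]: "B \<in> sets borel"
  have i2: "integrable M (\<lambda>x. indicator B (X x) * g x / k)"
    by (rule integrable_const_bound[of _ "C / k"]) (use g gk k in \<open>auto simp: divide_right_mono indicator_def order_trans[OF g(1) g(2)]\<close>)
  have "emeasure D B = (\<integral>\<^sup>+x. ennreal (g x / k) * indicator (X -` B \<inter> space M) x \<partial>M)"
    unfolding D_def by (subst emeasure_distr) (auto simp: emeasure_density)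
  also have "\<dots> = (\<integral>\<^sup>+x. ennreal (indicator B (X x) * g x / k) \<partial>M)"
    by (intro nn_integral_cong) (auto simp: indicator_def)
  also have "\<dots> = ennreal (\<integral>x. indicator B (X x) * g x / k \<partial>M)"
    by (rule nn_integral_eq_integral[OF i2]) (use gk in \<open>auto simp: indicator_def\<close>)
  finally show "measure D B = (\<integral>x. indicator B (X x) * g x \<partial>M) / k"
    by (simp add: measure_def integral_nonneg_AE gk g k order_less_imp_le)
qed

lemma Levy_uniqueness_weighted_nonneg:
  fixes X g :: "'a \<Rightarrow> real" and X' g' :: "'b \<Rightarrow> real"
  assumes M: "prob_space M" and [measurable]: "X \<in> borel_measurable M" "g \<in> borel_measurable M"
    and M': "prob_space M'" and [measurable]: "X' \<in> borel_measurable M'" "g' \<in> borel_measurable M'"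
    and g: "\<And>x. 0 \<le> g x" "\<And>x. g x \<le> C" and g': "\<And>x. 0 \<le> g' x" "\<And>x. g' x \<le> C"
    and eq: "\<And>u. (CLINT x|M. iexp (u * X x) * g x) = (CLINT x|M'. iexp (u * X' x) * g' x)"
    and [measurable]: "B \<in> sets borel"
  shows "(\<integral>x. indicator B (X x) * g x \<partial>M) = (\<integral>x. indicator B (X' x) * g' x \<partial>M')"
proof -
  interpret M: prob_space M by fact
  interpret M': prob_space M' by fact
  have i: "integrable M g" "integrable M' g'"
    by (rule M.integrable_const_bound[of _ C] M'.integrable_const_bound[of _ C]; use g g' in auto)+
  define k where "k = (\<integral>x. g x \<partial>M)"
  have k': "k = (\<integral>x. g' x \<partial>M')"
    using eq[of 0] by (simp add: k_def)
  show ?thesis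
  \<comment> \<open>A weight of total mass 0 cannot be normalised, but then both weights vanish
    almost everywhere.\<close>
  proof (cases "k = 0")
    case True
    then have "AE x in M. g x = 0" "AE x in M'. g' x = 0"
      using integral_nonneg_eq_0_iff_AE[OF i(1)] integral_nonneg_eq_0_iff_AE[OF i(2)] g(1) g'(1) k' k_def
      by simp_all
    then have "(\<integral>x. indicator B (X x) * g x \<partial>M) = (\<integral>x. 0 \<partial>M)" "(\<integral>x. indicator B (X' x) * g' x \<partial>M') = (\<integral>x. 0 \<partial>M')"
      by (intro integral_cong_AE; auto)+
    then show ?thesis by simp
  next
    case False
    then have k: "0 < k"
      using g by (simp add: k_def integral_nonneg_AE less_le)
    let ?D = "distr (density M (\<lambda>x. ennreal (g x / k))) borel X"
    let ?D' = "distr (density M' (\<lambda>x. ennreal (g' x / k))) borel X'"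
    have "?D = ?D'"
    proof (rule Levy_uniqueness)
      show "char ?D = char ?D'"
        using char_tilted[of M X g C k] char_tilted[of M' X' g' C k] M M' g g' k k' eq
        by (auto simp: fun_eq_iff k_def)
    qed (use real_distribution_tilted[of M X g C k] real_distribution_tilted[of M' X' g' C k] M M' g g' k k'
        in \<open>auto simp: k_def\<close>)
    then have "measure ?D B = measure ?D' B"
      by simp
    then have "(\<integral>x. indicator B (X x) * g x \<partial>M) / k = (\<integral>x. indicator B (X' x) * g' x \<partial>M') / k"
      using measure_tilted[of M X g C k B] measure_tilted[of M' X' g' C k B] M M' g g' k k'
      by (auto simp: k_def)
    then show ?thesis
      using k by simp
  qed
qed

lemma integrable_iexp_mult:
  fixes X :: "'a \<Rightarrow> real" and g :: "'a \<Rightarrow> complex"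
  assumes "prob_space M" and [measurable]: "X \<in> borel_measurable M" "g \<in> borel_measurable M"
    and g: "\<And>x. norm (g x) \<le> C"
  shows "integrable M (\<lambda>x. iexp (u * X x) * g x)"
proof -
  interpret prob_space M by fact
  show ?thesis
    by (rule integrable_const_bound[of _ C]) (auto simp: norm_mult g)
qed

text \<open>Adding the constant bound C makes the weight nonnegative. The assumption
  \<open>char\<close> takes care of the constant, whose contribution is subtracted again at the
  end.\<close>

lemma Levy_uniqueness_weighted_real:
  fixes X g :: "'a \<Rightarrow> real" and X' g' :: "'b \<Rightarrow> real"
  assumes M: "prob_space M" and [measurable]: "X \<in> borel_measurable M" "g \<in> borel_measurable M"
    and M': "prob_space M'" and [measurable]: "X' \<in> borel_measurable M'" "g' \<in> borel_measurable M'"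
    and g: "\<And>x. \<bar>g x\<bar> \<le> C" and g': "\<And>x. \<bar>g' x\<bar> \<le> C"
    and char: "\<And>u. (CLINT x|M. iexp (u * X x)) = (CLINT x|M'. iexp (u * X' x))"
    and eq: "\<And>u. (CLINT x|M. iexp (u * X x) * g x) = (CLINT x|M'. iexp (u * X' x) * g' x)"
    and [measurable]: "B \<in> sets borel"
  shows "(\<integral>x. indicator B (X x) * g x \<partial>M) = (\<integral>x. indicator B (X' x) * g' x \<partial>M')"
proof -
  interpret M: prob_space M by fact
  interpret M': prob_space M' by fact
  have C: "0 \<le> C"
    using g[of undefined] by linarith
  have 1: "(\<integral>x. indicator B (X x) * (g x + C) \<partial>M) = (\<integral>x. indicator B (X' x) * (g' x + C) \<partial>M')"
  proof (rule Levy_uniqueness_weighted_nonneg[where C = "2 * C"])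
    fix u
    note int = integrable_iexp_mult[of M X "\<lambda>x. of_real (g x)" C] integrable_iexp_mult[of M X "\<lambda>_. of_real C" C]
      integrable_iexp_mult[of M' X' "\<lambda>x. of_real (g' x)" C] integrable_iexp_mult[of M' X' "\<lambda>_. of_real C" C]
    show "(CLINT x|M. iexp (u * X x) * (g x + C)) = (CLINT x|M'. iexp (u * X' x) * (g' x + C))"
      unfolding of_real_add distrib_left using int M M' g g' C eq[of u] char[of u]
      by (simp)
  qed (use M M' g g' in \<open>auto simp: abs_le_iff add.commute minus_le_iff, auto simp: algebra_simps, smt+\<close>)
  have 2: "(\<integral>x. indicator B (X x) * C \<partial>M) = (\<integral>x. indicator B (X' x) * C \<partial>M')"
    by (rule Levy_uniqueness_weighted_nonneg[where C = C]) (use M M' C char in auto)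
  have i: "integrable M (\<lambda>x. indicator B (X x) * g x)" "integrable M (\<lambda>x. indicator B (X x) * C)"
    "integrable M' (\<lambda>x. indicator B (X' x) * g' x)" "integrable M' (\<lambda>x. indicator B (X' x) * C)"
    by (rule M.integrable_const_bound[of _ C] M'.integrable_const_bound[of _ C];
        use g g' C in \<open>auto simp: indicator_def\<close>)+
  show ?thesis
    using 1 2 unfolding distrib_left
    by (simp only: Bochner_Integration.integral_add i)
qed

lemma Levy_uniqueness_weighted:
  fixes X :: "'a \<Rightarrow> real" and X' :: "'b \<Rightarrow> real" and g :: "'a \<Rightarrow> complex" and g' :: "'b \<Rightarrow> complex"
  assumes M: "prob_space M" and [measurable]: "X \<in> borel_measurable M" "g \<in> borel_measurable M"
    and M': "prob_space M'" and [measurable]: "X' \<in> borel_measurable M'" "g' \<in> borel_measurable M'"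
    and g: "\<And>x. norm (g x) \<le> C" and g': "\<And>x. norm (g' x) \<le> C"
    and char: "\<And>u. (CLINT x|M. iexp (u * X x)) = (CLINT x|M'. iexp (u * X' x))"
    and eq: "\<And>u. (CLINT x|M. iexp (u * X x) * g x) = (CLINT x|M'. iexp (u * X' x) * g' x)"
    and [measurable]: "B \<in> sets borel"
  shows "(CLINT x|M. indicator B (X x) * g x) = (CLINT x|M'. indicator B (X' x) * g' x)"
proof -
  interpret M: prob_space M by fact
  interpret M': prob_space M' by fact
  \<comment> \<open>Real and imaginary part of the weight involve its conjugate too. The equation
    for the conjugate weight is the conjugate of the given one at -u.\<close>
  have cnj: "(CLINT x|M. iexp (u * X x) * cnj (g x)) = (CLINT x|M'. iexp (u * X' x) * cnj (g' x))" for u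
  proof -
    have c: "iexp (u * y) * cnj z = cnj (iexp (- u * y) * z)" for y z
      by (simp add: exp_cnj)
    show ?thesis
      unfolding c Bochner_Integration.integral_cnj eq ..
  qed
  note int = integrable_iexp_mult[of M X g C] integrable_iexp_mult[of M X "\<lambda>x. cnj (g x)" C]
    integrable_iexp_mult[of M' X' g' C] integrable_iexp_mult[of M' X' "\<lambda>x. cnj (g' x)" C]
  have Re: "complex_of_real (Re z) = (z + cnj z) / 2" and Im: "complex_of_real (Im z) = (z - cnj z) / (2 * \<i>)" for z
    by (auto simp: complex_eq_iff)
  have [measurable]: "(\<lambda>x. cnj (g x)) \<in> borel_measurable M" "(\<lambda>x. cnj (g' x)) \<in> borel_measurable M'"
    by (auto intro!: borel_measurable_continuous_on[of cnj] continuous_intros)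
  have r: "(\<integral>x. indicator B (X x) * Re (g x) \<partial>M) = (\<integral>x. indicator B (X' x) * Re (g' x) \<partial>M')"
  proof (rule Levy_uniqueness_weighted_real[where C = C])
    show "(CLINT x|M. iexp (u * X x) * Re (g x)) = (CLINT x|M'. iexp (u * X' x) * Re (g' x))" for u
      unfolding Re times_divide_eq_right distrib_left using int[of u] M M' g g' eq[of u] cnj[of u] by simp
  qed (use M M' char g g' order_trans[OF abs_Re_le_cmod] in auto)
  have i: "(\<integral>x. indicator B (X x) * Im (g x) \<partial>M) = (\<integral>x. indicator B (X' x) * Im (g' x) \<partial>M')"
  proof (rule Levy_uniqueness_weighted_real[where C = C])
    show "(CLINT x|M. iexp (u * X x) * Im (g x)) = (CLINT x|M'. iexp (u * X' x) * Im (g' x))" for u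
      unfolding Im times_divide_eq_right right_diff_distrib using int[of u] M M' g g' eq[of u] cnj[of u] by simp
  qed (use M M' char g g' order_trans[OF abs_Im_le_cmod] in auto)
  have ii: "integrable M (\<lambda>x. indicator B (X x) * g x)" "integrable M' (\<lambda>x. indicator B (X' x) * g' x)"
    by (rule M.integrable_const_bound[of _ C] M'.integrable_const_bound[of _ C];
        use g g' order_trans[OF norm_ge_zero g] in \<open>auto simp: indicator_def\<close>)+
  have I: "Re (indicator B y * z) = indicator B y * Re z" "Im (indicator B y * z) = indicator B y * Im z" for y z
    by (auto simp: indicator_def)
  show ?thesis
    by (simp only: complex_eq_iff integral_Re[OF ii(1), symmetric] integral_Re[OF ii(2), symmetric]
        integral_Im[OF ii(1), symmetric] integral_Im[OF ii(2), symmetric] I r i)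
qed

text \<open>Coordinates are converted one at a time from exponentials to indicators: the
  one-dimensional theorem is applied to a single coordinate while everything else, the indicators
  already obtained and the exponentials still pending, acts as a bounded complex weight.\<close>

lemma Levy_uniqueness_boxes:
  fixes X :: "'i \<Rightarrow> 'a \<Rightarrow> real" and X' :: "'i \<Rightarrow> 'b \<Rightarrow> real"
  assumes M: "prob_space M" and X[measurable]: "\<And>i. i \<in> I \<Longrightarrow> X i \<in> borel_measurable M"
    and M': "prob_space M'" and X'[measurable]: "\<And>i. i \<in> I \<Longrightarrow> X' i \<in> borel_measurable M'"
    and eq: "\<And>J v. finite J \<Longrightarrow> J \<subseteq> I \<Longrightarrow> (CLINT x|M. iexp (\<Sum>i\<in>J. v i * X i x)) = (CLINT x|M'. iexp (\<Sum>i\<in>J. v i * X' i x))"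
    and K: "finite K" "K \<subseteq> I" and B[measurable]: "\<And>i. i \<in> I \<Longrightarrow> B i \<in> sets borel"
  shows "measure M {x\<in>space M. \<forall>i\<in>K. X i x \<in> B i} = measure M' {x\<in>space M'. \<forall>i\<in>K. X' i x \<in> B i}"
proof -
  interpret M: prob_space M by fact
  interpret M': prob_space M' by fact
  have "(CLINT x|M. (\<Prod>i\<in>K. indicator (B i) (X i x)) * iexp (\<Sum>i\<in>J. v i * X i x))
     = (CLINT x|M'. (\<Prod>i\<in>K. indicator (B i) (X' i x)) * iexp (\<Sum>i\<in>J. v i * X' i x))"
    if "finite J" "J \<subseteq> I" "J \<inter> K = {}" for J v
    using K that
  proof (induction K arbitrary: J v rule: finite_induct)
    case empty
    then show ?case
      using eq by simp
  next
    case (insert k K)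
    let ?g = "\<lambda>x. (\<Prod>i\<in>K. indicator (B i) (X i x)) * iexp (\<Sum>i\<in>J. v i * X i x)"
    let ?g' = "\<lambda>x. (\<Prod>i\<in>K. indicator (B i) (X' i x)) * iexp (\<Sum>i\<in>J. v i * X' i x)"
    have meas[measurable]: "X k \<in> borel_measurable M" "X' k \<in> borel_measurable M'" "B k \<in> sets borel"
      using insert by auto
    have gm[measurable]: "?g \<in> borel_measurable M" "?g' \<in> borel_measurable M'"
      using insert.prems by (auto intro!: borel_measurable_times borel_measurable_prod
        borel_measurable_indicator' measurable_compose[OF _ borel_measurable_exp] borel_measurable_of_real
        borel_measurable_sum borel_measurable_const X X' B measurable_sets_borel)
    have "(CLINT x|M. indicator (B k) (X k x) * ?g x) = (CLINT x|M'. indicator (B k) (X' k x) * ?g' x)"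
    proof (rule Levy_uniqueness_weighted[where C = 1])
      fix u
      show "(CLINT x|M. iexp (u * X k x)) = (CLINT x|M'. iexp (u * X' k x))"
        using eq[of "{k}" "\<lambda>_. u"] insert.prems by simp
      have k: "k \<notin> J" using insert.prems by auto
      then have upd: "(\<Sum>i\<in>J. (if i = k then u else v i) * Z i) = (\<Sum>i\<in>J. v i * Z i)" for Z :: "'i \<Rightarrow> real"
        by (intro sum.cong) auto
      show "(CLINT x|M. iexp (u * X k x) * ?g x) = (CLINT x|M'. iexp (u * X' k x) * ?g' x)"
        \<comment> \<open>The induction hypothesis is taken with k put back among the exponentials,
          with coefficient u.\<close>
        using insert.IH[of "insert k J" "v(k := u)"] insert.prems insert.hyps k
        by (simp add: upd exp_add distrib_left mult.left_commute flip: of_real_mult of_real_sum)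
      show "norm (?g x) \<le> 1" "norm (?g' y) \<le> 1" for x y
        by (auto simp: norm_mult indicator_def simp flip: prod_norm intro!: prod_le_1)
    qed (rule M M' meas gm)+
    then show ?case
      using insert.hyps by (simp add: mult.assoc)
  qed
  from this[of "{}"] have 1: "(CLINT x|M. (\<Prod>i\<in>K. indicator (B i) (X i x))) = (CLINT x|M'. (\<Prod>i\<in>K. indicator (B i) (X' i x)))"
    by simp
  have ind: "(\<Prod>i\<in>K. indicator (B i) (Z i)) = complex_of_real (if \<forall>i\<in>K. Z i \<in> B i then 1 else 0)" for Z
    using K by (auto simp: indicator_def intro!: prod_zero prod.neutral)
  have 2: "(\<integral>x. (if \<forall>i\<in>K. X i x \<in> B i then 1 else 0 :: real) \<partial>M) = (\<integral>x. (if \<forall>i\<in>K. X' i x \<in> B i then 1 else 0) \<partial>M')"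
    using 1 unfolding ind integral_complex_of_real of_real_eq_iff .
  have 3: "(\<integral>x. (if \<forall>i\<in>K. X i x \<in> B i then 1 else 0 :: real) \<partial>M) = (\<integral>x. indicator {x\<in>space M. \<forall>i\<in>K. X i x \<in> B i} x \<partial>M)"
    by (intro Bochner_Integration.integral_cong) (auto simp: indicator_def)
  have 4: "(\<integral>x. (if \<forall>i\<in>K. X' i x \<in> B i then 1 else 0 :: real) \<partial>M') = (\<integral>x. indicator {x\<in>space M'. \<forall>i\<in>K. X' i x \<in> B i} x \<partial>M')"
    by (intro Bochner_Integration.integral_cong) (auto simp: indicator_def)
  show ?thesis
    using 2 unfolding 3 4 by (simp add: Int_absorb2[OF Collect_restrict])
qed

section \<open>The driving Poisson process\<close>

lemma expectation_power_poisson_pmf: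
  fixes a r :: real
  assumes r: "0 < r" and a: "0 \<le> a"
  shows "(\<integral>n. a ^ n \<partial>measure_pmf (poisson_pmf r)) = exp ((a - 1) * r)"
proof -
  have *: "(\<lambda>n. (r ^ n / fact n * exp (- r)) * a ^ n) = (\<lambda>n. exp (- r) * ((a * r) ^ n /\<^sub>R fact n))"
    by (auto simp: fun_eq_iff power_mult_distrib divide_inverse)
  have s: "(\<lambda>n. (r ^ n / fact n * exp (- r)) * a ^ n) sums (exp (- r) * exp (a * r))"
    unfolding * by (intro sums_mult exp_converges)
  have "(\<integral>n. a ^ n \<partial>measure_pmf (poisson_pmf r)) = (\<integral>n. (r ^ n / fact n * exp (- r)) * a ^ n \<partial>count_space UNIV)"
    using r unfolding measure_pmf_eq_density by (subst integral_density) auto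
  also have "\<dots> = (\<Sum>n. (r ^ n / fact n * exp (- r)) * a ^ n)"
    by (rule integral_count_space_nat)
       (use s r a in \<open>auto simp: integrable_count_space_nat_iff abs_mult dest: sums_summable\<close>)
  also have "\<dots> = exp ((a - 1) * r)"
    using s by (simp add: sums_iff exp_add[symmetric] algebra_simps)
  finally show ?thesis .
qed

lemma has_integral_two_over:
  fixes s t :: real
  assumes "0 < s" "s \<le> t"
  shows "((\<lambda>x. c * (2 / x)) has_integral c * (2 * ln (t / s))) {s..t}"
proof -
  have "((\<lambda>x. c * (2 / x)) has_integral c * (2 * ln t) - c * (2 * ln s)) {s..t}"
    by (rule fundamental_theorem_of_calculus)
       (use assms in \<open>auto intro!: derivative_eq_intros simp flip: has_real_derivative_iff_has_vector_derivative\<close>)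
  then show ?thesis
    using assms by (simp add: ln_div right_diff_distrib)
qed

locale laplace_clock = prob_space M for M :: "'a measure" +
  fixes \<eta> :: real and P :: "real \<Rightarrow> 'a \<Rightarrow> nat"
  assumes \<eta>: "0 < \<eta>" and poisson: "poisson_process M \<eta> (\<lambda>t. 2 / t) P"
begin

abbreviation "\<tau> \<equiv> jump_time \<eta> P"

lemma P_measurable: "\<eta> \<le> t \<Longrightarrow> P t \<in> measurable M (count_space UNIV)"
  using poisson by (auto simp: poisson_process_def)

lemma P_start: "\<omega> \<in> space M \<Longrightarrow> P \<eta> \<omega> = 0"
  using poisson by (auto simp: poisson_process_def)

lemma P_mono: "\<omega> \<in> space M \<Longrightarrow> \<eta> \<le> s \<Longrightarrow> s \<le> t \<Longrightarrow> P s \<omega> \<le> P t \<omega>"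
  using poisson by (auto simp: poisson_process_def mono_on_def)

lemma P_right_const:
  assumes "\<omega> \<in> space M" "\<eta> \<le> t"
  shows "\<forall>\<^sub>F s in at_right t. P s \<omega> = P t \<omega>"
  using poisson assms by (auto simp: poisson_process_def continuous_within tendsto_discrete)

text \<open>A right-continuous integer-valued path is constant just after the infimum, so the
  infimum is attained. The assumption \<open>ex\<close> says that level n is reached at all and
  keeps the infimum from ranging over the empty set.\<close>

lemma jump_time_le_iff:
  assumes \<omega>: "\<omega> \<in> space M" and ex: "\<eta> \<le> r" "n \<le> P r \<omega>" and t: "\<eta> \<le> t"
  shows "\<tau> n \<omega> \<le> t \<longleftrightarrow> n \<le> P t \<omega>"
proof (cases "n = 0")
  case True
  then show ?thesis using t by (simp add: jump_time_def)
next
  case False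
  define S where "S = {t. \<eta> \<le> t \<and> n \<le> P t \<omega>}"
  have S: "S \<noteq> {}" "bdd_below S"
    using ex by (auto simp: S_def bdd_below_def)
  have T: "\<tau> n \<omega> = Inf S"
    using False by (simp add: jump_time_def S_def)
  have ge: "\<eta> \<le> Inf S"
    using S by (intro cInf_greatest) (auto simp: S_def)
  have att: "n \<le> P (Inf S) \<omega>"
  proof (rule ccontr)
    assume n: "\<not> n \<le> P (Inf S) \<omega>"
    obtain e where e: "Inf S < e" "\<And>s. Inf S < s \<Longrightarrow> s < e \<Longrightarrow> P s \<omega> = P (Inf S) \<omega>"
      using P_right_const[OF \<omega> ge] by (auto simp: eventually_at_right_field)
    obtain s where s: "s \<in> S" "s < e"
      using cInf_lessD[OF S(1) e(1)] by auto
    moreover have "Inf S \<le> s"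
      using s S by (intro cInf_lower)
    ultimately show False
      using n e(2)[of s] by (cases "s = Inf S") (auto simp: S_def)
  qed
  show ?thesis
    unfolding T
  proof
    assume "Inf S \<le> t"
    then show "n \<le> P t \<omega>"
      using P_mono[OF \<omega> ge] att by force
  next
    assume "n \<le> P t \<omega>"
    then show "Inf S \<le> t"
      using t S by (intro cInf_lower) (auto simp: S_def)
  qed
qed

lemma jump_time_ge:
  assumes \<omega>: "\<omega> \<in> space M" and ex: "\<eta> \<le> r" "n \<le> P r \<omega>"
  shows "\<eta> \<le> \<tau> n \<omega>"
proof (cases "n = 0")
  case False
  then show ?thesis
    using ex by (auto simp: jump_time_def intro!: cInf_greatest)
qed (simp add: jump_time_def)

lemma jump_time_gt:
  assumes \<omega>: "\<omega> \<in> space M" and "1 \<le> n" "\<eta> \<le> r" "n \<le> P r \<omega>"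
  shows "\<eta> < \<tau> n \<omega>"
  using jump_time_le_iff[OF \<omega> assms(3,4), of \<eta>] jump_time_ge[OF \<omega> assms(3,4)] P_start[OF \<omega>] assms(2)
  by (auto simp: less_le)

lemma distr_increment:
  assumes "\<eta> \<le> s" "s < t"
  shows "distr M (count_space UNIV) (\<lambda>\<omega>. P t \<omega> - P s \<omega>) = measure_pmf (poisson_pmf (2 * ln (t / s)))"
proof -
  have "integral {s..t} (\<lambda>t. 2 / t) = 2 * ln (t / s)"
    using has_integral_two_over[of s t 1] assms \<eta> by (simp add: integral_unique)
  then show ?thesis
    using poisson assms by (auto simp: poisson_process_def)
qed

lemma AE_P_unbounded: "AE \<omega> in M. \<forall>n. \<exists>t\<ge>\<eta>. n \<le> P t \<omega>"
  unfolding AE_all_countable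
proof
  fix n
  \<comment> \<open>By the intensity 2/t, the mean number of jumps up to this time is 2 ln (t k /
    \<eta>) = k + 1, and Poisson laws of growing mean give vanishing mass to
    \<open>{..<n}\<close>.\<close>
  define t where "t k = \<eta> * exp (real (Suc k) / 2)" for k
  have t: "\<eta> < t k" for k
    using \<eta> by (simp add: t_def)
  have [measurable]: "P (t k) \<in> measurable M (count_space UNIV)" for k
    using t[of k] by (intro P_measurable) simp
  have meas: "prob {\<omega>\<in>space M. P (t k) \<omega> < n} = (\<Sum>j<n. real (Suc k) ^ j / exp (real (Suc k)) / fact j)" for k
  proof -
    have [measurable]: "(\<lambda>\<omega>. P (t k) \<omega> - P \<eta> \<omega>) \<in> measurable M (count_space UNIV)"
      by (rule measurable_cong[THEN iffD1, of _ "P (t k)"]) (auto simp: P_start)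
    have "prob {\<omega>\<in>space M. P (t k) \<omega> < n} = measure (distr M (count_space UNIV) (\<lambda>\<omega>. P (t k) \<omega> - P \<eta> \<omega>)) {..<n}"
      by (subst measure_distr) (auto simp: P_start intro!: arg_cong[where f = prob])
    also have "\<dots> = measure (measure_pmf (poisson_pmf (real (Suc k)))) {..<n}"
    proof -
      have "2 * ln (t k / \<eta>) = real (Suc k)"
        using \<eta> by (simp add: t_def field_simps)
      then show ?thesis
        using distr_increment[OF order_refl t] by simp
    qed
    also have "\<dots> = (\<Sum>j<n. real (Suc k) ^ j / exp (real (Suc k)) / fact j)"
      by (simp add: measure_measure_pmf_finite divide_inverse mult_ac flip: exp_minus)
    finally show ?thesis .
  qed
  have "(\<lambda>k. prob {\<omega>\<in>space M. P (t k) \<omega> < n}) \<longlonglongrightarrow> (\<Sum>j<n. 0 / fact j)"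
    unfolding meas
  proof (intro tendsto_sum tendsto_divide tendsto_const)
    fix j
    show "(\<lambda>k. real (Suc k) ^ j / exp (real (Suc k))) \<longlonglongrightarrow> 0"
      by (rule filterlim_compose[OF tendsto_power_div_exp_0])
         (rule filterlim_compose[OF filterlim_real_sequentially filterlim_Suc])
  qed auto
  then have lim: "(\<lambda>k. prob {\<omega>\<in>space M. P (t k) \<omega> < n}) \<longlonglongrightarrow> 0"
    by simp
  define N where "N = {\<omega>\<in>space M. \<forall>k. P (t k) \<omega> < n}"
  have [measurable]: "N \<in> events"
    unfolding N_def by measurable
  have "prob N \<le> 0"
  proof (rule LIMSEQ_le_const[OF lim], intro exI allI impI)
    fix k
    show "prob N \<le> prob {\<omega>\<in>space M. P (t k) \<omega> < n}"
      by (intro finite_measure_mono) (auto simp: N_def)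
  qed
  then have "N \<in> null_sets M"
    by (simp add: null_sets_def emeasure_eq_measure measure_le_0_iff)
  then have "AE \<omega> in M. \<omega> \<notin> N"
    by (rule AE_not_in)
  then show "AE \<omega> in M. \<exists>t\<ge>\<eta>. n \<le> P t \<omega>"
    using AE_space
  proof eventually_elim
    case (elim \<omega>)
    then obtain k where "n \<le> P (t k) \<omega>"
      by (auto simp: N_def not_less)
    then show ?case
      using t[of k] by (auto intro!: exI[of _ "t k"])
  qed
qed

lemma jump_time_measurable [measurable]: "\<tau> n \<in> borel_measurable M"
proof (rule borel_measurableI_le)
  fix t
  have meas: "{\<omega>\<in>space M. n \<le> P r \<omega>} \<in> events" if "\<eta> \<le> r" for r
    using P_measurable[OF that] by measurable
  \<comment> \<open>Paths are monotone, so whether level n is ever reached can be decided at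
    countably many times.\<close>
  define E where "E = {\<omega>\<in>space M. \<exists>k::nat. n \<le> P (\<eta> + k) \<omega>}"
  have E: "E \<in> events"
    unfolding E_def using meas[of "\<eta> + real k" for k] by (intro sets.sets_Collect_countable_Ex) auto
  have ex: "\<omega> \<in> E \<longleftrightarrow> (\<exists>r\<ge>\<eta>. n \<le> P r \<omega>)" if "\<omega> \<in> space M" for \<omega>
  proof
    assume "\<exists>r\<ge>\<eta>. n \<le> P r \<omega>"
    then obtain r where r: "\<eta> \<le> r" "n \<le> P r \<omega>" by auto
    have "r \<le> \<eta> + real (nat \<lceil>r - \<eta>\<rceil>)"
      by linarith
    then have "P r \<omega> \<le> P (\<eta> + real (nat \<lceil>r - \<eta>\<rceil>)) \<omega>"
      using r that by (intro P_mono)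
    then show "\<omega> \<in> E"
      using r that unfolding E_def by (blast intro: order_trans)
  next
    assume "\<omega> \<in> E"
    then obtain k :: nat where "n \<le> P (\<eta> + real k) \<omega>"
      by (auto simp: E_def)
    then show "\<exists>r\<ge>\<eta>. n \<le> P r \<omega>"
      by (intro exI[of _ "\<eta> + real k"]) simp
  qed
  \<comment> \<open>Where level n is never reached, the jump time is the infimum of the empty set,
    some fixed real number.\<close>
  define c where "c = (if n = 0 then \<eta> else Inf {})"
  have "{\<omega>\<in>space M. \<tau> n \<omega> \<le> t} =
    (if \<eta> \<le> t then {\<omega>\<in>space M. n \<le> P t \<omega>} else {}) \<union> (if c \<le> t then space M - E else {})"
  proof (intro set_eqI)
    fix \<omega>
    show "\<omega> \<in> {\<omega>\<in>space M. \<tau> n \<omega> \<le> t} \<longleftrightarrow> \<omega> \<in> (if \<eta> \<le> t then {\<omega>\<in>space M. n \<le> P t \<omega>} else {}) \<union> (if c \<le> t then space M - E else {})"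
    proof (cases "\<omega> \<in> space M")
      case sp: True
      show ?thesis
      proof (cases "\<omega> \<in> E")
        case True
        then obtain r where r: "\<eta> \<le> r" "n \<le> P r \<omega>"
          using ex[OF sp] by auto
        show ?thesis
          using jump_time_le_iff[OF sp r, of t] jump_time_ge[OF sp r] True sp by auto
      next
        case False
        then have no: "\<not> n \<le> P r \<omega>" if "\<eta> \<le> r" for r
          using ex[OF sp] that by auto
        have "{t. \<eta> \<le> t \<and> n \<le> P t \<omega>} = {}"
          using no by auto
        moreover have "n \<noteq> 0"
          using no[OF order_refl] by auto
        ultimately have "\<tau> n \<omega> = c"
          by (simp only: jump_time_def c_def if_False)
        then show ?thesis
          using False sp no by auto
      qed
    qed auto
  qed
  also have "\<dots> \<in> events"
    using meas E by auto
  finally show "{\<omega>\<in>space M. \<tau> n \<omega> \<le> t} \<in> events" .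
qed

section \<open>Products over the jump times: grid approximation and the exponential formula\<close>

lemma expectation_power_increment:
  assumes "\<eta> \<le> s" "s < t" "0 \<le> a"
  shows "(\<integral>\<omega>. a ^ (P t \<omega> - P s \<omega>) \<partial>M) = exp ((a - 1) * (2 * ln (t / s)))"
proof -
  have [measurable]: "P t \<in> measurable M (count_space UNIV)" "P s \<in> measurable M (count_space UNIV)"
    using assms by (auto intro: P_measurable)
  have m: "(\<lambda>\<omega>. P t \<omega> - P s \<omega>) \<in> measurable M (count_space UNIV)"
    by measurable
  have "(\<integral>\<omega>. a ^ (P t \<omega> - P s \<omega>) \<partial>M) = (\<integral>n. a ^ n \<partial>distr M (count_space UNIV) (\<lambda>\<omega>. P t \<omega> - P s \<omega>))"
    by (rule integral_distr[OF m, symmetric]) simp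
  also have "\<dots> = exp ((a - 1) * (2 * ln (t / s)))"
    unfolding distr_increment[OF assms(1,2)]
    by (rule expectation_power_poisson_pmf) (use assms \<eta> in auto)
  finally show ?thesis .
qed

lemma expectation_prod_power_increments:
  fixes t :: "nat \<Rightarrow> real" and a :: "nat \<Rightarrow> real"
  assumes t: "\<eta> \<le> t 0" "strict_mono t" and a: "\<And>k. 0 \<le> a k" "\<And>k. a k \<le> 1"
  shows "(\<integral>\<omega>. (\<Prod>k<m. a k ^ (P (t (Suc k)) \<omega> - P (t k) \<omega>)) \<partial>M) = exp (\<Sum>k<m. (a k - 1) * (2 * ln (t (Suc k) / t k)))"
proof -
  have t_ge: "\<eta> \<le> t k" for k
    using t strict_mono_less_eq[of t 0 k] by auto
  have "indep_vars (\<lambda>_. count_space UNIV) (\<lambda>k \<omega>. P (t (Suc k)) \<omega> - P (t k) \<omega>) {..<m}"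
    using poisson t strict_mono_mono[of t] by (auto simp: poisson_process_def)
  then have ind: "indep_vars (\<lambda>_. borel) (\<lambda>k \<omega>. a k ^ (P (t (Suc k)) \<omega> - P (t k) \<omega>)) {..<m}"
    by (rule indep_vars_compose2) simp
  have [measurable]: "P (t k) \<in> measurable M (count_space UNIV)" for k
    by (rule P_measurable[OF t_ge])
  have "(\<integral>\<omega>. (\<Prod>k<m. a k ^ (P (t (Suc k)) \<omega> - P (t k) \<omega>)) \<partial>M)
    = (\<Prod>k<m. \<integral>\<omega>. a k ^ (P (t (Suc k)) \<omega> - P (t k) \<omega>) \<partial>M)"
    by (rule indep_vars_lebesgue_integral[OF _ ind])
       (auto intro!: integrable_const_bound[of _ 1] simp: a power_le_one)
  also have "\<dots> = (\<Prod>k<m. exp ((a k - 1) * (2 * ln (t (Suc k) / t k))))"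
    using t t_ge a by (intro prod.cong refl expectation_power_increment) (auto simp: strict_mono_Suc_iff)
  also have "\<dots> = exp (\<Sum>k<m. (a k - 1) * (2 * ln (t (Suc k) / t k)))"
    by (simp add: exp_sum)
  finally show ?thesis .
qed

text \<open>The jumps in the cell (t k, t (k+1)] are those with index j in (P (t k), P (t (k+1))],
  and l rounds each of them down to t k. A product over jumps becomes a product of powers of
  increments, to which independence applies.\<close>

lemma prod_jump_times_grid:
  fixes t :: "nat \<Rightarrow> real" and h :: "real \<Rightarrow> real"
  assumes t: "t 0 = \<eta>" "mono t" and \<omega>: "\<omega> \<in> space M"
    and l: "\<And>k x. k < m \<Longrightarrow> t k < x \<Longrightarrow> x \<le> t (Suc k) \<Longrightarrow> l x = t k"
  shows "(\<Prod>j=1..P (t m) \<omega>. h (l (\<tau> j \<omega>))) = (\<Prod>k<m. h (t k) ^ (P (t (Suc k)) \<omega> - P (t k) \<omega>))"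
  using l
proof (induction m)
  case 0
  then show ?case
    using P_start[OF \<omega>] t by simp
next
  case (Suc m)
  have ge: "\<eta> \<le> t k" for k
    using t monoD[of t 0 k] by auto
  have le: "P (t m) \<omega> \<le> P (t (Suc m)) \<omega>"
    using ge t by (intro P_mono \<omega>) (auto simp: mono_iff_le_Suc)
  have "(\<Prod>j\<in>{P (t m) \<omega><..P (t (Suc m)) \<omega>}. h (l (\<tau> j \<omega>))) = (\<Prod>j\<in>{P (t m) \<omega><..P (t (Suc m)) \<omega>}. h (t m))"
  proof (intro prod.cong refl)
    fix j assume j: "j \<in> {P (t m) \<omega><..P (t (Suc m)) \<omega>}"
    then have "t m < \<tau> j \<omega>" "\<tau> j \<omega> \<le> t (Suc m)"
      using jump_time_le_iff[OF \<omega> ge, of j "Suc m"] ge by (auto simp: not_le[symmetric])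
    then show "h (l (\<tau> j \<omega>)) = h (t m)"
      using Suc.prems[of m "\<tau> j \<omega>"] by simp
  qed
  moreover have "{1..P (t (Suc m)) \<omega>} = {1..P (t m) \<omega>} \<union> {P (t m) \<omega><..P (t (Suc m)) \<omega>}"
    using le by auto
  then have "(\<Prod>j=1..P (t (Suc m)) \<omega>. h (l (\<tau> j \<omega>))) =
    (\<Prod>j=1..P (t m) \<omega>. h (l (\<tau> j \<omega>))) * (\<Prod>j\<in>{P (t m) \<omega><..P (t (Suc m)) \<omega>}. h (l (\<tau> j \<omega>)))"
    by (simp only:) (rule prod.union_disjoint; auto)
  ultimately show ?case
    using Suc.IH Suc.prems by simp
qed

text \<open>Cells are open on the left, so \<eta> lies in none of them and l is not controlled
  there; the integrand is set to 0 at that point.\<close>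

lemma has_integral_grid:
  fixes t :: "nat \<Rightarrow> real" and h :: "real \<Rightarrow> real"
  assumes t: "t 0 = \<eta>" "mono t"
    and l: "\<And>k x. k < m \<Longrightarrow> t k < x \<Longrightarrow> x \<le> t (Suc k) \<Longrightarrow> l x = t k"
  shows "((\<lambda>x. if x = \<eta> then 0 else (h (l x) - 1) * (2 / x)) has_integral (\<Sum>k<m. (h (t k) - 1) * (2 * ln (t (Suc k) / t k)))) {\<eta>..t m}"
  using l
proof (induction m)
  case 0
  then show ?case
    using t by (simp add: has_integral_refl)
next
  case (Suc m)
  have ge: "\<eta> \<le> t k" for k
    using t monoD[of t 0 k] by auto
  have le: "t m \<le> t (Suc m)"
    using t by (auto simp: mono_iff_le_Suc)
  have "((\<lambda>x. (h (t m) - 1) * (2 / x)) has_integral (h (t m) - 1) * (2 * ln (t (Suc m) / t m))) {t m..t (Suc m)}"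
    using ge[of m] \<eta> le by (intro has_integral_two_over) auto
  then have piece: "((\<lambda>x. if x = \<eta> then 0 else (h (l x) - 1) * (2 / x)) has_integral (h (t m) - 1) * (2 * ln (t (Suc m) / t m))) {t m..t (Suc m)}"
  proof (rule has_integral_spike_finite[where S = "{t m, \<eta>}", rotated 2])
    fix x assume "x \<in> {t m..t (Suc m)} - {t m, \<eta>}"
    then show "(if x = \<eta> then 0 else (h (l x) - 1) * (2 / x)) = (h (t m) - 1) * (2 / x)"
      using Suc.prems[of m x] by simp
  qed simp
  have "((\<lambda>x. if x = \<eta> then 0 else (h (l x) - 1) * (2 / x)) has_integral (\<Sum>k<m. (h (t k) - 1) * (2 * ln (t (Suc k) / t k)))) {\<eta>..t m}"
    by (rule Suc.IH) (use Suc.prems in simp)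
  from has_integral_combine[OF ge[of m] le this piece] show ?case
    by simp
qed

text \<open>Left endpoints are used because the jump times may sit at a discontinuity of \<open>h\<close>, which
  is only assumed to be left-continuous.\<close>

lemma exponential_formula:
  fixes h :: "real \<Rightarrow> real"
  assumes b: "\<eta> < b" and h: "\<And>x. 0 \<le> h x" "\<And>x. h x \<le> 1"
    and lc: "\<And>x. \<eta> < x \<Longrightarrow> x \<le> b \<Longrightarrow> (h \<longlongrightarrow> h x) (at_left x)"
  shows "(\<integral>\<omega>. (\<Prod>j=1..P b \<omega>. h (\<tau> j \<omega>)) \<partial>M) = exp (integral {\<eta>..b} (\<lambda>x. (h x - 1) * (2 / x)))"
    and exponential_formula_integrable: "(\<lambda>x. (h x - 1) * (2 / x)) integrable_on {\<eta>..b}"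
    and exponential_formula_measurable: "(\<lambda>\<omega>. \<Prod>j=1..P b \<omega>. h (\<tau> j \<omega>)) \<in> borel_measurable M"
proof -
  define \<delta> where "\<delta> m = (b - \<eta>) / real (Suc m)" for m
  define t where "t m k = \<eta> + real k * \<delta> m" for m k
  \<comment> \<open>Left endpoint of the cell (t k, t (k+1)] containing x: ceiling minus 1, so that
    a grid point belongs to the cell that it closes.\<close>
  define l where "l m x = \<eta> + (\<lceil>(x - \<eta>) / \<delta> m\<rceil> - 1) * \<delta> m" for m x
  have \<delta>: "0 < \<delta> m" for m
    using b by (simp add: \<delta>_def)
  have \<delta>_lim: "\<delta> \<longlonglongrightarrow> 0"
    unfolding \<delta>_def by real_asymp
  have t: "t m 0 = \<eta>" "t m (Suc m) = b" "strict_mono (t m)" for m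
  proof -
    show "t m 0 = \<eta>"
      by (simp add: t_def)
    show "t m (Suc m) = b"
      unfolding t_def \<delta>_def by (simp del: of_nat_Suc)
    show "strict_mono (t m)"
      unfolding strict_mono_Suc_iff t_def using \<delta>[of m] by (simp add: distrib_right)
  qed
  have mono: "mono (t m)" for m
    using t(3) by (rule strict_mono_mono)
  have l: "l m x = t m k" if "t m k < x" "x \<le> t m (Suc k)" for m k x
  proof -
    have "real k < (x - \<eta>) / \<delta> m" "(x - \<eta>) / \<delta> m \<le> real k + 1"
      using that \<delta>[of m] by (auto simp: t_def field_simps)
    then have "\<lceil>(x - \<eta>) / \<delta> m\<rceil> = int k + 1"
      by (simp add: ceiling_eq_iff)
    then show ?thesis
      by (simp add: l_def t_def)
  qed
  have l_less: "l m x < x" and l_ge: "x - \<delta> m \<le> l m x" for m x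
  proof -
    define y where "y = (x - \<eta>) / \<delta> m"
    have x: "x = \<eta> + y * \<delta> m"
      using \<delta>[of m] by (simp add: y_def)
    have "(\<lceil>y\<rceil> - 1) * \<delta> m < y * \<delta> m" "(y - 1) * \<delta> m \<le> (\<lceil>y\<rceil> - 1) * \<delta> m"
      using \<delta>[of m] by (intro mult_strict_right_mono mult_right_mono; linarith)+
    then show "l m x < x" "x - \<delta> m \<le> l m x"
      unfolding l_def y_def[symmetric] by (subst x, simp add: algebra_simps)+
  qed
  \<comment> \<open>The rounded point stays strictly below x even when x is a grid point, so
    left-continuity of h is enough for the limit.\<close>
  have l_lim: "filterlim (\<lambda>m. l m x) (at_left x) sequentially" for x
    unfolding filterlim_at
  proof
    show "(\<lambda>m. l m x) \<longlonglongrightarrow> x"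
    proof (rule tendsto_sandwich)
      show "(\<lambda>m. x - \<delta> m) \<longlonglongrightarrow> x"
        using tendsto_diff[OF tendsto_const \<delta>_lim, of x] by simp
    qed (use l_less l_ge in \<open>auto intro!: always_eventually less_imp_le\<close>)
  qed (use l_less in \<open>auto simp: less_le\<close>)
  have h_lim: "(\<lambda>m. h (l m x)) \<longlonglongrightarrow> h x" if "\<eta> < x" "x \<le> b" for x
    by (rule filterlim_compose[OF lc[OF that] l_lim])
  have [measurable]: "P (t m k) \<in> measurable M (count_space UNIV)" for m k
    using \<delta>[of m] by (intro P_measurable) (simp add: t_def)
  define F where "F m \<omega> = (\<Prod>k<Suc m. h (t m k) ^ (P (t m (Suc k)) \<omega> - P (t m k) \<omega>))" for m \<omega>
  have [measurable]: "F m \<in> borel_measurable M" for m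
    unfolding F_def by measurable
  have F: "F m \<omega> = (\<Prod>j=1..P b \<omega>. h (l m (\<tau> j \<omega>)))" if "\<omega> \<in> space M" for m \<omega>
    unfolding F_def using prod_jump_times_grid[where t = "t m" and m = "Suc m" and l = "l m" and h = h, OF t(1) mono that] l by (simp add: t)
  have F_lim: "(\<lambda>m. F m \<omega>) \<longlonglongrightarrow> (\<Prod>j=1..P b \<omega>. h (\<tau> j \<omega>))" if "\<omega> \<in> space M" for \<omega>
  proof -
    have "(\<lambda>m. \<Prod>j=1..P b \<omega>. h (l m (\<tau> j \<omega>))) \<longlonglongrightarrow> (\<Prod>j=1..P b \<omega>. h (\<tau> j \<omega>))"
    proof (intro tendsto_prod h_lim)
      fix j assume j: "j \<in> {1..P b \<omega>}"
      show "\<eta> < \<tau> j \<omega>" "\<tau> j \<omega> \<le> b"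
        using jump_time_gt[OF that, of j b] jump_time_le_iff[OF that, of b j b] j b by auto
    qed
    then show ?thesis
      using F[OF that] by simp
  qed
  have F_bd: "0 \<le> F m \<omega>" "F m \<omega> \<le> 1" for m \<omega>
    unfolding F_def using h
    by (intro prod_nonneg prod_le_1; auto intro: power_le_one)+
  show meas: "(\<lambda>\<omega>. \<Prod>j=1..P b \<omega>. h (\<tau> j \<omega>)) \<in> borel_measurable M"
    by (rule borel_measurable_LIMSEQ_real[where u = F]) (use F_lim in auto)
  have 1: "(\<lambda>m. \<integral>\<omega>. F m \<omega> \<partial>M) \<longlonglongrightarrow> (\<integral>\<omega>. (\<Prod>j=1..P b \<omega>. h (\<tau> j \<omega>)) \<partial>M)"
    by (rule integral_dominated_convergence[where w = "\<lambda>_. 1"]) (use F_lim F_bd meas in auto)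
  define G where "G m = (\<lambda>x. if x = \<eta> then 0 else (h (l m x) - 1) * (2 / x))" for m
  define g where "g = (\<lambda>x. if x = \<eta> then 0 else (h x - 1) * (2 / x))"
  have G: "(G m has_integral (\<Sum>k<Suc m. (h (t m k) - 1) * (2 * ln (t m (Suc k) / t m k)))) {\<eta>..b}" for m
    using has_integral_grid[where t = "t m" and m = "Suc m" and l = "l m" and h = h, OF t(1) mono] l by (simp add: G_def t(2))
  have D1: "G m integrable_on {\<eta>..b}" for m
    using G[of m] by blast
  have D2: "(\<lambda>x. 1 * (2 / x)) integrable_on {\<eta>..b}"
    using has_integral_two_over[of \<eta> b 1] \<eta> b by (metis less_imp_le has_integral_integrable)
  \<comment> \<open>Since h lies in [0, 1], the factor h - 1 has absolute value at most 1, which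
    gives the integrable majorant 2/x.\<close>
  have D3: "norm (G m x) \<le> 1 * (2 / x)" if "x \<in> {\<eta>..b}" for m x
  proof -
    have "\<bar>h (l m x) - 1\<bar> * (2 / x) \<le> 1 * (2 / x)"
      using h[of "l m x"] that \<eta> by (intro mult_right_mono) auto
    moreover have "\<bar>2 / x\<bar> = 2 / x"
      using that \<eta> by simp
    ultimately show ?thesis
      using that \<eta> unfolding G_def real_norm_def
      by (cases "x = \<eta>") (simp, simp only: if_False abs_mult)
  qed
  have D4: "(\<lambda>m. G m x) \<longlonglongrightarrow> g x" if "x \<in> {\<eta>..b}" for x
    using that \<eta> unfolding G_def g_def by (cases "x = \<eta>") (auto intro!: tendsto_intros h_lim)
  note gl = dominated_convergence[where f = G and S = "{\<eta>..b}", OF D1 D2 D3 D4]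
  have gi: "(g has_integral i) {\<eta>..b} \<longleftrightarrow> ((\<lambda>x. (h x - 1) * (2 / x)) has_integral i) {\<eta>..b}" for i
    by (rule has_integral_spike_eq[of "{\<eta>}"]) (auto simp: g_def)
  show "(\<lambda>x. (h x - 1) * (2 / x)) integrable_on {\<eta>..b}"
    using gl(1) gi by (auto simp: integrable_on_def)
  have g_eq: "integral {\<eta>..b} (\<lambda>x. (h x - 1) * (2 / x)) = integral {\<eta>..b} g"
    using gl(1) gi by (intro integral_unique) (auto simp: has_integral_integral)
  have "(\<integral>\<omega>. F m \<omega> \<partial>M) = exp (integral {\<eta>..b} (G m))" for m
    unfolding F_def using G[of m] t h
    by (subst expectation_prod_power_increments) (auto simp: integral_unique)
  then have "(\<lambda>m. \<integral>\<omega>. F m \<omega> \<partial>M) \<longlonglongrightarrow> exp (integral {\<eta>..b} g)"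
    using tendsto_exp[OF gl(2)] by simp
  from LIMSEQ_unique[OF 1 this] show "(\<integral>\<omega>. (\<Prod>j=1..P b \<omega>. h (\<tau> j \<omega>)) \<partial>M) = exp (integral {\<eta>..b} (\<lambda>x. (h x - 1) * (2 / x)))"
    unfolding g_eq .
qed

end

section \<open>The univariate Laplace process\<close>

locale laplace_path = laplace_clock M \<eta> P for M :: "'a measure" and \<eta> P +
  fixes Y :: "nat \<Rightarrow> 'a \<Rightarrow> real"
  assumes jumps: "laplace_jumps M \<eta> P Y"
begin

lemma Y_measurable [measurable]: "Y n \<in> borel_measurable M"
  using jumps by (simp add: laplace_jumps_def)

lemma AE_jump_time_pos: "AE \<omega> in M. \<forall>n. 0 < \<tau> n \<omega>"
  using AE_P_unbounded AE_space
proof eventually_elim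
  case (elim \<omega>)
  then show ?case
    using \<eta> jump_time_ge by (metis order_less_le_trans)
qed

lemma subalgebra_jump_times: "subalgebra M (generated_sigma M \<tau> UNIV)"
  unfolding subalgebra_def generated_sigma_def
  by (auto intro!: sets.sigma_sets_subset simp: space_measure_of_conv sets_measure_of_conv)

text \<open>Integrates the defining conditional probabilities over an event of the jump-time
  sigma-algebra; such boxes suffice to identify the joint law of times and jumps.\<close>

lemma prob_jump_boxes:
  fixes D B :: "nat \<Rightarrow> real set"
  assumes [measurable]: "\<And>n. D n \<in> sets borel" "\<And>n. B n \<in> sets borel"
  shows "prob {\<omega>\<in>space M. \<forall>n\<le>m. \<tau> n \<omega> \<in> D n \<and> Y n \<omega> \<in> B n}
    = (\<integral>\<omega>. indicator {\<omega>\<in>space M. \<forall>n\<le>m. \<tau> n \<omega> \<in> D n} \<omega> * (\<Prod>n\<le>m. measure (Lap (\<tau> n \<omega>)) (B n)) \<partial>M)"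
proof -
  let ?F = "generated_sigma M \<tau> UNIV"
  interpret F: finite_measure_subalgebra M ?F
    by unfold_locales (rule subalgebra_jump_times)
  let ?A = "{\<omega>\<in>space M. \<forall>n\<le>m. \<tau> n \<omega> \<in> D n}"
  let ?C = "{\<omega>\<in>space M. \<forall>n\<le>m. Y n \<omega> \<in> B n}"
  have sp: "space ?F = space M"
    by (simp add: generated_sigma_def space_measure_of_conv)
  have "{\<omega>\<in>space ?F. \<forall>n\<in>{..m}. \<tau> n \<omega> \<in> D n} \<in> sets ?F"
  proof (rule sets.sets_Collect_finite_All)
    fix n
    have "\<tau> n -` D n \<inter> space M \<in> sigma_sets (space M) (\<Union>n\<in>UNIV. {\<tau> n -` B \<inter> space M |B. B \<in> sets borel})"
      by (rule sigma_sets.Basic) (use assms(1) in blast)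
    moreover have "{\<omega>\<in>space ?F. \<tau> n \<omega> \<in> D n} = \<tau> n -` D n \<inter> space M"
      by (auto simp: sp)
    ultimately show "{\<omega>\<in>space ?F. \<tau> n \<omega> \<in> D n} \<in> sets ?F"
      by (auto simp: generated_sigma_def sets_measure_of_conv)
  qed simp
  moreover have "{\<omega>\<in>space ?F. \<forall>n\<in>{..m}. \<tau> n \<omega> \<in> D n} = ?A"
    by (auto simp: sp)
  ultimately have A: "?A \<in> sets ?F"
    by (simp only:)
  then have A'[measurable]: "?A \<in> events"
    using subalgebra_jump_times unfolding subalgebra_def by blast
  have C[measurable]: "?C \<in> events"
    by measurable
  have "prob {\<omega>\<in>space M. \<forall>n\<le>m. \<tau> n \<omega> \<in> D n \<and> Y n \<omega> \<in> B n} = (LINT \<omega>:?A|M. indicator ?C \<omega>)"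
    unfolding set_lebesgue_integral_def
    by (subst Bochner_Integration.integral_cong[of M M _ "indicator {\<omega>\<in>space M. \<forall>n\<le>m. \<tau> n \<omega> \<in> D n \<and> Y n \<omega> \<in> B n}"])
       (auto simp: indicator_def Int_absorb2[OF Collect_restrict])
  also have "\<dots> = (LINT \<omega>:?A|M. real_cond_exp M ?F (indicator ?C) \<omega>)"
    by (rule F.real_cond_exp_intA[OF integrable_real_indicator[OF C] A]) (simp add: emeasure_eq_measure)
  also have "\<dots> = (\<integral>\<omega>. indicator ?A \<omega> * (\<Prod>n\<le>m. measure (Lap (\<tau> n \<omega>)) (B n)) \<partial>M)"
    unfolding set_lebesgue_integral_def real_scaleR_def
  proof (rule integral_cong_AE)
    have "AE \<omega> in M. real_cond_exp M ?F (indicator ?C) \<omega> = (\<Prod>n\<le>m. measure (Lap (\<tau> n \<omega>)) (B n))"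
      using jumps assms by (auto simp: laplace_jumps_def)
    then show eq: "AE \<omega> in M. indicator ?A \<omega> * real_cond_exp M ?F (indicator ?C) \<omega> =
      indicator ?A \<omega> * (\<Prod>n\<le>m. measure (Lap (\<tau> n \<omega>)) (B n))"
      by eventually_elim simp
    have "(\<lambda>\<omega>. measure (Lap (\<tau> n \<omega>)) (B n)) \<in> borel_measurable M" for n
      by (rule borel_measurable_measure_Lap) measurable
    then show "(\<lambda>\<omega>. indicator ?A \<omega> * (\<Prod>n\<le>m. measure (Lap (\<tau> n \<omega>)) (B n))) \<in> borel_measurable M"
      by measurable
  qed simp
  finally show ?thesis .
qed

text \<open>The index \<open>(True, n)\<close> carries the \<open>n\<close>-th jump time and \<open>(False, n)\<close> the \<open>n\<close>-th jump.\<close>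

lemma distr_jumps:
  fixes m :: nat
  defines "I \<equiv> UNIV \<times> {..m}" and "L \<equiv> PiM {..m} (\<lambda>_. Lap 1)"
  shows "distr M (PiM I (\<lambda>_. borel)) (\<lambda>\<omega>. \<lambda>i\<in>I. if fst i then \<tau> (snd i) \<omega> else Y (snd i) \<omega>) =
    distr (M \<Otimes>\<^sub>M L) (PiM I (\<lambda>_. borel)) (\<lambda>(\<omega>, l). \<lambda>i\<in>I. if fst i then \<tau> (snd i) \<omega> else \<tau> (snd i) \<omega> * l (snd i))"
    (is "distr M ?B ?W = distr _ _ ?W'")
proof (rule measure_eqI_PiM_infinite)
  interpret L: product_prob_space "\<lambda>_. Lap 1" "{..m}"
    by (intro product_prob_spaceI prob_space_Lap_1)
  interpret L': prob_space L
    unfolding L_def by (rule L.prob_space_axioms)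
  interpret PL: pair_prob_space M L ..
  have sL[measurable_cong]: "sets L = sets (PiM {..m} (\<lambda>_. borel))"
    unfolding L_def by (intro sets_PiM_cong) auto
  have W[measurable]: "?W \<in> measurable M ?B"
    by (rule measurable_restrict) (auto split: prod.splits)
  have W'[measurable]: "?W' \<in> measurable (M \<Otimes>\<^sub>M L) ?B"
  proof -
    have "(\<lambda>x. \<lambda>i\<in>I. if fst i then \<tau> (snd i) (fst x) else \<tau> (snd i) (fst x) * snd x (snd i)) \<in> measurable (M \<Otimes>\<^sub>M L) ?B"
      by (rule measurable_restrict) (auto split: prod.splits simp: I_def)
    then show ?thesis
      by (simp add: case_prod_unfold)
  qed
  show "finite_measure (distr M ?B ?W)"
    by (intro finite_measure_distr) measurable
  fix A J assume J: "finite J" "J \<subseteq> I" and A: "\<And>i. i \<in> J \<Longrightarrow> A i \<in> sets (borel :: real measure)"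
  \<comment> \<open>Missing coordinates get the side \<open>UNIV\<close>, so that the finite box
    constrains every index up to m and has the form of \<open>prob_jump_boxes\<close>.\<close>
  define D where "D n = (if (True, n) \<in> J then A (True, n) else UNIV)" for n :: nat
  define B where "B n = (if (False, n) \<in> J then A (False, n) else UNIV)" for n :: nat
  have [measurable]: "D n \<in> sets borel" "B n \<in> sets borel" for n
    using A by (auto simp: D_def B_def)
  let ?S = "prod_emb I (\<lambda>_. borel) J (Pi\<^sub>E J A)"
  have S[measurable]: "?S \<in> sets ?B"
    using J A by (intro sets_PiM_I) auto
  have mem: "restrict g I \<in> ?S \<longleftrightarrow> (\<forall>n\<le>m. g (True, n) \<in> D n \<and> g (False, n) \<in> B n)" for g
  proof -
    have "restrict g I \<in> ?S \<longleftrightarrow> (\<forall>i\<in>J. g i \<in> A i)"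
      using J unfolding prod_emb_PiE[OF J(2), of A "\<lambda>_. borel", simplified]
      by (auto simp: PiE_iff split: if_splits)
    also have "\<dots> \<longleftrightarrow> (\<forall>n\<le>m. g (True, n) \<in> D n \<and> g (False, n) \<in> B n)"
    proof
      assume *: "\<forall>n\<le>m. g (True, n) \<in> D n \<and> g (False, n) \<in> B n"
      show "\<forall>i\<in>J. g i \<in> A i"
      proof
        fix i assume i: "i \<in> J"
        obtain k n where "i = (k, n)" by (cases i)
        with i J * show "g i \<in> A i"
          by (cases k) (auto simp: I_def D_def B_def dest!: spec[of _ n])
      qed
    qed (auto simp: D_def B_def)
    finally show ?thesis .
  qed
  \<comment> \<open>For fixed jump times the section of the event is a box in the i.i.d. standard
    variables, each side rescaled by its jump time. The scaling of \<open>Lap\<close> needs positive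
    jump times, which is why the claim is only almost sure.\<close>
  have pos: "AE \<omega> in M. emeasure L (Pair \<omega> -` (?W' -` ?S \<inter> space (M \<Otimes>\<^sub>M L))) =
     ennreal (indicator {\<omega>\<in>space M. \<forall>n\<le>m. \<tau> n \<omega> \<in> D n} \<omega> * (\<Prod>n\<le>m. measure (Lap (\<tau> n \<omega>)) (B n)))"
    using AE_jump_time_pos AE_space
  proof eventually_elim
    case (elim \<omega>)
    have *: "measure (Lap (\<tau> n \<omega>)) (B n) = measure (Lap 1) ((\<lambda>x. \<tau> n \<omega> * x) -` B n)" for n
      using elim by (subst Lap_eq_distr) (auto simp: measure_distr)
    have m: "(\<lambda>x. \<tau> n \<omega> * x) -` B n \<in> sets borel" for n
      using measurable_sets[of "\<lambda>x. \<tau> n \<omega> * x" borel borel "B n"] by simp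
    have "Pair \<omega> -` (?W' -` ?S \<inter> space (M \<Otimes>\<^sub>M L)) =
      (if \<forall>n\<le>m. \<tau> n \<omega> \<in> D n then (\<Pi>\<^sub>E n\<in>{..m}. (\<lambda>x. \<tau> n \<omega> * x) -` B n) else {})"
      using elim by (auto simp: mem space_pair_measure L_def space_PiM PiE_iff)
    moreover have "emeasure L (\<Pi>\<^sub>E n\<in>{..m}. (\<lambda>x. \<tau> n \<omega> * x) -` B n) = ennreal (\<Prod>n\<le>m. measure (Lap (\<tau> n \<omega>)) (B n))"
      unfolding L_def using m by (subst L.emeasure_PiM) (auto simp: * prod_ennreal L.M.emeasure_eq_measure)
    ultimately show ?case
      using elim by simp
  qed
  have "emeasure (distr (M \<Otimes>\<^sub>M L) ?B ?W') ?S = emeasure (M \<Otimes>\<^sub>M L) (?W' -` ?S \<inter> space (M \<Otimes>\<^sub>M L))"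
    by (rule emeasure_distr) measurable
  also have "\<dots> = (\<integral>\<^sup>+\<omega>. emeasure L (Pair \<omega> -` (?W' -` ?S \<inter> space (M \<Otimes>\<^sub>M L))) \<partial>M)"
    by (rule L'.emeasure_pair_measure_alt) measurable
  also have "\<dots> = (\<integral>\<^sup>+\<omega>. ennreal (indicator {\<omega>\<in>space M. \<forall>n\<le>m. \<tau> n \<omega> \<in> D n} \<omega> * (\<Prod>n\<le>m. measure (Lap (\<tau> n \<omega>)) (B n))) \<partial>M)"
    using pos by (rule nn_integral_cong_AE)
  also have "\<dots> = ennreal (\<integral>\<omega>. indicator {\<omega>\<in>space M. \<forall>n\<le>m. \<tau> n \<omega> \<in> D n} \<omega> * (\<Prod>n\<le>m. measure (Lap (\<tau> n \<omega>)) (B n)) \<partial>M)"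
  proof (rule nn_integral_eq_integral)
    have meas: "(\<lambda>\<omega>. measure (Lap (\<tau> n \<omega>)) (B n)) \<in> borel_measurable M" for n
      by (rule borel_measurable_measure_Lap) measurable
    have "AE \<omega> in M. norm (indicator {\<omega>\<in>space M. \<forall>n\<le>m. \<tau> n \<omega> \<in> D n} \<omega> * (\<Prod>n\<le>m. measure (Lap (\<tau> n \<omega>)) (B n))) \<le> 1"
      using AE_jump_time_pos
      by eventually_elim (auto simp: indicator_def abs_prod intro!: prod_le_1 prob_space.prob_le_1 prob_space_Lap)
    then show "integrable M (\<lambda>\<omega>. indicator {\<omega>\<in>space M. \<forall>n\<le>m. \<tau> n \<omega> \<in> D n} \<omega> * (\<Prod>n\<le>m. measure (Lap (\<tau> n \<omega>)) (B n)))"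
      using meas by (intro integrable_const_bound[where B = 1]) (auto, measurable)
  qed (auto intro!: mult_nonneg_nonneg prod_nonneg)
  also have "\<dots> = ennreal (prob {\<omega>\<in>space M. \<forall>n\<le>m. \<tau> n \<omega> \<in> D n \<and> Y n \<omega> \<in> B n})"
    by (subst prob_jump_boxes) auto
  also have "\<dots> = emeasure (distr M ?B ?W) ?S"
    by (subst emeasure_distr) (auto simp: emeasure_eq_measure mem intro!: arg_cong[where f = prob])
  finally show "emeasure (distr M ?B ?W) ?S = emeasure (distr (M \<Otimes>\<^sub>M L) ?B ?W') ?S" ..
qed auto

text \<open>Once \<open>distr_jumps\<close> has replaced each jump by its time multiplied by an
  independent standard Laplace variable, Fubini integrates these variables out and leaves one factor
  1/(1 + (w x)^2 x^2) per jump time x.\<close>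

lemma char_jumps_finite:
  fixes w :: "real \<Rightarrow> real"
  assumes [measurable]: "w \<in> borel_measurable borel"
  shows "(CLINT \<omega>|M. iexp (\<Sum>j\<le>m. w (\<tau> j \<omega>) * Y j \<omega>)) =
    (\<integral>\<omega>. (\<Prod>j\<le>m. 1 / (1 + (w (\<tau> j \<omega>))\<^sup>2 * (\<tau> j \<omega>)\<^sup>2)) \<partial>M)"
proof -
  define I where "I = (UNIV :: bool set) \<times> {..m}"
  define L where "L = PiM {..m} (\<lambda>_. Lap 1)"
  interpret L: product_prob_space "\<lambda>_. Lap 1" "{..m}"
    by (intro product_prob_spaceI prob_space_Lap_1)
  interpret L': prob_space L
    unfolding L_def by (rule L.prob_space_axioms)
  interpret PL: pair_prob_space M L ..
  have sL[measurable_cong]: "sets L = sets (PiM {..m} (\<lambda>_. borel))"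
    unfolding L_def by (intro sets_PiM_cong) auto
  let ?B = "PiM I (\<lambda>_. borel :: real measure)"
  let ?W = "\<lambda>\<omega>. \<lambda>i\<in>I. if fst i then \<tau> (snd i) \<omega> else Y (snd i) \<omega>"
  let ?W' = "\<lambda>(\<omega>, l). \<lambda>i\<in>I. if fst i then \<tau> (snd i) \<omega> else \<tau> (snd i) \<omega> * l (snd i)"
  have W: "?W \<in> measurable M ?B"
    by (rule measurable_restrict) auto
  have W': "?W' \<in> measurable (M \<Otimes>\<^sub>M L) ?B"
  proof -
    have "(\<lambda>x. \<lambda>i\<in>I. if fst i then \<tau> (snd i) (fst x) else \<tau> (snd i) (fst x) * snd x (snd i)) \<in> measurable (M \<Otimes>\<^sub>M L) ?B"
      by (rule measurable_restrict) (auto simp: I_def)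
    then show ?thesis
      by (simp add: case_prod_unfold)
  qed
  define F where "F x = iexp (\<Sum>j\<le>m. w (x (True, j)) * x (False, j))" for x
  have F: "F \<in> borel_measurable ?B"
  proof -
    have [measurable]: "(\<lambda>x. x (k, j)) \<in> borel_measurable ?B" if "j \<le> m" for k j
      using that by (intro measurable_component_singleton) (simp add: I_def)
    show ?thesis
      unfolding F_def by measurable (auto simp: I_def)
  qed
  have mem: "(k, j) \<in> I \<longleftrightarrow> j \<le> m" for k j
    by (simp add: I_def)
  have "(CLINT \<omega>|M. iexp (\<Sum>j\<le>m. w (\<tau> j \<omega>) * Y j \<omega>)) = (CLINT \<omega>|M. F (?W \<omega>))"
    by (intro Bochner_Integration.integral_cong refl) (simp add: F_def mem)
  also have "\<dots> = integral\<^sup>L (distr M ?B ?W) F"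
    by (rule integral_distr[symmetric, OF W F])
  also have "\<dots> = integral\<^sup>L (distr (M \<Otimes>\<^sub>M L) ?B ?W') F"
    unfolding I_def L_def distr_jumps ..
  also have "\<dots> = (CLINT x|(M \<Otimes>\<^sub>M L). F (?W' x))"
    by (rule integral_distr[OF W' F])
  also have "\<dots> = (CLINT \<omega>|M. (CLINT l|L. F (?W' (\<omega>, l))))"
  proof (rule PL.integral_fst'[symmetric])
    show "integrable (M \<Otimes>\<^sub>M L) (\<lambda>x. F (?W' x))"
    proof (rule PL.integrable_const_bound[where B = 1])
      show "(\<lambda>x. F (?W' x)) \<in> borel_measurable (M \<Otimes>\<^sub>M L)"
        by (rule measurable_compose[OF W' F])
    qed (simp add: F_def)
  qed
  also have "\<dots> = (CLINT \<omega>|M. complex_of_real (\<Prod>j\<le>m. 1 / (1 + (w (\<tau> j \<omega>))\<^sup>2 * (\<tau> j \<omega>)\<^sup>2)))"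
  proof (intro Bochner_Integration.integral_cong refl)
    fix \<omega>
    have "(CLINT l|L. F (?W' (\<omega>, l))) = (CLINT l|L. (\<Prod>j\<le>m. iexp ((w (\<tau> j \<omega>) * \<tau> j \<omega>) * l j)))"
      by (intro Bochner_Integration.integral_cong refl)
         (simp add: F_def mem exp_sum[symmetric] sum_distrib_left mult.assoc)
    also have "\<dots> = (\<Prod>j\<le>m. char (Lap 1) (w (\<tau> j \<omega>) * \<tau> j \<omega>))"
      unfolding L_def char_def
    proof (rule L.product_integral_prod)
      show "complex_integrable (Lap 1) (\<lambda>x. iexp ((w (\<tau> j \<omega>) * \<tau> j \<omega>) * x))" for j
        by (rule L.M.integrable_const_bound[where B = 1]) auto
    qed simp
    also have "\<dots> = complex_of_real (\<Prod>j\<le>m. 1 / (1 + (w (\<tau> j \<omega>))\<^sup>2 * (\<tau> j \<omega>)\<^sup>2))"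
      by (simp add: char_Lap_1 power_mult_distrib)
    finally show "(CLINT l|L. F (?W' (\<omega>, l))) = complex_of_real (\<Prod>j\<le>m. 1 / (1 + (w (\<tau> j \<omega>))\<^sup>2 * (\<tau> j \<omega>)\<^sup>2))" .
  qed
  also have "\<dots> = complex_of_real (\<integral>\<omega>. (\<Prod>j\<le>m. 1 / (1 + (w (\<tau> j \<omega>))\<^sup>2 * (\<tau> j \<omega>)\<^sup>2)) \<partial>M)"
    by (rule integral_complex_of_real)
  finally show ?thesis .
qed

text \<open>Passes from a fixed number of jumps to the random number up to b. The factor
  \<open>h \<eta>\<close> belongs to jump 0, which sits at the deterministic time \<eta>; the
  exponential formula covers the others. Local constancy of w from the left makes h left-continuous,
  as that formula requires.\<close>

lemma char_jumps:
  fixes w :: "real \<Rightarrow> real"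
  assumes w[measurable]: "w \<in> borel_measurable borel" and b: "\<eta> < b" and w0: "\<And>x. b < x \<Longrightarrow> w x = 0"
    and step: "\<And>x. \<forall>\<^sub>F y in at_left x. w y = w x"
  defines "h \<equiv> (\<lambda>x. 1 / (1 + (w x)\<^sup>2 * x\<^sup>2))"
  shows "(CLINT \<omega>|M. iexp (\<Sum>j\<le>P b \<omega>. w (\<tau> j \<omega>) * Y j \<omega>)) =
      complex_of_real (h \<eta> * exp (integral {\<eta>..b} (\<lambda>x. (h x - 1) * (2 / x))))"
    and "(\<lambda>x. (h x - 1) * (2 / x)) integrable_on {\<eta>..b}"
proof -
  have [measurable]: "P b \<in> measurable M (count_space UNIV)"
    using b by (intro P_measurable) simp
  have h: "0 \<le> h x" "h x \<le> 1" for x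
  proof -
    have "0 \<le> 1 / (1 + r) \<and> 1 / (1 + r) \<le> 1" if "0 \<le> r" for r :: real
      using that by (auto simp: divide_simps)
    from this[of "(w x)\<^sup>2 * x\<^sup>2"] show "0 \<le> h x" "h x \<le> 1"
      unfolding h_def by simp_all
  qed
  have lc: "(h \<longlongrightarrow> h x) (at_left x)" for x
  proof (rule Lim_transform_eventually)
    have "(1::real) + (w x)\<^sup>2 * x\<^sup>2 \<noteq> 0"
      by (smt (verit) mult_nonneg_nonneg zero_le_power2)
    then show "((\<lambda>y. 1 / (1 + (w x)\<^sup>2 * y\<^sup>2)) \<longlongrightarrow> h x) (at_left x)"
      unfolding h_def by (intro tendsto_intros)
    show "\<forall>\<^sub>F y in at_left x. 1 / (1 + (w x)\<^sup>2 * y\<^sup>2) = h y"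
      using step[of x] by eventually_elim (simp add: h_def)
  qed
  note ef = exponential_formula[OF b h lc]
  show "(\<lambda>x. (h x - 1) * (2 / x)) integrable_on {\<eta>..b}"
    by (rule exponential_formula_integrable[OF b h lc])
  \<comment> \<open>Jumps with index above \<open>P b\<close> occur after b, where w vanishes, so
    the partial sums and products in m are constant from \<open>P b\<close> on.\<close>
  have large: "AE \<omega> in M. \<forall>j>P b \<omega>. b < \<tau> j \<omega>"
    using AE_P_unbounded AE_space
  proof eventually_elim
    case (elim \<omega>)
    show ?case
    proof (intro allI impI)
      fix j assume "P b \<omega> < j"
      moreover obtain r where "\<eta> \<le> r" "j \<le> P r \<omega>"
        using elim by auto
      ultimately show "b < \<tau> j \<omega>"
        using jump_time_le_iff[of \<omega> r j b] elim b by auto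
    qed
  qed
  have 1: "(\<lambda>m. CLINT \<omega>|M. iexp (\<Sum>j\<le>m. w (\<tau> j \<omega>) * Y j \<omega>)) \<longlonglongrightarrow> (CLINT \<omega>|M. iexp (\<Sum>j\<le>P b \<omega>. w (\<tau> j \<omega>) * Y j \<omega>))"
  proof (rule integral_dominated_convergence[where w = "\<lambda>_. 1"])
    have "(\<lambda>\<omega>. \<Sum>j\<le>P b \<omega>. w (\<tau> j \<omega>) * Y j \<omega>) \<in> borel_measurable M"
      by (rule measurable_compose_countable[where g = "P b"]) measurable
    then show "(\<lambda>\<omega>. iexp (\<Sum>j\<le>P b \<omega>. w (\<tau> j \<omega>) * Y j \<omega>)) \<in> borel_measurable M"
      by measurable
    show "AE \<omega> in M. (\<lambda>m. iexp (\<Sum>j\<le>m. w (\<tau> j \<omega>) * Y j \<omega>)) \<longlonglongrightarrow> iexp (\<Sum>j\<le>P b \<omega>. w (\<tau> j \<omega>) * Y j \<omega>)"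
      using large
    proof eventually_elim
      case (elim \<omega>)
      show ?case
      proof (rule tendsto_eventually, rule eventually_sequentiallyI[of "P b \<omega>"])
        fix m assume "P b \<omega> \<le> m"
        then have "(\<Sum>j\<le>P b \<omega>. w (\<tau> j \<omega>) * Y j \<omega>) = (\<Sum>j\<le>m. w (\<tau> j \<omega>) * Y j \<omega>)"
          using elim by (intro sum.mono_neutral_left) (auto simp: w0)
        then show "iexp (\<Sum>j\<le>m. w (\<tau> j \<omega>) * Y j \<omega>) = iexp (\<Sum>j\<le>P b \<omega>. w (\<tau> j \<omega>) * Y j \<omega>)"
          by simp
      qed
    qed
  qed auto
  have hm[measurable]: "h \<in> borel_measurable borel"
    unfolding h_def by measurable
  have 2: "(\<lambda>m. \<integral>\<omega>. (\<Prod>j\<le>m. h (\<tau> j \<omega>)) \<partial>M) \<longlonglongrightarrow> (\<integral>\<omega>. h \<eta> * (\<Prod>j=1..P b \<omega>. h (\<tau> j \<omega>)) \<partial>M)"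
  proof (rule integral_dominated_convergence[where w = "\<lambda>_. 1"])
    show "(\<lambda>\<omega>. h \<eta> * (\<Prod>j=1..P b \<omega>. h (\<tau> j \<omega>))) \<in> borel_measurable M"
      using exponential_formula_measurable[OF b h lc] by simp
    show "AE \<omega> in M. (\<lambda>m. \<Prod>j\<le>m. h (\<tau> j \<omega>)) \<longlonglongrightarrow> h \<eta> * (\<Prod>j=1..P b \<omega>. h (\<tau> j \<omega>))"
      using large
    proof eventually_elim
      case (elim \<omega>)
      show ?case
      proof (rule tendsto_eventually, rule eventually_sequentiallyI[of "P b \<omega>"])
        fix m assume "P b \<omega> \<le> m"
        then have "(\<Prod>j\<le>P b \<omega>. h (\<tau> j \<omega>)) = (\<Prod>j\<le>m. h (\<tau> j \<omega>))"
          using elim by (intro prod.mono_neutral_left) (auto simp: w0 h_def)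
        moreover have "(\<Prod>j\<le>P b \<omega>. h (\<tau> j \<omega>)) = h (\<tau> 0 \<omega>) * (\<Prod>j=1..P b \<omega>. h (\<tau> j \<omega>))"
          unfolding atMost_atLeast0 by (subst prod.atLeast_Suc_atMost) auto
        ultimately show "(\<Prod>j\<le>m. h (\<tau> j \<omega>)) = h \<eta> * (\<Prod>j=1..P b \<omega>. h (\<tau> j \<omega>))"
          by (simp add: jump_time_def)
      qed
    qed
    show "AE \<omega> in M. norm (\<Prod>j\<le>m. h (\<tau> j \<omega>)) \<le> 1" for m
      using h by (intro AE_I2) (auto simp: abs_prod intro!: prod_le_1)
  qed auto
  have "(\<lambda>m. CLINT \<omega>|M. iexp (\<Sum>j\<le>m. w (\<tau> j \<omega>) * Y j \<omega>)) \<longlonglongrightarrow> complex_of_real (\<integral>\<omega>. h \<eta> * (\<Prod>j=1..P b \<omega>. h (\<tau> j \<omega>)) \<partial>M)"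
    using tendsto_of_real[OF 2] unfolding char_jumps_finite[OF w] h_def .
  from LIMSEQ_unique[OF 1 this]
  show "(CLINT \<omega>|M. iexp (\<Sum>j\<le>P b \<omega>. w (\<tau> j \<omega>) * Y j \<omega>)) =
      complex_of_real (h \<eta> * exp (integral {\<eta>..b} (\<lambda>x. (h x - 1) * (2 / x))))"
    by (simp only: ef integral_mult_right_zero)
qed

section \<open>The value at a fixed time against the later increments\<close>

abbreviation Z :: "real \<Rightarrow> 'a \<Rightarrow> real" where
  "Z t \<omega> \<equiv> (\<Sum>j\<le>P t \<omega>. Y j \<omega>)"

lemma Z_measurable: "\<eta> \<le> t \<Longrightarrow> Z t \<in> borel_measurable M"
  by (rule measurable_compose_countable[where g = "P t"]) (auto intro: P_measurable)

text \<open>The exponent is a functional of the marked jump times whose weight is constant up to time \<open>s\<close>.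
  The contribution of \<open>{\<eta>..s}\<close> to the exponential formula is the characteristic function of
  \<open>Lap s\<close>, and the remaining factor does not depend on \<open>u\<close>.\<close>

lemma char_increments:
  assumes s: "\<eta> \<le> s" and J: "finite J" "J \<subseteq> {s<..}"
  shows "(CLINT \<omega>|M. iexp (u * Z s \<omega> + (\<Sum>t\<in>J. v t * (Z t \<omega> - Z s \<omega>)))) =
    char (Lap s) u * (CLINT \<omega>|M. iexp (\<Sum>t\<in>J. v t * (Z t \<omega> - Z s \<omega>)))"
proof -
  \<comment> \<open>The added 1 gives \<eta> < b even if J is empty and s = \<eta>, as the strict
    inequality in \<open>char_jumps\<close> demands.\<close>
  define b where "b = Max (insert s J) + 1"
  have b: "\<eta> < b" "s \<le> b" and Jb: "t \<in> J \<Longrightarrow> t \<le> b" for t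
  proof -
    have "t \<in> insert s J \<Longrightarrow> t + 1 \<le> b" for t
      unfolding b_def using J by simp
    from this[of s] this[of t] s show "\<eta> < b" "s \<le> b" "t \<in> J \<Longrightarrow> t \<le> b"
      by auto
  qed
  have Js: "t \<in> J \<Longrightarrow> s < t" for t
    using J by auto
  \<comment> \<open>Coefficient of a jump at time x in the exponent: the jump enters
    \<open>Z s\<close> if x \<le> s, and \<open>Z t - Z s\<close> if s < x \<le> t. Hence w equals u
    up to s and does not involve u afterwards.\<close>
  define w where "w u x = u * of_bool (x \<le> s) + (\<Sum>t\<in>J. v t * (of_bool (x \<le> t) - of_bool (x \<le> s)))" for u x :: real
  define h where "h u x = 1 / (1 + (w u x)\<^sup>2 * x\<^sup>2)" for u x
  define K where "K = integral {s..b} (\<lambda>x. (h 0 x - 1) * (2 / x))"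
  have [measurable]: "w u \<in> borel_measurable borel" for u
    unfolding w_def by measurable
  have w_b: "w u x = 0" if "b < x" for u x
    using that b Jb[THEN order_le_less_trans, OF _ that] by (auto simp: w_def not_le intro!: sum.neutral)
  have ob: "\<forall>\<^sub>F y in at_left x. of_bool (y \<le> t) = (of_bool (x \<le> t) :: real)" for x t :: real
  proof (cases "x \<le> t")
    case True
    then show ?thesis
      by (auto simp: eventually_at_filter)
  next
    case False
    then have "\<forall>\<^sub>F y in at_left x. t < y"
      by (intro eventually_at_leftI[of t]) auto
    then show ?thesis
      by eventually_elim (use False in auto)
  qed
  have step: "\<forall>\<^sub>F y in at_left x. w u y = w u x" for u x
  proof -
    have "\<forall>\<^sub>F y in at_left x. \<forall>t\<in>insert s J. of_bool (y \<le> t) = (of_bool (x \<le> t) :: real)"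
      using J ob by (intro eventually_ball_finite) auto
    then show ?thesis
      by eventually_elim (simp add: w_def)
  qed
  have w_s: "w u x = u" if "x \<le> s" for u x
    using that Js[THEN less_imp_le, THEN order_trans[OF that]] by (auto simp: w_def intro!: sum.neutral)
  have w_0: "w u x = w 0 x" if "s < x" for u x
    using that by (simp add: w_def)
  have path: "u * Z s \<omega> + (\<Sum>t\<in>J. v t * (Z t \<omega> - Z s \<omega>)) = (\<Sum>j\<le>P b \<omega>. w u (\<tau> j \<omega>) * Y j \<omega>)"
    if \<omega>: "\<omega> \<in> space M" for u \<omega>
  proof -
    have Zt: "Z t \<omega> = (\<Sum>j\<le>P b \<omega>. of_bool (\<tau> j \<omega> \<le> t) * Y j \<omega>)" if t: "\<eta> \<le> t" "t \<le> b" for t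
    proof -
      have "P t \<omega> \<le> P b \<omega>"
        using t by (intro P_mono \<omega>)
      moreover have "\<tau> j \<omega> \<le> t \<longleftrightarrow> j \<le> P t \<omega>" if "j \<le> P b \<omega>" for j
        using jump_time_le_iff[OF \<omega> _ that t(1)] b by simp
      ultimately have "(\<Sum>j\<le>P b \<omega>. of_bool (\<tau> j \<omega> \<le> t) * Y j \<omega>) = (\<Sum>j\<le>P t \<omega>. of_bool (\<tau> j \<omega> \<le> t) * Y j \<omega>)"
        by (intro sum.mono_neutral_right) auto
      also have "\<dots> = (\<Sum>j\<le>P t \<omega>. Y j \<omega>)"
        using jump_time_le_iff[OF \<omega> t(1) _ t(1)] by (intro sum.cong) auto
      finally show ?thesis ..
    qed
    have "u * Z s \<omega> + (\<Sum>t\<in>J. v t * (Z t \<omega> - Z s \<omega>)) =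
      (\<Sum>j\<le>P b \<omega>. u * of_bool (\<tau> j \<omega> \<le> s) * Y j \<omega>) +
      (\<Sum>t\<in>J. \<Sum>j\<le>P b \<omega>. v t * (of_bool (\<tau> j \<omega> \<le> t) - of_bool (\<tau> j \<omega> \<le> s)) * Y j \<omega>)"
    proof (intro arg_cong2[where f = "(+)"] sum.cong refl)
      show "u * Z s \<omega> = (\<Sum>j\<le>P b \<omega>. u * of_bool (\<tau> j \<omega> \<le> s) * Y j \<omega>)"
        unfolding Zt[OF s b(2)] sum_distrib_left by (simp only: mult.assoc)
      fix t assume t: "t \<in> J"
      then have "\<eta> \<le> t" "t \<le> b"
        using Js[OF t] Jb s by auto
      from Zt[OF this] show "v t * (Z t \<omega> - Z s \<omega>) =
          (\<Sum>j\<le>P b \<omega>. v t * (of_bool (\<tau> j \<omega> \<le> t) - of_bool (\<tau> j \<omega> \<le> s)) * Y j \<omega>)"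
        unfolding Zt[OF s b(2)]
        by (simp only: sum_subtractf[symmetric] sum_distrib_left left_diff_distrib[symmetric] mult.assoc)
    qed
    also have "\<dots> = (\<Sum>j\<le>P b \<omega>. w u (\<tau> j \<omega>) * Y j \<omega>)"
      by (subst sum.swap) (simp add: w_def distrib_right sum.distrib sum_distrib_right)
    finally show ?thesis .
  qed
  have hu: "(\<lambda>x. (h u x - 1) * (2 / x)) integrable_on {\<eta>..b}" for u
    unfolding h_def by (rule char_jumps[OF _ b(1) w_b step]) auto
  have val: "(CLINT \<omega>|M. iexp (u * Z s \<omega> + (\<Sum>t\<in>J. v t * (Z t \<omega> - Z s \<omega>)))) =
    complex_of_real (1 / (1 + u\<^sup>2 * s\<^sup>2) * exp K)" for u
  proof -
    have pos: "0 < 1 + u\<^sup>2 * x\<^sup>2" for x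
      by (smt (verit) mult_nonneg_nonneg zero_le_power2)
    \<comment> \<open>Here the intensity is decisive: the factor 2/x makes the integrand an exact
      derivative.\<close>
    have "((\<lambda>x. (1 / (1 + u\<^sup>2 * x\<^sup>2) - 1) * (2 / x)) has_integral (- ln (1 + u\<^sup>2 * s\<^sup>2)) - (- ln (1 + u\<^sup>2 * \<eta>\<^sup>2))) {\<eta>..s}"
    proof (rule fundamental_theorem_of_calculus[OF s])
      fix x assume "x \<in> {\<eta>..s}"
      then have x: "0 < x" using \<eta> by simp
      have "((\<lambda>x. - ln (1 + u\<^sup>2 * x\<^sup>2)) has_real_derivative (1 / (1 + u\<^sup>2 * x\<^sup>2) - 1) * (2 / x)) (at x within {\<eta>..s})"
        using pos[of x] x by (auto intro!: derivative_eq_intros simp: field_simps power2_eq_square)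
      then show "((\<lambda>x. - ln (1 + u\<^sup>2 * x\<^sup>2)) has_vector_derivative (1 / (1 + u\<^sup>2 * x\<^sup>2) - 1) * (2 / x)) (at x within {\<eta>..s})"
        by (simp add: has_real_derivative_iff_has_vector_derivative)
    qed
    then have "((\<lambda>x. (h u x - 1) * (2 / x)) has_integral (- ln (1 + u\<^sup>2 * s\<^sup>2)) - (- ln (1 + u\<^sup>2 * \<eta>\<^sup>2))) {\<eta>..s}"
      by (rule has_integral_eq[rotated]) (simp add: h_def w_s)
    then have 1: "integral {\<eta>..s} (\<lambda>x. (h u x - 1) * (2 / x)) = ln (1 + u\<^sup>2 * \<eta>\<^sup>2) - ln (1 + u\<^sup>2 * s\<^sup>2)"
      by (simp add: integral_unique)
    have 2: "integral {s..b} (\<lambda>x. (h u x - 1) * (2 / x)) = K"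
      unfolding K_def
    proof (rule integral_spike[of "{s}"])
      fix x assume "x \<in> {s..b} - {s}"
      then show "(h 0 x - 1) * (2 / x) = (h u x - 1) * (2 / x)"
        using w_0[of x u] by (simp add: h_def)
    qed simp
    have 3: "integral {\<eta>..b} (\<lambda>x. (h u x - 1) * (2 / x)) = ln (1 + u\<^sup>2 * \<eta>\<^sup>2) - ln (1 + u\<^sup>2 * s\<^sup>2) + K"
      using Henstock_Kurzweil_Integration.integral_combine[OF s b(2) hu[of u]] 1 2 by simp
    have "(CLINT \<omega>|M. iexp (u * Z s \<omega> + (\<Sum>t\<in>J. v t * (Z t \<omega> - Z s \<omega>)))) =
      (CLINT \<omega>|M. iexp (\<Sum>j\<le>P b \<omega>. w u (\<tau> j \<omega>) * Y j \<omega>))"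
      by (intro Bochner_Integration.integral_cong refl) (simp only: path)
    also have "\<dots> = complex_of_real (h u \<eta> * exp (integral {\<eta>..b} (\<lambda>x. (h u x - 1) * (2 / x))))"
      unfolding h_def by (rule char_jumps[OF _ b(1) w_b step]) auto
    \<comment> \<open>The initial jump contributes 1/(1 + u^2 \<eta>^2), which cancels the boundary
      term at \<eta>; only the one at s survives.\<close>
    also have "h u \<eta> * exp (integral {\<eta>..b} (\<lambda>x. (h u x - 1) * (2 / x))) = 1 / (1 + u\<^sup>2 * s\<^sup>2) * exp K"
      unfolding 3 exp_add exp_diff using pos[of \<eta>] pos[of s] s by (simp add: h_def w_s exp_ln)
    finally show ?thesis .
  qed
  \<comment> \<open>At u = 0 the formula \<open>val\<close> evaluates the integral over the
    increments alone: it is \<open>exp K\<close>.\<close>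
  show ?thesis
    using val[of u] val[of 0] char_Lap[of s u] s \<eta> by simp
qed

text \<open>The factorised characteristic functions determine the law on the whole path space.
  Coordinate s stores the value and the others the increments, so one function carries the pair, and
  independence means that coordinate s may be redrawn from \<open>Lap s\<close>.\<close>

lemma distr_increments:
  assumes s: "\<eta> \<le> s"
  shows "distr M (PiM {s..} (\<lambda>_. borel)) (\<lambda>\<omega>. \<lambda>t\<in>{s..}. if t = s then Z s \<omega> else Z t \<omega> - Z s \<omega>) =
    distr (M \<Otimes>\<^sub>M Lap s) (PiM {s..} (\<lambda>_. borel)) (\<lambda>(\<omega>, z). \<lambda>t\<in>{s..}. if t = s then z else Z t \<omega> - Z s \<omega>)"
    (is "distr M ?B ?W = distr _ _ ?W'")
proof (rule measure_eqI_PiM_infinite)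
  have s0: "0 < s"
    using s \<eta> by simp
  interpret L: prob_space "Lap s"
    by (rule prob_space_Lap[OF s0])
  interpret PL: pair_prob_space M "Lap s" ..
  have Zm[measurable]: "Z t \<in> borel_measurable M" if "t \<in> {s..}" for t
    using that s by (intro Z_measurable) simp
  have Zs[measurable]: "Z s \<in> borel_measurable M"
    by (rule Zm) simp
  define X where "X t \<omega> = (if t = s then Z s \<omega> else Z t \<omega> - Z s \<omega>)" for t \<omega>
  define X' where "X' t x = (if t = s then snd x else Z t (fst x) - Z s (fst x))" for t x
  have X: "X t \<in> borel_measurable M" if "t \<in> {s..}" for t
    unfolding X_def using Zm[OF that] by measurable
  have X': "X' t \<in> borel_measurable (M \<Otimes>\<^sub>M Lap s)" if "t \<in> {s..}" for t
  proof (cases "t = s")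
    case False
    have "(\<lambda>x. Z t (fst x) - Z s (fst x)) \<in> borel_measurable (M \<Otimes>\<^sub>M Lap s)"
      by (intro borel_measurable_diff measurable_compose[OF measurable_fst] Zm that Zs)
    moreover have "X' t = (\<lambda>x. Z t (fst x) - Z s (fst x))"
      using False by (auto simp: X'_def fun_eq_iff)
    ultimately show ?thesis
      by simp
  next
    case True
    then have "X' t = snd"
      by (auto simp: X'_def fun_eq_iff)
    then show ?thesis
      by simp
  qed
  have WX: "?W = (\<lambda>\<omega>. \<lambda>t\<in>{s..}. X t \<omega>)" "?W' = (\<lambda>x. \<lambda>t\<in>{s..}. X' t x)"
    by (auto simp: X_def X'_def fun_eq_iff)
  have W: "?W \<in> measurable M ?B"
    unfolding WX by (intro measurable_restrict X)
  have W': "?W' \<in> measurable (M \<Otimes>\<^sub>M Lap s) ?B"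
    unfolding WX by (intro measurable_restrict X')
  show "finite_measure (distr M ?B ?W)"
    by (intro finite_measure_distr W)
  fix A :: "real \<Rightarrow> real set" and J assume J: "finite J" "J \<subseteq> {s..}" and A: "\<And>i. i \<in> J \<Longrightarrow> A i \<in> sets borel"
  let ?S = "prod_emb {s..} (\<lambda>_. borel) J (Pi\<^sub>E J A)"
  have S: "?S \<in> sets ?B"
    using J A by (intro sets_PiM_I) auto
  have mem: "(\<lambda>t\<in>{s..}. g t) \<in> ?S \<longleftrightarrow> (\<forall>t\<in>J. g t \<in> A t)" for g
    using J unfolding prod_emb_PiE[OF J(2), of A "\<lambda>_. borel", simplified]
    by (auto simp: PiE_iff split: if_splits)
  \<comment> \<open>\<open>Levy_uniqueness_boxes\<close> expects a Borel side for every index in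
    \<open>{s..}\<close>, whereas A is controlled only on J; the empty set fills the rest.\<close>
  have "measure M {\<omega>\<in>space M. \<forall>t\<in>J. X t \<omega> \<in> (if t \<in> J then A t else {})} =
    measure (M \<Otimes>\<^sub>M Lap s) {x\<in>space (M \<Otimes>\<^sub>M Lap s). \<forall>t\<in>J. X' t x \<in> (if t \<in> J then A t else {})}"
  proof (rule Levy_uniqueness_boxes[OF prob_space_axioms X PL.prob_space_axioms X' _ J])
    fix K :: "real set" and v :: "real \<Rightarrow> real" assume K: "finite K" "K \<subseteq> {s..}"
    \<comment> \<open>The value coordinate s need not occur in K. Its coefficient is split off, with
      0 as the default.\<close>
    define u where "u = (if s \<in> K then v s else 0)"
    define K' where "K' = K - {s}"
    have K': "finite K'" "K' \<subseteq> {s<..}"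
      using K by (auto simp: K'_def less_le)
    have split: "(\<Sum>t\<in>K. v t * g t) = u * g s + (\<Sum>t\<in>K'. v t * g t)" for g
      unfolding u_def K'_def using K by (simp add: sum.remove)
    have X_K': "(\<Sum>t\<in>K'. v t * X t \<omega>) = (\<Sum>t\<in>K'. v t * (Z t \<omega> - Z s \<omega>))"
      "(\<Sum>t\<in>K'. v t * X' t x) = (\<Sum>t\<in>K'. v t * (Z t (fst x) - Z s (fst x)))" for \<omega> x
      by (intro sum.cong refl; simp add: X_def X'_def K'_def)+
    have XS: "X s \<omega> = Z s \<omega>" "X' s x = snd x" for \<omega> x
      by (simp_all add: X_def X'_def)
    define V where "V \<omega> = (\<Sum>t\<in>K'. v t * (Z t \<omega> - Z s \<omega>))" for \<omega>
    have V[measurable]: "V \<in> borel_measurable M"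
      unfolding V_def using K' by (intro borel_measurable_sum borel_measurable_times borel_measurable_diff Zm Zs) auto
    have "(CLINT \<omega>|M. iexp (\<Sum>t\<in>K. v t * X t \<omega>)) = (CLINT \<omega>|M. iexp (u * Z s \<omega> + V \<omega>))"
      by (simp only: split X_K' V_def XS)
    also have "\<dots> = (CLINT \<omega>|M. (CLINT z|Lap s. iexp (u * z) * iexp (V \<omega>)))"
      unfolding V_def char_increments[OF s K'] by (simp add: char_def)
    also have "\<dots> = (CLINT x|(M \<Otimes>\<^sub>M Lap s). iexp (u * snd x) * iexp (V (fst x)))"
    proof (subst PL.integral_fst'[symmetric])
      show "complex_integrable (M \<Otimes>\<^sub>M Lap s) (\<lambda>x. iexp (u * snd x) * iexp (V (fst x)))"
        by (rule PL.integrable_const_bound[where B = 1]) (auto simp: norm_mult)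
    qed simp
    also have "\<dots> = (CLINT x|(M \<Otimes>\<^sub>M Lap s). iexp (\<Sum>t\<in>K. v t * X' t x))"
      by (simp only: split X_K' V_def[symmetric] XS of_real_add distrib_left exp_add)
    finally show "(CLINT \<omega>|M. iexp (\<Sum>t\<in>K. v t * X t \<omega>)) = (CLINT x|(M \<Otimes>\<^sub>M Lap s). iexp (\<Sum>t\<in>K. v t * X' t x))" .
  qed (use A in auto)
  then have eq: "measure M {\<omega>\<in>space M. \<forall>t\<in>J. X t \<omega> \<in> A t} = measure (M \<Otimes>\<^sub>M Lap s) {x\<in>space (M \<Otimes>\<^sub>M Lap s). \<forall>t\<in>J. X' t x \<in> A t}"
    by (simp cong: ball_cong)
  have "emeasure (distr M ?B ?W) ?S = ennreal (measure M {\<omega>\<in>space M. \<forall>t\<in>J. X t \<omega> \<in> A t})"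
    by (subst emeasure_distr[OF W S]) (auto simp: WX mem emeasure_eq_measure intro!: arg_cong[where f = prob])
  also have "\<dots> = emeasure (distr (M \<Otimes>\<^sub>M Lap s) ?B ?W') ?S"
    unfolding eq by (subst emeasure_distr[OF W' S])
      (auto simp only: WX mem PL.emeasure_eq_measure intro!: arg_cong[where f = "\<lambda>A. ennreal (PL.prob A)"])
  finally show "emeasure (distr M ?B ?W) ?S = emeasure (distr (M \<Otimes>\<^sub>M Lap s) ?B ?W') ?S" .
qed auto

text \<open>Shifting a path moves its value at s and leaves the increments alone. With the
  increments held fixed the claim is \<open>nn_integral_Lap_shift\<close> for the value; integrating
  over the increments gives the law of the path.\<close>

lemma univariate_path_shift:
  assumes s: "\<eta> \<le> s" and A: "A \<in> sets (PiM {s..} (\<lambda>_. borel))"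
  shows "emeasure (distr M (PiM {s..} (\<lambda>_. borel)) (\<lambda>\<omega>. \<lambda>t\<in>{s..}. a + Z t \<omega>)) A \<le>
    ennreal (exp (\<bar>a - b\<bar> / s)) * emeasure (distr M (PiM {s..} (\<lambda>_. borel)) (\<lambda>\<omega>. \<lambda>t\<in>{s..}. b + Z t \<omega>)) A"
proof -
  let ?B = "PiM {s..} (\<lambda>_. borel :: real measure)"
  let ?W = "\<lambda>\<omega>. \<lambda>t\<in>{s..}. if t = s then Z s \<omega> else Z t \<omega> - Z s \<omega>"
  let ?W' = "\<lambda>(\<omega>, z). \<lambda>t\<in>{s..}. if t = s then z else Z t \<omega> - Z s \<omega>"
  have s0: "0 < s"
    using s \<eta> by simp
  interpret L: prob_space "Lap s"
    by (rule prob_space_Lap[OF s0])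
  interpret PL: pair_prob_space M "Lap s" ..
  have Zm: "Z t \<in> borel_measurable M" if "t \<in> {s..}" for t
    using that s by (intro Z_measurable) simp
  have Zs: "Z s \<in> borel_measurable M"
    by (rule Zm) simp
  have W: "?W \<in> measurable M ?B"
    by (intro measurable_restrict) (use Zm Zs in auto)
  have W': "?W' \<in> measurable (M \<Otimes>\<^sub>M Lap s) ?B"
  proof -
    have "(\<lambda>x. if t = s then snd x else Z t (fst x) - Z s (fst x)) \<in> borel_measurable (M \<Otimes>\<^sub>M Lap s)" if "t \<in> {s..}" for t
      using that by (cases "t = s")
        (auto intro!: borel_measurable_diff measurable_compose[OF measurable_fst] Zm Zs)
    then have "(\<lambda>x. \<lambda>t\<in>{s..}. if t = s then snd x else Z t (fst x) - Z s (fst x)) \<in> measurable (M \<Otimes>\<^sub>M Lap s) ?B"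
      by (intro measurable_restrict)
    then show ?thesis
      by (simp add: case_prod_unfold)
  qed
  \<comment> \<open>\<open>\<Psi>\<close> rebuilds a path from its value at s and its increments;
    \<open>\<Phi> c\<close> adds c to the value first.\<close>
  define \<Psi> where "\<Psi> x = (\<lambda>t\<in>{s..}. if t = s then x s else x s + x t)" for x :: "real \<Rightarrow> real"
  define \<Phi> where "\<Phi> c x = \<Psi> (x(s := c + x s))" for c and x :: "real \<Rightarrow> real"
  have \<Phi>_eq: "\<Phi> c x = (\<lambda>t\<in>{s..}. if t = s then c + x s else c + x s + x t)" for c x
    by (auto simp: \<Phi>_def \<Psi>_def fun_eq_iff)
  have \<Phi>: "\<Phi> c \<in> measurable ?B ?B" for c
    unfolding \<Phi>_eq by (intro measurable_restrict) (auto intro!: borel_measurable_add)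
  have "emeasure (distr M ?B (\<lambda>\<omega>. \<lambda>t\<in>{s..}. c + Z t \<omega>)) A = (\<integral>\<^sup>+\<omega>. (\<integral>\<^sup>+z. indicator A (\<Psi> (\<lambda>t\<in>{s..}. if t = s then c + z else Z t \<omega> - Z s \<omega>)) \<partial>Lap s) \<partial>M)" for c
  proof -
    have "(\<lambda>\<omega>. \<lambda>t\<in>{s..}. c + Z t \<omega>) = (\<lambda>\<omega>. \<Phi> c (?W \<omega>))"
      by (auto simp: \<Phi>_eq fun_eq_iff)
    then have "emeasure (distr M ?B (\<lambda>\<omega>. \<lambda>t\<in>{s..}. c + Z t \<omega>)) A = emeasure (distr (distr M ?B ?W) ?B (\<Phi> c)) A"
      using \<Phi> W by (simp add: distr_distr comp_def)
    also have "\<dots> = emeasure (distr (M \<Otimes>\<^sub>M Lap s) ?B (\<lambda>x. \<Phi> c (?W' x))) A"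
      unfolding distr_increments[OF s] using \<Phi> W' by (simp add: distr_distr comp_def)
    also have "\<dots> = (\<integral>\<^sup>+x. indicator A (\<Phi> c (?W' x)) \<partial>(M \<Otimes>\<^sub>M Lap s))"
    proof -
      have "emeasure (distr (M \<Otimes>\<^sub>M Lap s) ?B (\<lambda>x. \<Phi> c (?W' x))) A =
        (\<integral>\<^sup>+x. indicator A x \<partial>distr (M \<Otimes>\<^sub>M Lap s) ?B (\<lambda>x. \<Phi> c (?W' x)))"
        using A by simp
      then show ?thesis
        using nn_integral_distr[OF measurable_compose[OF W' \<Phi>], of "indicator A" c] A by simp
    qed
    also have "\<dots> = (\<integral>\<^sup>+\<omega>. (\<integral>\<^sup>+z. indicator A (\<Phi> c (?W' (\<omega>, z))) \<partial>Lap s) \<partial>M)"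
      using measurable_compose[OF measurable_compose[OF W' \<Phi>] borel_measurable_indicator[OF A]]
      by (intro L.nn_integral_fst[symmetric])
    also have "\<dots> = (\<integral>\<^sup>+\<omega>. (\<integral>\<^sup>+z. indicator A (\<Psi> (\<lambda>t\<in>{s..}. if t = s then c + z else Z t \<omega> - Z s \<omega>)) \<partial>Lap s) \<partial>M)"
      by (intro nn_integral_cong arg_cong[where f = "indicator A"]) (auto simp: \<Phi>_def \<Psi>_def fun_eq_iff)
    finally show ?thesis .
  qed
  note eq = this
  have \<Psi>: "\<Psi> \<in> measurable ?B ?B"
    unfolding \<Psi>_def by (intro measurable_restrict) (auto intro!: borel_measurable_add)
  have g: "(\<lambda>y. indicator A (\<Psi> (\<lambda>t\<in>{s..}. if t = s then y else Z t \<omega> - Z s \<omega>)) :: ennreal) \<in> borel_measurable borel" for \<omega>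
  proof (rule measurable_compose[OF _ borel_measurable_indicator[OF A]], rule measurable_compose[OF _ \<Psi>])
    show "(\<lambda>y. \<lambda>t\<in>{s..}. if t = s then y else Z t \<omega> - Z s \<omega>) \<in> measurable borel ?B"
      by (intro measurable_restrict) auto
  qed
  have "(\<lambda>\<omega>. \<integral>\<^sup>+z. indicator A (\<Phi> b (?W' (\<omega>, z))) \<partial>Lap s) \<in> borel_measurable M"
    using measurable_compose[OF measurable_compose[OF W' \<Phi>] borel_measurable_indicator[OF A]]
    by (rule L.borel_measurable_nn_integral_fst)
  moreover have "(\<lambda>\<omega>. \<integral>\<^sup>+z. indicator A (\<Phi> b (?W' (\<omega>, z))) \<partial>Lap s) =
    (\<lambda>\<omega>. \<integral>\<^sup>+z. indicator A (\<Psi> (\<lambda>t\<in>{s..}. if t = s then b + z else Z t \<omega> - Z s \<omega>)) \<partial>Lap s)"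
    by (intro ext nn_integral_cong arg_cong[where f = "indicator A"]) (auto simp: \<Phi>_def \<Psi>_def fun_eq_iff)
  ultimately have m: "(\<lambda>\<omega>. \<integral>\<^sup>+z. indicator A (\<Psi> (\<lambda>t\<in>{s..}. if t = s then b + z else Z t \<omega> - Z s \<omega>)) \<partial>Lap s) \<in> borel_measurable M"
    by simp
  show ?thesis
    unfolding eq nn_integral_cmult[OF m, symmetric]
    by (intro nn_integral_mono nn_integral_Lap_shift[OF s0] g)
qed

end

section \<open>The multivariate Laplace process\<close>

text \<open>A setwise bound is an inequality between a measure and a scaled measure, so integrals
  can be compared without any densities.\<close>

lemma nn_integral_le_of_emeasure_le:
  assumes sets: "sets \<mu> = sets \<nu>" and le: "\<And>A. A \<in> sets \<nu> \<Longrightarrow> emeasure \<mu> A \<le> c * emeasure \<nu> A"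
    and f: "f \<in> borel_measurable \<nu>"
  shows "(\<integral>\<^sup>+x. f x \<partial>\<mu>) \<le> c * (\<integral>\<^sup>+x. f x \<partial>\<nu>)"
proof -
  have s: "sets \<mu> = sets (scale_measure c \<nu>)"
    using sets by simp
  have "\<mu> \<le> scale_measure c \<nu>"
    using le sets by (simp add: le_measure[OF s])
  then show ?thesis
    using nn_integral_mono_measure[OF s, of f] nn_integral_scale_measure[OF f, of c] by simp
qed

text \<open>Coordinates are exchanged one at a time through Fubini. The integrand stays arbitrary in
  the induction because the inner integral over the new coordinate becomes the integrand for the
  others.\<close>

lemma nn_integral_PiM_le:
  fixes \<mu> \<nu> :: "'i \<Rightarrow> 'b measure"
  assumes \<mu>: "\<And>i. prob_space (\<mu> i)" and \<nu>: "\<And>i. prob_space (\<nu> i)" and sets: "\<And>i. sets (\<mu> i) = sets (\<nu> i)"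
    and le: "\<And>i A. A \<in> sets (\<nu> i) \<Longrightarrow> emeasure (\<mu> i) A \<le> c i * emeasure (\<nu> i) A"
    and I: "finite I" and f: "f \<in> borel_measurable (PiM I \<nu>)"
  shows "(\<integral>\<^sup>+x. f x \<partial>PiM I \<mu>) \<le> (\<Prod>i\<in>I. c i) * (\<integral>\<^sup>+x. f x \<partial>PiM I \<nu>)"
  using I f
proof (induction I arbitrary: f rule: finite_induct)
  case empty
  then show ?case
    by (simp add: PiM_empty nn_integral_count_space_finite)
next
  case (insert i I)
  interpret \<mu>: product_sigma_finite \<mu>
    using \<mu> by (intro product_sigma_finite.intro prob_space_imp_sigma_finite)
  interpret \<nu>: product_sigma_finite \<nu>
    using \<nu> by (intro product_sigma_finite.intro prob_space_imp_sigma_finite)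
  have sI: "sets (PiM J \<mu>) = sets (PiM J \<nu>)" for J
    by (intro sets_PiM_cong sets refl)
  have f\<mu>: "f \<in> borel_measurable (PiM (insert i I) \<mu>)"
    using insert.prems by (simp cong: measurable_cong_sets add: sI)
  have upd: "(\<lambda>(x, y). f (x(i := y))) \<in> borel_measurable (PiM I \<nu> \<Otimes>\<^sub>M \<nu> i)"
    using measurable_compose[OF measurable_add_dim insert.prems] by (simp only: case_prod_unfold)
  have fx: "(\<lambda>y. f (x(i := y))) \<in> borel_measurable (\<nu> i)" if "x \<in> space (PiM I \<nu>)" for x
    using measurable_Pair2[OF upd that] by simp
  have sp: "space (PiM I \<mu>) = space (PiM I \<nu>)"
    by (rule sets_eq_imp_space_eq[OF sI])
  have m: "(\<lambda>x. \<integral>\<^sup>+y. f (x(i := y)) \<partial>\<nu> i) \<in> borel_measurable (PiM I \<nu>)"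
    using sigma_finite_measure.borel_measurable_nn_integral_fst[OF prob_space_imp_sigma_finite[OF \<nu>] upd] by simp
  have "(\<integral>\<^sup>+x. f x \<partial>PiM (insert i I) \<mu>) = (\<integral>\<^sup>+x. (\<integral>\<^sup>+y. f (x(i := y)) \<partial>\<mu> i) \<partial>PiM I \<mu>)"
    by (rule \<mu>.product_nn_integral_insert[OF insert.hyps f\<mu>])
  also have "\<dots> \<le> (\<integral>\<^sup>+x. c i * (\<integral>\<^sup>+y. f (x(i := y)) \<partial>\<nu> i) \<partial>PiM I \<mu>)"
    using sp by (intro nn_integral_mono nn_integral_le_of_emeasure_le sets le fx) auto
  also have "\<dots> \<le> (\<Prod>i\<in>I. c i) * (\<integral>\<^sup>+x. c i * (\<integral>\<^sup>+y. f (x(i := y)) \<partial>\<nu> i) \<partial>PiM I \<nu>)"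
    by (rule insert.IH) (intro borel_measurable_times_ennreal borel_measurable_const m)
  also have "\<dots> = (\<Prod>i\<in>insert i I. c i) * (\<integral>\<^sup>+x. (\<integral>\<^sup>+y. f (x(i := y)) \<partial>\<nu> i) \<partial>PiM I \<nu>)"
    unfolding nn_integral_cmult[OF m] using insert.hyps by (simp add: mult_ac)
  also have "\<dots> = (\<Prod>i\<in>insert i I. c i) * (\<integral>\<^sup>+x. f x \<partial>PiM (insert i I) \<nu>)"
    by (simp only: \<nu>.product_nn_integral_insert[OF insert.hyps insert.prems])
  finally show ?case .
qed

lemma borel_measurable_vec_iff:
  fixes g :: "'a \<Rightarrow> real ^ 'd"
  shows "g \<in> borel_measurable M \<longleftrightarrow> (\<forall>i. (\<lambda>x. g x $ i) \<in> borel_measurable M)"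
  by (subst borel_measurable_euclidean_space) (auto simp: Basis_vec_def inner_axis)

locale laplace_noise = prob_space M for M :: "'a measure" +
  fixes \<eta> :: real and Z :: "real \<Rightarrow> 'a \<Rightarrow> real ^ 'd"
  assumes \<eta>: "0 < \<eta>" and laplace: "laplace_process M \<eta> Z"
begin

lemma coordinate:
  obtains P Y where "laplace_path M \<eta> P Y"
    "\<And>t \<omega>. \<eta> \<le> t \<Longrightarrow> \<omega> \<in> space M \<Longrightarrow> Z t \<omega> $ i = (\<Sum>n\<le>P t \<omega>. Y n \<omega>)"
proof -
  have "univariate_laplace_process M \<eta> (\<lambda>t \<omega>. Z t \<omega> $ i)"
    using laplace by (simp add: laplace_process_def)
  then show ?thesis
    unfolding univariate_laplace_process_def
    by (auto intro!: that laplace_path.intro laplace_clock.intro laplace_clock_axioms.intro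
        laplace_path_axioms.intro prob_space_axioms \<eta>)
qed

lemma Z_measurable: "\<eta> \<le> t \<Longrightarrow> Z t \<in> borel_measurable M"
  unfolding borel_measurable_vec_iff
proof
  fix i assume t: "\<eta> \<le> t"
  obtain P Y where PY: "laplace_path M \<eta> P Y"
    "\<And>t \<omega>. \<eta> \<le> t \<Longrightarrow> \<omega> \<in> space M \<Longrightarrow> Z t \<omega> $ i = (\<Sum>n\<le>P t \<omega>. Y n \<omega>)"
    using coordinate[where i = i] by blast
  show "(\<lambda>x. Z t x $ i) \<in> borel_measurable M"
    using laplace_path.Z_measurable[OF PY(1) t] PY(2)[OF t] by (simp cong: measurable_cong)
qed

text \<open>Each coordinate has its own jump times, but finitely many coordinates share a right
  neighbourhood without jumps.\<close>

lemma Z_right_const: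
  assumes "\<omega> \<in> space M" "\<eta> \<le> t"
  shows "\<forall>\<^sub>F r in at_right t. Z r \<omega> = Z t \<omega>"
proof -
  have "\<forall>\<^sub>F r in at_right t. Z r \<omega> $ i = Z t \<omega> $ i" for i
  proof -
    obtain P Y where PY: "laplace_path M \<eta> P Y"
      "\<And>t \<omega>. \<eta> \<le> t \<Longrightarrow> \<omega> \<in> space M \<Longrightarrow> Z t \<omega> $ i = (\<Sum>n\<le>P t \<omega>. Y n \<omega>)"
      using coordinate[where i = i] by blast
    interpret laplace_path M \<eta> P Y by (rule PY)
    have "\<forall>\<^sub>F r in at_right t. \<eta> \<le> r"
      using assms(2) by (auto simp: eventually_at_filter)
    with P_right_const[OF assms] show ?thesis
      by eventually_elim (use PY(2) assms in simp)
  qed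
  then have "\<forall>\<^sub>F r in at_right t. \<forall>i. Z r \<omega> $ i = Z t \<omega> $ i"
    by (rule eventually_all_finite)
  then show ?thesis
    by eventually_elim (simp add: vec_eq_iff)
qed

abbreviation paths :: "real \<Rightarrow> (real \<Rightarrow> real ^ 'd) measure" where
  "paths s \<equiv> PiM {s..} (\<lambda>_. borel)"

definition path :: "real \<Rightarrow> real ^ 'd \<Rightarrow> 'a \<Rightarrow> real \<Rightarrow> real ^ 'd" where
  "path s a \<omega> = (\<lambda>t\<in>{s..}. a + Z t \<omega>)"

lemma path_measurable: "\<eta> \<le> s \<Longrightarrow> path s a \<in> measurable M (paths s)"
  unfolding path_def
  by (intro measurable_restrict borel_measurable_add borel_measurable_const Z_measurable) auto

text \<open>Independent coordinates make the law of the vector path an image of a product measure.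
  The coordinatewise factors exp (|a_i - b_i| / s) multiply, so their exponents add up to the l1
  distance.\<close>

lemma path_shift:
  assumes s: "\<eta> \<le> s" and A: "A \<in> sets (paths s)"
  shows "emeasure (distr M (paths s) (path s a)) A \<le>
    ennreal (exp ((\<Sum>i\<in>UNIV. \<bar>a $ i - b $ i\<bar>) / s)) * emeasure (distr M (paths s) (path s b)) A"
proof -
  let ?U = "PiM {s..} (\<lambda>_. borel) :: (real \<Rightarrow> real) measure"
  let ?V = "PiM (UNIV :: 'd set) (\<lambda>_. ?U)"
  define X where "X i \<omega> = (\<lambda>t\<in>{\<eta>..}. Z t \<omega> $ i)" for i \<omega>
  define V where "V c i \<omega> = (\<lambda>t\<in>{s..}. c $ i + Z t \<omega> $ i)" for c :: "real ^ 'd" and i \<omega>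
  define G where "G v = (\<lambda>t\<in>{s..}. \<chi> i. v i t)" for v :: "'d \<Rightarrow> real \<Rightarrow> real"
  define \<mu> where "\<mu> c i = distr M ?U (V c i)" for c i
  have indX: "indep_vars (\<lambda>_. PiM {\<eta>..} (\<lambda>_. borel)) X UNIV"
    using laplace by (simp add: laplace_process_def X_def[abs_def])
  have indV: "indep_vars (\<lambda>_. ?U) (V c) UNIV" for c
  proof -
    have "indep_vars (\<lambda>_. ?U) (\<lambda>i \<omega>. (\<lambda>x. \<lambda>t\<in>{s..}. c $ i + x t) (X i \<omega>)) UNIV"
      using s by (intro indep_vars_compose2[OF indX] measurable_restrict borel_measurable_add) auto
    moreover have "(\<lambda>i \<omega>. (\<lambda>x. \<lambda>t\<in>{s..}. c $ i + x t) (X i \<omega>)) = V c"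
      using s by (auto simp: fun_eq_iff V_def X_def)
    ultimately show ?thesis
      by simp
  qed
  have Vm: "V c i \<in> measurable M ?U" for c i
    using indV[of c] by (auto simp: indep_vars_def)
  have Vm': "(\<lambda>\<omega>. \<lambda>i\<in>UNIV. V c i \<omega>) \<in> measurable M ?V" for c
    by (intro measurable_restrict Vm)
  have law: "distr M ?V (\<lambda>\<omega>. \<lambda>i\<in>UNIV. V c i \<omega>) = PiM UNIV (\<mu> c)" for c
    using indep_vars_iff_distr_eq_PiM[where I = UNIV and M' = "\<lambda>_. ?U" and X = "V c"] Vm indV[of c] by (simp add: \<mu>_def[abs_def])
  have G: "G \<in> measurable ?V (paths s)"
    unfolding G_def
  proof (rule measurable_restrict)
    fix t assume t: "t \<in> {s..}"
    have "(\<lambda>v. v i t) \<in> borel_measurable ?V" for i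
    proof (rule measurable_compose[where g = "\<lambda>x. x t"])
      show "(\<lambda>v. v i) \<in> measurable ?V ?U"
        by (rule measurable_component_singleton) simp
      show "(\<lambda>x. x t) \<in> borel_measurable ?U"
        by (rule measurable_component_singleton[OF t])
    qed
    then show "(\<lambda>v. \<chi> i. v i t) \<in> borel_measurable ?V"
      by (simp add: borel_measurable_vec_iff)
  qed
  have path_G: "path s c = (\<lambda>\<omega>. G (\<lambda>i\<in>UNIV. V c i \<omega>))" for c
    by (auto simp: path_def G_def V_def fun_eq_iff vec_eq_iff)
  have eq: "emeasure (distr M (paths s) (path s c)) A = (\<integral>\<^sup>+v. indicator A (G v) \<partial>PiM UNIV (\<mu> c))" for c
  proof -
    have "emeasure (distr M (paths s) (path s c)) A = (\<integral>\<^sup>+x. indicator A x \<partial>distr (distr M ?V (\<lambda>\<omega>. \<lambda>i\<in>UNIV. V c i \<omega>)) (paths s) G)"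
      using A G Vm' by (simp add: path_G distr_distr comp_def)
    also have "\<dots> = (\<integral>\<^sup>+v. indicator A (G v) \<partial>PiM UNIV (\<mu> c))"
      unfolding law[symmetric] using A G by (subst nn_integral_distr) simp_all
    finally show ?thesis .
  qed
  have "(\<integral>\<^sup>+v. indicator A (G v) \<partial>PiM UNIV (\<mu> a)) \<le> (\<Prod>i\<in>UNIV. ennreal (exp (\<bar>a $ i - b $ i\<bar> / s))) * (\<integral>\<^sup>+v. indicator A (G v) \<partial>PiM UNIV (\<mu> b))"
  proof (rule nn_integral_PiM_le)
    show "prob_space (\<mu> a i)" "prob_space (\<mu> b i)" for i
      unfolding \<mu>_def by (intro prob_space_distr Vm)+
    show "sets (\<mu> a i) = sets (\<mu> b i)" for i
      by (simp add: \<mu>_def)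
    show "emeasure (\<mu> a i) C \<le> ennreal (exp (\<bar>a $ i - b $ i\<bar> / s)) * emeasure (\<mu> b i) C" if "C \<in> sets (\<mu> b i)" for i C
    proof -
      obtain P Y where PY: "laplace_path M \<eta> P Y"
        "\<And>t \<omega>. \<eta> \<le> t \<Longrightarrow> \<omega> \<in> space M \<Longrightarrow> Z t \<omega> $ i = (\<Sum>n\<le>P t \<omega>. Y n \<omega>)"
        using coordinate[where i = i] by blast
      have "\<mu> c i = distr M ?U (\<lambda>\<omega>. \<lambda>t\<in>{s..}. c $ i + (\<Sum>n\<le>P t \<omega>. Y n \<omega>))" for c
        unfolding \<mu>_def V_def using PY(2) s by (intro distr_cong refl) (auto simp: fun_eq_iff)
      then show ?thesis
        using laplace_path.univariate_path_shift[OF PY(1) s, of C "a $ i" "b $ i"] that by (simp add: \<mu>_def)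
    qed
    have "sets (PiM UNIV (\<mu> b)) = sets ?V"
      by (intro sets_PiM_cong) (auto simp: \<mu>_def)
    then show "(\<lambda>v. indicator A (G v)) \<in> borel_measurable (PiM UNIV (\<mu> b))"
      using measurable_compose[OF G borel_measurable_indicator[OF A]] by (simp cong: measurable_cong_sets)
  qed simp
  then show ?thesis
    unfolding eq by (simp add: prod_ennreal exp_sum sum_divide_distrib)
qed

end

section \<open>The mechanism as a functional of the noise path\<close>

text \<open>Evaluation of a right-continuous path at a random time, written as a limit over rational grids
  so that it is measurable in the product \<open>\<sigma>\<close>-algebra.\<close>

definition path_eval :: "real \<Rightarrow> (real \<Rightarrow> 'b) \<Rightarrow> real \<Rightarrow> 'b :: t2_space" where
  "path_eval s w r = lim (\<lambda>k. w (max s (real_of_int (\<lfloor>real (Suc k) * r\<rfloor> + 1) / real (Suc k))))"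

lemma path_eval_right_const:
  assumes "s \<le> r" and const: "\<forall>\<^sub>F t in at_right r. g t = g r"
  shows "path_eval s (\<lambda>t\<in>{s..}. g t) r = g r"
proof -
  \<comment> \<open>The smallest multiple of 1/(k+1) strictly above r; the strictness, due to the
    added 1, makes q approach r from the right.\<close>
  define q where "q k = real_of_int (\<lfloor>real (Suc k) * r\<rfloor> + 1) / real (Suc k)" for k
  have gt: "r < q k" for k
  proof -
    have "r * real (Suc k) < real_of_int (\<lfloor>real (Suc k) * r\<rfloor> + 1)"
      by (simp only: mult.commute[of r]) linarith
    then show ?thesis
      unfolding q_def by (subst less_divide_eq) simp
  qed
  have le: "q k \<le> r + 1 / real (Suc k)" for k
  proof -
    have "real_of_int (\<lfloor>real (Suc k) * r\<rfloor> + 1) \<le> real (Suc k) * r + 1"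
      by linarith
    then have "q k \<le> (real (Suc k) * r + 1) / real (Suc k)"
      unfolding q_def by (rule divide_right_mono) simp
    then show ?thesis
      by (simp add: add_divide_distrib del: of_nat_Suc)
  qed
  have "filterlim q (at_right r) sequentially"
    unfolding filterlim_at
  proof
    show "q \<longlonglongrightarrow> r"
    proof (rule tendsto_sandwich[where f = "\<lambda>_. r" and h = "\<lambda>k. r + 1 / real (Suc k)"])
      show "(\<lambda>k. r + 1 / real (Suc k)) \<longlonglongrightarrow> r"
        by real_asymp
    qed (use gt le in \<open>auto intro!: always_eventually less_imp_le\<close>)
    show "\<forall>\<^sub>F k in sequentially. q k \<in> {r<..} \<and> q k \<noteq> r"
    proof (intro always_eventually allI)
      show "q k \<in> {r<..} \<and> q k \<noteq> r" for k
        using gt[of k] by simp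
    qed
  qed
  from eventually_compose_filterlim[OF const this] have "\<forall>\<^sub>F k in sequentially. g (q k) = g r" .
  then have "(\<lambda>k. g (q k)) \<longlonglongrightarrow> g r"
    by (rule tendsto_eventually)
  moreover have "max s (q k) = q k" "q k \<in> {s..}" for k
    using gt[of k] assms(1) by auto
  ultimately show ?thesis
    unfolding path_eval_def q_def[symmetric] by (simp add: limI)
qed

text \<open>The grid index takes countably many integer values, and for each of them the path is
  read at a fixed time; \<open>max s\<close> keeps this time inside the index set.\<close>

lemma measurable_path_eval:
  fixes r :: "(real \<Rightarrow> 'b :: {banach, second_countable_topology}) \<Rightarrow> real"
  assumes r[measurable]: "r \<in> borel_measurable (PiM {s..} (\<lambda>_. borel))"
  shows "(\<lambda>w. path_eval s w (r w)) \<in> borel_measurable (PiM {s..} (\<lambda>_. borel))"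
  unfolding path_eval_def
proof (rule borel_measurable_lim_metric)
  fix k :: nat
  show "(\<lambda>w. w (max s (real_of_int (\<lfloor>real (Suc k) * r w\<rfloor> + 1) / real (Suc k)))) \<in> borel_measurable (PiM {s..} (\<lambda>_. borel))"
  proof (rule measurable_compose_countable[where g = "\<lambda>w. \<lfloor>real (Suc k) * r w\<rfloor>"
        and f = "\<lambda>j w. w (max s (real_of_int (j + 1) / real (Suc k)))"])
    show "(\<lambda>w. w (max s (real_of_int (j + 1) / real (Suc k)))) \<in> borel_measurable (PiM {s..} (\<lambda>_. borel))" for j
      by (rule measurable_component_singleton) simp
  qed measurable
qed

text \<open>Reuses the recursion of \<open>lnr\<close> with the path itself as sample point. The
  function f is 0 because the shift by \<open>f x\<close> is already part of the path, and
  \<open>()\<close> stands in for the database.\<close>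

definition path_lnr :: "real \<Rightarrow> (nat \<Rightarrow> (nat \<Rightarrow> real ^ 'd) \<Rightarrow> real) \<Rightarrow> nat \<Rightarrow> (real \<Rightarrow> real ^ 'd) \<Rightarrow> real ^ 'd" where
  "path_lnr s T n w = lnr (\<lambda>_. 0) T (\<lambda>r w. path_eval s w r) () n w"

lemma path_lnr_rec: "path_lnr s T n w = path_eval s w (T n (\<lambda>i\<in>{1..n - 1}. path_lnr s T i w))"
  unfolding path_lnr_def by (subst lnr.simps) simp

lemma measurable_path_lnr:
  fixes T :: "nat \<Rightarrow> (nat \<Rightarrow> real ^ 'd) \<Rightarrow> real"
  assumes T: "\<And>n. 1 \<le> n \<Longrightarrow> T n \<in> borel_measurable (tuples (n - 1))" and n: "1 \<le> n"
  shows "path_lnr s T n \<in> borel_measurable (PiM {s..} (\<lambda>_. borel))"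
  using n
proof (induction n rule: less_induct)
  case (less n)
  have "(\<lambda>w. path_eval s w (T n (\<lambda>i\<in>{1..n - 1}. path_lnr s T i w))) \<in> borel_measurable (PiM {s..} (\<lambda>_. borel))"
    using less by (intro measurable_path_eval measurable_compose[OF _ T] measurable_restrict) auto
  then show ?case
    by (simp only: path_lnr_rec[symmetric])
qed

lemma restrict_in_space_tuples: "restrict b {1..n} \<in> space (tuples n)"
  by (simp add: space_PiM)

text \<open>All times are at least s, so the restricted path is only consulted where it is defined,
  and by right-continuity \<open>path_eval\<close> returns its true value there.\<close>

lemma lnr_eq_path_lnr:
  assumes T: "\<And>n \<beta>. 1 \<le> n \<Longrightarrow> \<beta> \<in> space (tuples (n - 1)) \<Longrightarrow> s \<le> T n \<beta>"
    and rc: "\<And>r. s \<le> r \<Longrightarrow> \<forall>\<^sub>F t in at_right r. Z t \<omega> = Z r \<omega>" and n: "1 \<le> n"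
  shows "lnr f T Z x n \<omega> = path_lnr s T n (\<lambda>t\<in>{s..}. f x + Z t \<omega>)"
  using n
proof (induction n rule: less_induct)
  case (less n)
  have eq: "(\<lambda>i\<in>{1..n - 1}. path_lnr s T i (\<lambda>t\<in>{s..}. f x + Z t \<omega>)) = (\<lambda>i\<in>{1..n - 1}. lnr f T Z x i \<omega>)"
    by (intro restrict_ext less.IH[symmetric]) (use less.prems in auto)
  have ge: "s \<le> T n (\<lambda>i\<in>{1..n - 1}. lnr f T Z x i \<omega>)"
    by (intro T less.prems restrict_in_space_tuples)
  show ?case
    unfolding path_lnr_rec[of s T n] eq
    by (subst lnr.simps, subst path_eval_right_const[OF ge]) (use rc[OF ge] in \<open>auto elim: eventually_mono\<close>)
qed

section \<open>Raising the time functions to a fixed level\<close>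

lemma lnr_cong_times:
  assumes "\<And>i. 1 \<le> i \<Longrightarrow> i \<le> n \<Longrightarrow> T i (\<lambda>j\<in>{1..i - 1}. lnr f T Z x j \<omega>) = T' i (\<lambda>j\<in>{1..i - 1}. lnr f T Z x j \<omega>)"
    and "1 \<le> i" "i \<le> n"
  shows "lnr f T' Z x i \<omega> = lnr f T Z x i \<omega>"
  using assms(2,3)
proof (induction i rule: less_induct)
  case (less i)
  have eq: "(\<lambda>j\<in>{1..i - 1}. lnr f T' Z x j \<omega>) = (\<lambda>j\<in>{1..i - 1}. lnr f T Z x j \<omega>)"
    using less by (intro restrict_ext) auto
  show ?case
    by (subst (1 2) lnr.simps) (simp only: eq assms(1)[OF less.prems])
qed

lemma time_functions_antimono:
  assumes T: "time_functions T" and m: "1 \<le> m" "m \<le> n"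
  shows "T n (restrict b {1..n - 1}) \<le> T m (restrict b {1..m - 1})"
  using m(2)
proof (induction n rule: dec_induct)
  case (step k)
  have "1 \<le> k"
    using step.hyps m(1) by simp
  with T restrict_in_space_tuples[of b k] have "T (Suc k) (restrict b {1..k}) \<le> T k (restrict (restrict b {1..k}) {1..k - 1})"
    unfolding time_functions_def Suc_eq_plus1 by blast
  also have "restrict (restrict b {1..k}) {1..k - 1} = restrict b {1..k - 1}"
    by (auto simp: restrict_def fun_eq_iff)
  also note step.IH
  finally show ?case
    by (simp only: diff_Suc_1)
qed simp

text \<open>Times decrease along the outputs: if the last one is at least s, so are the earlier
  ones, and the maximum with s changes nothing. The condition is put on the tuples in A and not on
  one of the mechanisms, which lets the same argument run in both directions.\<close>

lemma lnr_max_times: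
  fixes T :: "nat \<Rightarrow> (nat \<Rightarrow> real ^ 'd) \<Rightarrow> real"
  assumes T: "time_functions T" and n: "1 \<le> n"
    and A: "\<And>\<beta>. \<beta> \<in> A \<Longrightarrow> s \<le> T n (restrict \<beta> {1..n - 1})"
  defines "T' \<equiv> (\<lambda>n \<beta>. max s (T n \<beta>))"
  shows "(\<lambda>i\<in>{1..n}. lnr f T' Z x i \<omega>) \<in> A \<longleftrightarrow> (\<lambda>i\<in>{1..n}. lnr f T Z x i \<omega>) \<in> A"
proof -
  have late: "s \<le> T i (restrict b {1..i - 1})" if "restrict b {1..n} \<in> A" "1 \<le> i" "i \<le> n" for b i
  proof -
    have "restrict (restrict b {1..n}) {1..n - 1} = restrict b {1..n - 1}"
      by (auto simp: restrict_def fun_eq_iff)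
    then have "s \<le> T n (restrict b {1..n - 1})"
      using A[OF that(1)] by simp
    also have "\<dots> \<le> T i (restrict b {1..i - 1})"
      by (rule time_functions_antimono[OF T that(2,3)])
    finally show ?thesis .
  qed
  have "(\<lambda>i\<in>{1..n}. lnr f T' Z x i \<omega>) = (\<lambda>i\<in>{1..n}. lnr f T Z x i \<omega>)" if "(\<lambda>i\<in>{1..n}. lnr f T Z x i \<omega>) \<in> A"
    using late[OF that] by (intro restrict_ext lnr_cong_times[where n = n]) (auto simp: T'_def max_def)
  moreover have "(\<lambda>i\<in>{1..n}. lnr f T Z x i \<omega>) = (\<lambda>i\<in>{1..n}. lnr f T' Z x i \<omega>)" if "(\<lambda>i\<in>{1..n}. lnr f T' Z x i \<omega>) \<in> A"
    using late[OF that] by (intro restrict_ext lnr_cong_times[where n = n]) (auto simp: T'_def max_def)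
  ultimately show ?thesis
    by auto
qed

context laplace_noise
begin

lemma lnr_eq_path:
  assumes s: "\<eta> \<le> s" and T: "\<And>n \<beta>. 1 \<le> n \<Longrightarrow> \<beta> \<in> space (tuples (n - 1)) \<Longrightarrow> s \<le> T n \<beta>"
    and "\<omega> \<in> space M" "1 \<le> n"
  shows "lnr f T Z x n \<omega> = path_lnr s T n (path s (f x) \<omega>)"
  unfolding path_def using assms Z_right_const by (intro lnr_eq_path_lnr) auto

lemma measurable_lnr:
  assumes T: "\<And>n. 1 \<le> n \<Longrightarrow> T n \<in> borel_measurable (tuples (n - 1))"
    "\<And>n \<beta>. 1 \<le> n \<Longrightarrow> \<beta> \<in> space (tuples (n - 1)) \<Longrightarrow> \<eta> \<le> T n \<beta>" and n: "1 \<le> n"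
  shows "lnr f T Z x n \<in> borel_measurable M"
proof -
  have "(\<lambda>\<omega>. path_lnr \<eta> T n (path \<eta> (f x) \<omega>)) \<in> borel_measurable M"
    by (rule measurable_compose[OF path_measurable[OF order_refl] measurable_path_lnr[OF T(1) n]])
  then show ?thesis
    by (rule measurable_cong[THEN iffD2, rotated]) (rule lnr_eq_path[OF order_refl T(2) _ n])
qed

text \<open>The outputs are a measurable image of the path after s, so the bound for paths carries
  over. The index set stays general because both finite tuples and entire sequences are
  needed.\<close>

lemma emeasure_lnr_shift:
  assumes s: "\<eta> \<le> s" and T: "\<And>n. 1 \<le> n \<Longrightarrow> T n \<in> borel_measurable (tuples (n - 1))"
    "\<And>n \<beta>. 1 \<le> n \<Longrightarrow> \<beta> \<in> space (tuples (n - 1)) \<Longrightarrow> s \<le> T n \<beta>"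
    and I: "I \<subseteq> {1..}" and A: "A \<in> sets (PiM I (\<lambda>_. borel))"
  shows "emeasure M {\<omega>\<in>space M. (\<lambda>i\<in>I. lnr f T Z x i \<omega>) \<in> A} \<le>
    ennreal (exp ((\<Sum>i\<in>UNIV. \<bar>f x $ i - f x' $ i\<bar>) / s)) * emeasure M {\<omega>\<in>space M. (\<lambda>i\<in>I. lnr f T Z x' i \<omega>) \<in> A}"
proof -
  define \<Phi> where "\<Phi> w = (\<lambda>i\<in>I. path_lnr s T i w)" for w
  have \<Phi>: "\<Phi> \<in> measurable (paths s) (PiM I (\<lambda>_. borel))"
    unfolding \<Phi>_def using I by (intro measurable_restrict measurable_path_lnr T) auto
  define B where "B = \<Phi> -` A \<inter> space (paths s)"
  have B: "B \<in> sets (paths s)"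
    unfolding B_def by (rule measurable_sets[OF \<Phi> A])
  have "{\<omega>\<in>space M. (\<lambda>i\<in>I. lnr f T Z x i \<omega>) \<in> A} = path s (f x) -` B \<inter> space M" for x
  proof -
    have "(\<lambda>i\<in>I. lnr f T Z x i \<omega>) = \<Phi> (path s (f x) \<omega>)" if "\<omega> \<in> space M" for \<omega>
      unfolding \<Phi>_def using I that by (intro restrict_ext lnr_eq_path s T(2)) auto
    then show ?thesis
      using measurable_space[OF path_measurable[OF s]] by (auto simp: B_def)
  qed
  then have "emeasure M {\<omega>\<in>space M. (\<lambda>i\<in>I. lnr f T Z x i \<omega>) \<in> A} = emeasure (distr M (paths s) (path s (f x))) B" for x
    by (simp add: emeasure_distr[OF path_measurable[OF s] B])
  then show ?thesis
    using path_shift[OF s B] by simp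
qed

text \<open>Off the event the times may fall below s, where the path after s does not determine the
  outputs. The mechanism with times raised to s has the same event and never looks before s.\<close>

lemma emeasure_tuple_shift:
  assumes s: "\<eta> \<le> s" and T: "time_functions T" and n: "1 \<le> n" and A: "A \<in> sets (tuples n)"
    "\<And>\<beta>. \<beta> \<in> A \<Longrightarrow> s \<le> T n (restrict \<beta> {1..n - 1})"
  shows "emeasure M {\<omega>\<in>space M. (\<lambda>i\<in>{1..n}. lnr f T Z x i \<omega>) \<in> A} \<le>
    ennreal (exp ((\<Sum>i\<in>UNIV. \<bar>f x $ i - f x' $ i\<bar>) / s)) * emeasure M {\<omega>\<in>space M. (\<lambda>i\<in>{1..n}. lnr f T Z x' i \<omega>) \<in> A}"
proof -
  have m: "(\<lambda>\<beta>. max s (T n \<beta>)) \<in> borel_measurable (tuples (n - 1))" if "1 \<le> n" for n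
    using T that by (auto simp: time_functions_def)
  have eq: "{\<omega>\<in>space M. (\<lambda>i\<in>{1..n}. lnr f T Z x i \<omega>) \<in> A} =
    {\<omega>\<in>space M. (\<lambda>i\<in>{1..n}. lnr f (\<lambda>n \<beta>. max s (T n \<beta>)) Z x i \<omega>) \<in> A}" for x
    by (intro Collect_cong conj_cong refl lnr_max_times[symmetric] T n A(2))
  show ?thesis
    unfolding eq by (rule emeasure_lnr_shift[OF s m]) (use A in auto)
qed

end

section \<open>Bounding the privacy loss\<close>

lemma sets_measure_sum [simp]: "sets (measure_sum \<mu> \<nu>) = sets \<mu>"
  by (simp add: measure_sum_def)

lemma space_measure_sum [simp]: "space (measure_sum \<mu> \<nu>) = space \<mu>"
  by (simp add: measure_sum_def)

lemma emeasure_measure_sum: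
  assumes "sets \<mu> = sets \<nu>" "A \<in> sets \<mu>"
  shows "emeasure (measure_sum \<mu> \<nu>) A = emeasure \<mu> A + emeasure \<nu> A"
  unfolding measure_sum_def
proof (rule emeasure_measure_of_sigma)
  show "sigma_algebra (space \<mu>) (sets \<mu>)" ..
  show "positive (sets \<mu>) (\<lambda>A. emeasure \<mu> A + emeasure \<nu> A)"
    by (simp add: positive_def)
  show "countably_additive (sets \<mu>) (\<lambda>A. emeasure \<mu> A + emeasure \<nu> A)"
    using assms(1) by (auto simp: countably_additive_def suminf_add[symmetric] suminf_emeasure)
qed fact

lemma measurable_elog [measurable]: "elog \<in> borel_measurable borel"
  unfolding elog_def[abs_def] by measurable

lemma elog_divide_gtD:
  assumes "ereal q < elog (p / p')"
  shows "ennreal (exp q) * p' < p"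
proof (cases "p' = 0 \<or> p' = \<infinity>")
  \<comment> \<open>In \<open>ennreal\<close>, p / \<infinity> = 0 and 0 / 0 = 0 have logarithm
    -\<infinity>; what remains is p' = 0 < p, where the loss is \<infinity>.\<close>
  case True
  then show ?thesis
    using assms by (auto simp: elog_def zero_less_iff_neq_zero split: if_splits)
next
  case False
  then obtain r' where r': "p' = ennreal r'" "0 < r'"
    by (cases p') (auto simp: ennreal_eq_0_iff)
  show ?thesis
  proof (cases p)
    case (real r)
    have "r \<noteq> 0"
      using assms real by (auto simp: elog_def)
    then have r: "0 < r"
      using real by simp
    have d: "p / p' = ennreal (r / r')"
      using r r' real by (simp add: divide_ennreal)
    have "q < ln (r / r')"
      using assms r r' unfolding d by (auto simp: elog_def split: if_splits)
    then have "exp q < r / r'"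
      using r r' by (metis divide_pos_pos exp_less_mono exp_ln)
    then have "exp q * r' < r"
      using r' by (simp add: field_simps)
    then show ?thesis
      using r' real by (simp add: ennreal_mult[symmetric] ennreal_less_iff)
  next
    case top
    then show ?thesis
      using r' by (simp add: ennreal_mult_less_top)
  qed
qed

text \<open>The bound E is random, the hypothesis concerns fixed levels c. Whenever the loss exceeds
  E, a rational q lies strictly between them; there E \<le> q and p > exp q * p'. The hypothesis
  with c = q bounds the integral of p by that of exp q * p' over this set, which forces it to be
  null, and countably many q suffice.\<close>

lemma privacy_loss_gt:
  assumes M: "prob_space M" and X: "X \<in> measurable M S" and X': "X' \<in> measurable M S"
    and E[measurable]: "E \<in> borel_measurable S"
    and le: "\<And>c A. A \<in> sets S \<Longrightarrow> (\<And>y. y \<in> A \<Longrightarrow> E y \<le> c) \<Longrightarrow>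
      emeasure (distr M S X) A \<le> ennreal (exp c) * emeasure (distr M S X') A"
  shows sets_privacy_loss_gt: "{\<omega>\<in>space M. privacy_loss M S X X' \<omega> > ereal (E (X \<omega>))} \<in> sets M"
    and measure_privacy_loss_gt: "measure M {\<omega>\<in>space M. privacy_loss M S X X' \<omega> > ereal (E (X \<omega>))} = 0"
proof -
  interpret prob_space M by fact
  define \<mu> where "\<mu> = distr M S X"
  define \<mu>' where "\<mu>' = distr M S X'"
  interpret \<mu>: prob_space \<mu>
    unfolding \<mu>_def by (rule prob_space_distr[OF X])
  interpret \<mu>': prob_space \<mu>'
    unfolding \<mu>'_def by (rule prob_space_distr[OF X'])
  define R where "R = measure_sum \<mu> \<mu>'"
  have sets_eq: "sets \<mu> = sets S" "sets \<mu>' = sets S" "sets R = sets S" "space R = space S"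
    by (simp_all add: \<mu>_def \<mu>'_def R_def)
  have R: "emeasure R A = emeasure \<mu> A + emeasure \<mu>' A" if "A \<in> sets S" for A
    unfolding R_def using that sets_eq by (intro emeasure_measure_sum) auto
  interpret R: finite_measure R
    by (rule finite_measureI) (simp add: sets_eq R ennreal_add_eq_top)
  have ac: "absolutely_continuous R \<mu>" "absolutely_continuous R \<mu>'"
    by (auto simp: absolutely_continuous_def null_sets_def sets_eq R)
  define p where "p = RN_deriv R \<mu>"
  define p' where "p' = RN_deriv R \<mu>'"
  have [measurable]: "p \<in> borel_measurable S" "p' \<in> borel_measurable S"
    using borel_measurable_RN_deriv[of R] sets_eq(3) by (auto simp: p_def p'_def cong: measurable_cong_sets)
  have pR: "p \<in> borel_measurable R" "p' \<in> borel_measurable R"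
    by (simp_all add: p_def p'_def)
  have dens: "density R p = \<mu>" "density R p' = \<mu>'"
    unfolding p_def p'_def using ac sets_eq by (auto intro!: R.density_RN_deriv)
  define B where "B = {y\<in>space S. ereal (E y) < elog (p y / p' y)}"
  have B: "B \<in> sets S"
    unfolding B_def by measurable
  define Bq where "Bq q = {y\<in>space S. E y \<le> q \<and> ennreal (exp q) * p' y < p y}" for q
  have Bq[measurable]: "Bq q \<in> sets S" for q
    unfolding Bq_def by measurable
  have "B \<subseteq> (\<Union>q. Bq (real_of_rat q))"
  proof
    fix y assume y: "y \<in> B"
    then obtain q where "ereal (E y) < ereal (real_of_rat q)" "ereal (real_of_rat q) < elog (p y / p' y)"
      using ereal_dense3[of "ereal (E y)" "elog (p y / p' y)"] by (auto simp: B_def)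
    then show "y \<in> (\<Union>q. Bq (real_of_rat q))"
      using y by (auto simp: Bq_def B_def intro!: exI[of _ q] elog_divide_gtD)
  qed
  moreover have "Bq q \<in> null_sets \<mu>" for q
  proof -
    let ?f = "\<lambda>y. (ennreal (exp q) * p' y) * indicator (Bq q) y"
    let ?g = "\<lambda>y. p y * indicator (Bq q) y"
    have BR: "Bq q \<in> sets R"
      using Bq sets_eq by simp
    have mf: "?f \<in> borel_measurable R" and mg: "?g \<in> borel_measurable R"
      using pR BR by measurable
    have f: "(\<integral>\<^sup>+y. ?f y \<partial>R) = ennreal (exp q) * emeasure \<mu>' (Bq q)"
      using pR BR unfolding dens(2)[symmetric]
      by (simp add: emeasure_density mult.assoc nn_integral_cmult)
    have g: "(\<integral>\<^sup>+y. ?g y \<partial>R) = emeasure \<mu> (Bq q)"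
      using pR BR unfolding dens(1)[symmetric] by (simp add: emeasure_density)
    have fg: "?f y \<le> ?g y" for y
      by (auto simp: Bq_def indicator_def)
    \<comment> \<open>Finiteness of the smaller integral permits subtraction in
      \<open>ennreal\<close>: the difference of the integrands has integral 0 although it is
      strictly positive on \<open>Bq q\<close>.\<close>
    have fin: "(\<integral>\<^sup>+y. ?f y \<partial>R) \<noteq> \<infinity>"
      unfolding f by (simp add: ennreal_mult_eq_top_iff)
    have "(\<integral>\<^sup>+y. ?g y \<partial>R) \<le> (\<integral>\<^sup>+y. ?f y \<partial>R)"
      unfolding f g \<mu>_def \<mu>'_def by (rule le) (auto simp: Bq_def)
    then have "(\<integral>\<^sup>+y. ?g y - ?f y \<partial>R) = 0"
      using mf mg fin fg by (subst nn_integral_diff) (auto simp: diff_eq_0_iff_ennreal less_top)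
    then have "AE y in R. ?g y - ?f y = 0"
      using mf mg by (subst (asm) nn_integral_0_iff_AE) auto
    then have "AE y in R. y \<notin> Bq q"
    proof eventually_elim
      case (elim y)
      then show ?case
        by (auto simp: Bq_def diff_eq_0_iff_ennreal)
    qed
    then have "Bq q \<in> null_sets R"
      using BR by (subst AE_iff_null_sets) auto
    then show ?thesis
      using ac(1) by (auto simp: absolutely_continuous_def)
  qed
  then have "(\<Union>q. Bq (real_of_rat q)) \<in> null_sets \<mu>"
    by (intro null_sets_UN) auto
  ultimately have "B \<in> null_sets \<mu>"
    using B sets_eq by (metis null_sets_subset)
  moreover have eq: "{\<omega>\<in>space M. privacy_loss M S X X' \<omega> > ereal (E (X \<omega>))} = X -` B \<inter> space M"
    using measurable_space[OF X]
    by (auto simp: privacy_loss_def Let_def B_def p_def p'_def R_def \<mu>_def \<mu>'_def)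
  ultimately show "measure M {\<omega>\<in>space M. privacy_loss M S X X' \<omega> > ereal (E (X \<omega>))} = 0"
    using B X by (simp add: \<mu>_def null_sets_def emeasure_distr measure_def)
  show "{\<omega>\<in>space M. privacy_loss M S X X' \<omega> > ereal (E (X \<omega>))} \<in> sets M"
    unfolding eq using measurable_sets[OF X B] .
qed

section \<open>Stopping\<close>

lemma space_generated_sigma [simp]: "space (generated_sigma M X I) = space M"
  by (simp add: generated_sigma_def space_measure_of_conv)

lemma sets_generated_sigma_mono:
  assumes "I \<subseteq> J"
  shows "sets (generated_sigma M X I) \<subseteq> sets (generated_sigma M X J)"
proof -
  have sets: "sets (generated_sigma M X K) = sigma_sets (space M) (\<Union>i\<in>K. {X i -` B \<inter> space M | B. B \<in> sets borel})" for K
    unfolding generated_sigma_def by (rule sets_measure_of) auto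
  show ?thesis
    unfolding sets using assms by (intro sigma_sets_mono' UN_mono) auto
qed

text \<open>Doob-Dynkin for events: the sets with such a description contain the generators and are
  closed under complements and countable unions. It turns the stopping time property into a
  condition on output tuples.\<close>

lemma generated_sigma_eq_vimage:
  fixes X :: "'i \<Rightarrow> 'a \<Rightarrow> 'c :: topological_space"
  assumes "E \<in> sets (generated_sigma M X I)"
  obtains B where "B \<in> sets (PiM I (\<lambda>_. borel))" "E = {\<omega>\<in>space M. (\<lambda>i\<in>I. X i \<omega>) \<in> B}"
proof -
  let ?P = "PiM I (\<lambda>_. borel :: 'c measure)"
  define R where "R \<omega> = (\<lambda>i\<in>I. X i \<omega>)" for \<omega>
  have R: "R \<omega> \<in> space ?P" "i \<in> I \<Longrightarrow> R \<omega> i = X i \<omega>" for \<omega> i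
    by (simp_all add: R_def space_PiM)
  have "E \<in> sigma_sets (space M) (\<Union>i\<in>I. {X i -` B \<inter> space M | B. B \<in> sets borel})"
    using assms by (auto simp: generated_sigma_def sets_measure_of_conv split: if_splits)
  then have "\<exists>B\<in>sets ?P. E = {\<omega>\<in>space M. R \<omega> \<in> B}"
  proof induction
    case (Basic E)
    then obtain i B where i: "i \<in> I" "B \<in> sets borel" "E = X i -` B \<inter> space M"
      by auto
    have "(\<lambda>x. x i) \<in> borel_measurable ?P"
      using i(1) by (rule measurable_component_singleton)
    from measurable_sets[OF this i(2)] show ?case
      by (rule bexI[rotated]) (use i R in auto)
  next
    case Empty
    show ?case
      by (rule bexI[of _ "{}"]) auto
  next
    case (Compl E)
    from Compl.IH obtain B where B: "B \<in> sets ?P" "E = {\<omega>\<in>space M. R \<omega> \<in> B}"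
      by (rule bexE)
    from sets.compl_sets[OF B(1)] show ?case
      by (rule bexI[rotated]) (use B(2) R(1) in blast)
  next
    case (Union E)
    have "\<forall>k. \<exists>B. B \<in> sets ?P \<and> E k = {\<omega>\<in>space M. R \<omega> \<in> B}"
      using Union.IH by (simp only: Bex_def) blast
    from choice[OF this] obtain B where B: "\<forall>k. B k \<in> sets ?P \<and> E k = {\<omega>\<in>space M. R \<omega> \<in> B k}"
      by (rule exE)
    then have "(\<Union>k. B k) \<in> sets ?P"
      by blast
    moreover have "(\<Union>k. E k) = {\<omega>\<in>space M. R \<omega> \<in> (\<Union>k. B k)}"
      using B by auto
    ultimately show ?case
      by (rule bexI[rotated])
  qed
  then show ?thesis
    using that unfolding R_def by blast
qed

section \<open>Measurability on the space of tuples of variable length\<close>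

abbreviation slice :: "(nat \<times> 'b) set \<Rightarrow> nat \<Rightarrow> 'b set" where
  "slice A n \<equiv> {\<beta>. (n, \<beta>) \<in> A}"

lemma space_finite_sequences: "space (finite_sequences :: (nat \<times> (nat \<Rightarrow> real ^ 'd)) measure) = (SIGMA n:{1..}. space (tuples n))"
  unfolding finite_sequences_def by (rule space_measure_of) auto

text \<open>The generating family is closed under complements and countable unions, slice by slice,
  hence is already the sigma-algebra, and measurability can be tested on slices.\<close>

lemma sets_finite_sequences:
  "A \<in> sets (finite_sequences :: (nat \<times> (nat \<Rightarrow> real ^ 'd)) measure) \<longleftrightarrow>
    A \<subseteq> (SIGMA n:{1..}. space (tuples n)) \<and> (\<forall>n\<ge>1. slice A n \<in> sets (tuples n))"
proof -
  let ?\<Omega> = "SIGMA n:{1..}. space (tuples n :: (nat \<Rightarrow> real ^ 'd) measure)"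
  let ?G = "{A. A \<subseteq> ?\<Omega> \<and> (\<forall>n\<ge>1. slice A n \<in> sets (tuples n))}"
  have sets: "sets (finite_sequences :: (nat \<times> (nat \<Rightarrow> real ^ 'd)) measure) = sigma_sets ?\<Omega> ?G"
    unfolding finite_sequences_def by (rule sets_measure_of) auto
  show ?thesis
  proof
    assume "A \<in> sets finite_sequences"
    then have "A \<in> sigma_sets ?\<Omega> ?G"
      unfolding sets .
    then show "A \<subseteq> ?\<Omega> \<and> (\<forall>n\<ge>1. slice A n \<in> sets (tuples n))"
    proof induction
      case (Compl A)
      have "slice (?\<Omega> - A) n = space (tuples n) - slice A n" if "1 \<le> n" for n
        using that by auto
      with Compl show ?case
        by auto
    next
      case (Union A)
      have "slice (\<Union>k. A k) n = (\<Union>k. slice (A k) n)" for n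
        by auto
      with Union show ?case
        by (auto intro!: sets.countable_UN)
    qed auto
  qed (auto simp: sets intro: sigma_sets.Basic)
qed

lemma measurable_finite_sequences:
  fixes X :: "nat \<Rightarrow> 'a \<Rightarrow> nat \<Rightarrow> real ^ 'd"
  assumes Nm: "N \<in> measurable M (count_space UNIV)" and N1: "\<And>\<omega>. \<omega> \<in> space M \<Longrightarrow> 1 \<le> N \<omega>"
    and X: "\<And>n. 1 \<le> n \<Longrightarrow> X n \<in> measurable M (tuples n)"
  shows "(\<lambda>\<omega>. (N \<omega>, X (N \<omega>) \<omega>)) \<in> measurable M finite_sequences"
proof (rule measurableI)
  fix \<omega> assume "\<omega> \<in> space M"
  then show "(N \<omega>, X (N \<omega>) \<omega>) \<in> space finite_sequences"
    using N1 measurable_space[OF X] by (auto simp: space_finite_sequences)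
next
  fix A :: "(nat \<times> (nat \<Rightarrow> real ^ 'd)) set" assume A: "A \<in> sets finite_sequences"
  have "(\<lambda>\<omega>. (N \<omega>, X (N \<omega>) \<omega>)) -` A \<inter> space M = (\<Union>n\<in>{1..}. (N -` {n} \<inter> space M) \<inter> (X n -` slice A n \<inter> space M))"
    using N1 by auto
  also have "\<dots> \<in> sets M"
  proof (rule sets.countable_UN'[OF countableI_type])
    have "(N -` {n} \<inter> space M) \<inter> (X n -` slice A n \<inter> space M) \<in> sets M" if "1 \<le> n" for n
      using that A by (intro sets.Int measurable_sets[OF Nm] measurable_sets[OF X[OF that]])
        (simp_all add: sets_finite_sequences)
    then show "(\<lambda>n. (N -` {n} \<inter> space M) \<inter> (X n -` slice A n \<inter> space M)) ` {1..} \<subseteq> sets M"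
      by blast
  qed
  finally show "(\<lambda>\<omega>. (N \<omega>, X (N \<omega>) \<omega>)) -` A \<inter> space M \<in> sets M" .
qed

section \<open>Comparison of the stopped outputs for two databases\<close>

locale stopped_mechanism = laplace_noise M \<eta> Z for M :: "'a measure" and \<eta> and Z :: "real \<Rightarrow> 'a \<Rightarrow> real ^ 'd" +
  fixes f :: "'x \<Rightarrow> real ^ 'd" and T :: "nat \<Rightarrow> (nat \<Rightarrow> real ^ 'd) \<Rightarrow> real" and N :: "(nat \<Rightarrow> real ^ 'd) \<Rightarrow> nat"
  assumes T: "time_functions T" and T_ge: "\<And>n \<beta>. 1 \<le> n \<Longrightarrow> \<beta> \<in> space (tuples (n - 1)) \<Longrightarrow> \<eta> \<le> T n \<beta>"
    and N: "stopping_function M f T Z N"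
begin

lemma T_measurable: "1 \<le> n \<Longrightarrow> T n \<in> borel_measurable (tuples (n - 1))"
  using T by (simp add: time_functions_def)

lemma lnr_measurable: "1 \<le> n \<Longrightarrow> lnr f T Z x n \<in> borel_measurable M"
  by (rule measurable_lnr[OF T_measurable T_ge])

abbreviation Tup :: "'x \<Rightarrow> nat \<Rightarrow> 'a \<Rightarrow> nat \<Rightarrow> real ^ 'd" where
  "Tup x n \<omega> \<equiv> (\<lambda>i\<in>{1..n}. lnr f T Z x i \<omega>)"

abbreviation Nx :: "'x \<Rightarrow> 'a \<Rightarrow> nat" where
  "Nx x \<omega> \<equiv> N (lnr_seq f T Z x \<omega>)"

lemma Tup_measurable: "Tup x n \<in> measurable M (tuples n)"
  by (intro measurable_restrict lnr_measurable) simp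

lemma lnr_seq_measurable: "lnr_seq f T Z x \<in> measurable M sequences"
  unfolding lnr_seq_def by (intro measurable_restrict lnr_measurable) simp

lemma Nx_measurable: "Nx x \<in> measurable M (count_space UNIV)"
  using N measurable_compose[OF lnr_seq_measurable] by (auto simp: stopping_function_def)

lemma Nx_ge: "1 \<le> Nx x \<omega>"
  using N by (auto simp: stopping_function_def lnr_seq_def space_PiM)

lemma lnr_stopped_eq: "lnr_stopped f T Z N x = (\<lambda>\<omega>. (Nx x \<omega>, Tup x (Nx x \<omega>) \<omega>))"
  by (simp add: fun_eq_iff lnr_stopped_def Let_def)

lemma lnr_stopped_measurable: "lnr_stopped f T Z N x \<in> measurable M finite_sequences"
  unfolding lnr_stopped_eq by (intro measurable_finite_sequences Nx_measurable Nx_ge Tup_measurable)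

lemma stopping_event:
  assumes "1 \<le> n"
  obtains B where "B \<in> sets (tuples n)" "\<And>\<omega>. \<omega> \<in> space M \<Longrightarrow> Nx x \<omega> = n \<longleftrightarrow> Tup x n \<omega> \<in> B"
proof -
  let ?F = "\<lambda>n. generated_sigma M (lnr f T Z x) {1..n}"
  have le: "{\<omega>\<in>space M. Nx x \<omega> \<le> n} \<in> sets (?F n)" for n
    using N by (auto simp: stopping_function_def stopping_time_def pred_def)
  have "sets (?F (n - 1)) \<subseteq> sets (?F n)"
    by (rule sets_generated_sigma_mono) auto
  then have "{\<omega>\<in>space M. Nx x \<omega> \<le> n} - {\<omega>\<in>space M. Nx x \<omega> \<le> n - 1} \<in> sets (?F n)"
    using le[of n] le[of "n - 1"] by auto
  then obtain B where B: "B \<in> sets (tuples n)"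
    "{\<omega>\<in>space M. Nx x \<omega> \<le> n} - {\<omega>\<in>space M. Nx x \<omega> \<le> n - 1} = {\<omega>\<in>space M. Tup x n \<omega> \<in> B}"
    by (rule generated_sigma_eq_vimage)
  show ?thesis
  proof (rule that[OF B(1)])
    fix \<omega> assume \<omega>: "\<omega> \<in> space M"
    have "Nx x \<omega> = n \<longleftrightarrow> \<omega> \<in> {\<omega>\<in>space M. Nx x \<omega> \<le> n} - {\<omega>\<in>space M. Nx x \<omega> \<le> n - 1}"
      using \<omega> assms by auto
    then show "Nx x \<omega> = n \<longleftrightarrow> Tup x n \<omega> \<in> B"
      unfolding B(2) using \<omega> by simp
  qed
qed

text \<open>The set \<open>B\<close> describing \<open>{N = n}\<close> in terms of the first \<open>n\<close> outputs is only determined on the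
  range of the outputs for \<open>x\<close>. It is also correct almost surely for \<open>x'\<close>, because the laws of the
  full output sequences are mutually absolutely continuous.\<close>

lemma AE_stopping_event:
  assumes B: "B \<in> sets (tuples n)" "\<And>\<omega>. \<omega> \<in> space M \<Longrightarrow> Nx x \<omega> = n \<longleftrightarrow> Tup x n \<omega> \<in> B"
  shows "AE \<omega> in M. Nx x' \<omega> = n \<longleftrightarrow> Tup x' n \<omega> \<in> B"
proof -
  \<comment> \<open>The sequences on which N and B disagree about stopping at n. The outputs for x
    never lie in D, by the choice of B.\<close>
  define D where "D = {\<beta>\<in>space sequences. (N \<beta> = n) \<noteq> (restrict \<beta> {1..n} \<in> B)}"
  have [measurable]: "N \<in> measurable sequences (count_space UNIV)"
    using N by (simp add: stopping_function_def)
  have restr_m: "(\<lambda>\<beta>. restrict \<beta> {1..n}) \<in> measurable sequences (tuples n)"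
    by (rule measurable_restrict_subset) auto
  have D: "D \<in> sets sequences"
  proof -
    have "{\<beta>\<in>space sequences. restrict \<beta> {1..n} \<in> B} \<in> sets sequences"
      using measurable_sets[OF restr_m B(1)]
      by (simp add: vimage_def Int_def conj_commute)
    moreover have "{\<beta>\<in>space sequences. N \<beta> = n} \<in> sets sequences"
      by measurable
    moreover have "D = ({\<beta>\<in>space sequences. N \<beta> = n} - {\<beta>\<in>space sequences. restrict \<beta> {1..n} \<in> B}) \<union>
        ({\<beta>\<in>space sequences. restrict \<beta> {1..n} \<in> B} - {\<beta>\<in>space sequences. N \<beta> = n})"
      by (auto simp: D_def)
    ultimately show ?thesis
      by auto
  qed
  have restr: "restrict (lnr_seq f T Z y \<omega>) {1..n} = Tup y n \<omega>" for y \<omega>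
    by (auto simp: lnr_seq_def restrict_def fun_eq_iff)
  have seq: "lnr_seq f T Z y \<omega> \<in> D \<longleftrightarrow> (Nx y \<omega> = n) \<noteq> (Tup y n \<omega> \<in> B)" if "\<omega> \<in> space M" for y \<omega>
    using measurable_space[OF lnr_seq_measurable that, of y] unfolding D_def mem_Collect_eq restr by blast
  \<comment> \<open>Only nullity has to be transferred, so the crude factor at the lowest level
    \<eta> is good enough, and at that level the bound holds for the entire infinite
    sequence.\<close>
  have "emeasure M {\<omega>\<in>space M. lnr_seq f T Z x' \<omega> \<in> D} \<le>
    ennreal (exp ((\<Sum>i\<in>UNIV. \<bar>f x' $ i - f x $ i\<bar>) / \<eta>)) * emeasure M {\<omega>\<in>space M. lnr_seq f T Z x \<omega> \<in> D}"
    unfolding lnr_seq_def by (rule emeasure_lnr_shift[OF order_refl T_measurable T_ge subset_refl D])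
  moreover have "{\<omega>\<in>space M. lnr_seq f T Z x \<omega> \<in> D} = {}"
    using B(2) seq by blast
  ultimately have "emeasure M {\<omega>\<in>space M. lnr_seq f T Z x' \<omega> \<in> D} = 0"
    by simp
  moreover have "{\<omega>\<in>space M. lnr_seq f T Z x' \<omega> \<in> D} \<in> sets M"
    using measurable_sets[OF lnr_seq_measurable D, of x'] by (simp add: vimage_def Int_def conj_commute)
  ultimately have "AE \<omega> in M. \<omega> \<notin> {\<omega>\<in>space M. lnr_seq f T Z x' \<omega> \<in> D}"
    by (intro AE_not_in) (simp add: null_sets_def)
  then show ?thesis
    using AE_space by eventually_elim (use seq in auto)
qed

text \<open>One set B describes stopping at n for both databases, up to null events. Stopping
  therefore merely replaces A by \<open>B \<inter> A\<close>, a smaller set on which the times are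
  still at least s.\<close>

lemma emeasure_stopped_slice:
  assumes n: "1 \<le> n" and A: "A \<in> sets (tuples n)" and s: "\<eta> \<le> s"
    "\<And>\<beta>. \<beta> \<in> A \<Longrightarrow> s \<le> T n (restrict \<beta> {1..n - 1})"
  shows "emeasure M {\<omega>\<in>space M. Nx x \<omega> = n \<and> Tup x n \<omega> \<in> A} \<le>
    ennreal (exp ((\<Sum>i\<in>UNIV. \<bar>f x $ i - f x' $ i\<bar>) / s)) * emeasure M {\<omega>\<in>space M. Nx x' \<omega> = n \<and> Tup x' n \<omega> \<in> A}"
proof -
  obtain B where B: "B \<in> sets (tuples n)" "\<And>\<omega>. \<omega> \<in> space M \<Longrightarrow> Nx x \<omega> = n \<longleftrightarrow> Tup x n \<omega> \<in> B"
    using stopping_event[OF n] by blast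
  have eq: "emeasure M {\<omega>\<in>space M. Nx y \<omega> = n \<and> Tup y n \<omega> \<in> A} = emeasure M {\<omega>\<in>space M. Tup y n \<omega> \<in> B \<inter> A}" for y
  proof (rule emeasure_eq_AE)
    have "AE \<omega> in M. Nx y \<omega> = n \<longleftrightarrow> Tup y n \<omega> \<in> B"
      by (rule AE_stopping_event[OF B(1)]) (rule B(2))
    then show "AE \<omega> in M. \<omega> \<in> {\<omega>\<in>space M. Nx y \<omega> = n \<and> Tup y n \<omega> \<in> A} \<longleftrightarrow> \<omega> \<in> {\<omega>\<in>space M. Tup y n \<omega> \<in> B \<inter> A}"
      by eventually_elim auto
    have t: "{\<omega>\<in>space M. Tup y n \<omega> \<in> C} \<in> sets M" if "C \<in> sets (tuples n)" for C
      using measurable_sets[OF Tup_measurable that] by (simp add: vimage_def Int_def conj_commute)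
    show "{\<omega>\<in>space M. Tup y n \<omega> \<in> B \<inter> A} \<in> sets M"
      using t A B(1) by blast
    have "{\<omega>\<in>space M. Nx y \<omega> = n} \<in> sets M"
      using Nx_measurable[of y] by measurable
    then have "{\<omega>\<in>space M. Nx y \<omega> = n} \<inter> {\<omega>\<in>space M. Tup y n \<omega> \<in> A} \<in> sets M"
      using t[OF A] by (rule sets.Int)
    moreover have "{\<omega>\<in>space M. Nx y \<omega> = n} \<inter> {\<omega>\<in>space M. Tup y n \<omega> \<in> A} = {\<omega>\<in>space M. Nx y \<omega> = n \<and> Tup y n \<omega> \<in> A}"
      by blast
    ultimately show "{\<omega>\<in>space M. Nx y \<omega> = n \<and> Tup y n \<omega> \<in> A} \<in> sets M"
      by simp
  qed
  show ?thesis
    unfolding eq by (rule emeasure_tuple_shift[OF s(1) T n]) (use A B s in auto)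
qed

lemma emeasure_stopped:
  assumes A: "A \<in> sets finite_sequences"
  shows "emeasure (distr M finite_sequences (lnr_stopped f T Z N x)) A =
    (\<Sum>n. emeasure M {\<omega>\<in>space M. Nx x \<omega> = Suc n \<and> Tup x (Suc n) \<omega> \<in> slice A (Suc n)})"
proof -
  let ?E = "\<lambda>n. {\<omega>\<in>space M. Nx x \<omega> = Suc n \<and> Tup x (Suc n) \<omega> \<in> slice A (Suc n)}"
  have E: "?E n \<in> sets M" for n
  proof -
    have "?E n = (Nx x -` {Suc n} \<inter> space M) \<inter> (Tup x (Suc n) -` slice A (Suc n) \<inter> space M)"
      by auto
    also have "\<dots> \<in> sets M"
      using A by (intro sets.Int measurable_sets[OF Nx_measurable] measurable_sets[OF Tup_measurable])
        (auto simp: sets_finite_sequences)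
    finally show ?thesis .
  qed
  have "lnr_stopped f T Z N x -` A \<inter> space M = (\<Union>n. ?E n)"
  proof (intro set_eqI iffI)
    fix \<omega> assume "\<omega> \<in> lnr_stopped f T Z N x -` A \<inter> space M"
    then have "\<omega> \<in> ?E (Nx x \<omega> - 1)"
      using Nx_ge[of x \<omega>] by (simp add: lnr_stopped_eq)
    then show "\<omega> \<in> (\<Union>n. ?E n)"
      by blast
  qed (auto simp: lnr_stopped_eq)
  then have "emeasure (distr M finite_sequences (lnr_stopped f T Z N x)) A = emeasure M (\<Union>n. ?E n)"
    by (simp add: emeasure_distr[OF lnr_stopped_measurable A])
  also have "\<dots> = (\<Sum>n. emeasure M (?E n))"
    by (rule suminf_emeasure[symmetric]) (use E in \<open>auto simp: disjoint_family_on_def\<close>)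
  finally show ?thesis .
qed

text \<open>For c > 0 the budget Delta / T is at most c exactly when T is at least Delta / c, so c
  fixes one level s for all slices. The factor exp c does not depend on n and leaves the sum over
  the stopping values.\<close>

lemma distr_stopped_le:
  assumes \<Delta>: "(\<Sum>i\<in>UNIV. \<bar>f x $ i - f x' $ i\<bar>) \<le> \<Delta>" and A: "A \<in> sets finite_sequences"
    and c: "\<And>n \<beta>. (n, \<beta>) \<in> A \<Longrightarrow> \<Delta> / T n (restrict \<beta> {1..n - 1}) \<le> c"
  shows "emeasure (distr M finite_sequences (lnr_stopped f T Z N x)) A \<le>
    ennreal (exp c) * emeasure (distr M finite_sequences (lnr_stopped f T Z N x')) A"
  unfolding emeasure_stopped[OF A] ennreal_suminf_cmult[symmetric]
proof (intro suminf_le summableI)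
  fix k
  let ?n = "Suc k" and ?A = "slice A (Suc k)"
  let ?E = "\<lambda>x. {\<omega>\<in>space M. Nx x \<omega> = Suc k \<and> Tup x (Suc k) \<omega> \<in> slice A (Suc k)}"
  have n: "1 \<le> ?n"
    by simp
  have An: "?A \<in> sets (tuples ?n)"
    using A by (simp add: sets_finite_sequences)
  have Tn: "\<eta> \<le> T ?n (restrict \<beta> {1..?n - 1})" for \<beta>
    by (rule T_ge) (use restrict_in_space_tuples in auto)
  have d0: "0 \<le> (\<Sum>i\<in>UNIV. \<bar>f x $ i - f x' $ i\<bar>)"
    by (simp add: sum_nonneg)
  show "emeasure M (?E x) \<le> ennreal (exp c) * emeasure M (?E x')"
  proof (cases "?A = {}")
    case True
    then show ?thesis
      by (metis (mono_tags, lifting) Collect_empty_eq emeasure_empty empty_iff zero_le)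
  next
    case False
    then obtain \<beta> where \<beta>: "(?n, \<beta>) \<in> A"
      by auto
    \<comment> \<open>A point of the slice is what excludes c < 0, since its budget is
      nonnegative.\<close>
    have c0: "0 \<le> c"
      using c[OF \<beta>] Tn[of \<beta>] \<eta> d0 \<Delta> by (smt (verit) divide_nonneg_pos)
    \<comment> \<open>Chosen so that Delta / s \<le> c, while the times on the slice are still at
      least s; the maximum keeps s in the range from \<eta> on.\<close>
    define s where "s = (if c = 0 then \<eta> else max \<eta> (\<Delta> / c))"
    have s: "\<eta> \<le> s"
      by (simp add: s_def)
    have s_T: "s \<le> T ?n (restrict \<beta> {1..?n - 1})" if "\<beta> \<in> ?A" for \<beta>
    proof (cases "c = 0")
      case False
      from that have "(?n, \<beta>) \<in> A"
        by simp
      from c[OF this] have "\<Delta> / T ?n (restrict \<beta> {1..?n - 1}) \<le> c" .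
      then have "\<Delta> \<le> c * T ?n (restrict \<beta> {1..?n - 1})"
        using Tn[of \<beta>] \<eta> by (subst (asm) pos_divide_le_eq) auto
      then have "\<Delta> / c \<le> T ?n (restrict \<beta> {1..?n - 1})"
        using c0 False by (subst pos_divide_le_eq) (auto simp: mult.commute)
      then show ?thesis
        using Tn[of \<beta>] False by (simp add: s_def)
    qed (use Tn in \<open>simp add: s_def\<close>)
    have "(\<Sum>i\<in>UNIV. \<bar>f x $ i - f x' $ i\<bar>) / s \<le> \<Delta> / s"
      using \<Delta> s \<eta> by (intro divide_right_mono) auto
    also have "\<dots> \<le> c"
    proof (cases "c = 0")
      case True
      \<comment> \<open>As times are positive, c = 0 forces Delta \<le> 0, and then every positive
        level does.\<close>
      then have "\<Delta> \<le> 0"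
        using c[OF \<beta>] Tn[of \<beta>] \<eta> by (simp add: divide_le_0_iff)
      then show ?thesis
        using True s \<eta> by (simp add: divide_le_0_iff)
    next
      case False
      then have "\<Delta> / c \<le> s" "0 < c"
        using c0 by (auto simp: s_def)
      then show ?thesis
        using s \<eta> by (simp add: divide_le_eq mult.commute)
    qed
    finally have "ennreal (exp ((\<Sum>i\<in>UNIV. \<bar>f x $ i - f x' $ i\<bar>) / s)) \<le> ennreal (exp c)"
      by (intro ennreal_leI) simp
    then have "ennreal (exp ((\<Sum>i\<in>UNIV. \<bar>f x $ i - f x' $ i\<bar>) / s)) * emeasure M (?E x') \<le> ennreal (exp c) * emeasure M (?E x')"
      by (rule mult_right_mono) simp
    from emeasure_stopped_slice[OF n An s s_T] this show ?thesis
      by (rule order_trans)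
  qed
qed

lemma measurable_budget:
  "(\<lambda>(n, \<beta>). \<Delta> / T n (restrict \<beta> {1..n - 1})) \<in> borel_measurable finite_sequences"
proof (rule measurableI)
  fix C :: "real set" assume C: "C \<in> sets borel"
  let ?E = "\<lambda>(n, \<beta>). \<Delta> / T n (restrict \<beta> {1..n - 1})"
  have "slice (?E -` C \<inter> space finite_sequences) n \<in> sets (tuples n)" if n: "1 \<le> n" for n
  proof -
    have "(\<lambda>\<beta>. restrict \<beta> {1..n - 1}) \<in> measurable (tuples n) (tuples (n - 1))"
      by (rule measurable_restrict_subset) auto
    from measurable_compose[OF this T_measurable[OF n]]
    have "(\<lambda>\<beta>. \<Delta> / T n (restrict \<beta> {1..n - 1})) \<in> borel_measurable (tuples n)"
      by (intro borel_measurable_divide borel_measurable_const)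
    from measurable_sets[OF this C] show ?thesis
      using n by (simp add: space_finite_sequences vimage_def Int_def conj_commute)
  qed
  then show "?E -` C \<inter> space finite_sequences \<in> sets finite_sequences"
    unfolding sets_finite_sequences by (auto simp: space_finite_sequences)
qed simp

end

theorem proposition4p2:
  fixes M :: "'a measure"
    and nbr :: "'x \<Rightarrow> 'x \<Rightarrow> bool"
    and f :: "'x \<Rightarrow> real ^ 'd"
    and T :: "nat \<Rightarrow> (nat \<Rightarrow> real ^ 'd) \<Rightarrow> real"
    and Z :: "real \<Rightarrow> 'a \<Rightarrow> real ^ 'd"
    and N :: "(nat \<Rightarrow> real ^ 'd) \<Rightarrow> nat"
    and \<eta> \<Delta>\<^sub>1 :: real
  assumes "prob_space M"
    and "0 < \<eta>"
    and "laplace_process M \<eta> Z"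
    and "l1_sensitivity_le nbr f \<Delta>\<^sub>1"
    and "time_functions T"
    and "\<forall>n\<ge>1. \<forall>\<beta>\<in>space (tuples (n - 1)). \<eta> \<le> T n \<beta>"
    and "stopping_function M f T Z N"
  shows "ex_post_private M finite_sequences nbr (lnr_stopped f T Z N)
           (\<lambda>(n, \<beta>). \<Delta>\<^sub>1 / T n (restrict \<beta> {1..n - 1})) 0
       \<and> (\<forall>x x'. nbr x x' \<longrightarrow>
            measure M {\<omega>\<in>space M.
              privacy_loss M finite_sequences (lnr_stopped f T Z N x) (lnr_stopped f T Z N x') \<omega>
              > ereal (\<Delta>\<^sub>1 / lnr_time f T Z x (N (lnr_seq f T Z x \<omega>)) \<omega>)} = 0)"
proof -
  interpret stopped_mechanism M \<eta> Z f T N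
    using assms by (auto intro!: stopped_mechanism.intro laplace_noise.intro laplace_noise_axioms.intro
        stopped_mechanism_axioms.intro)
  let ?E = "\<lambda>(n, \<beta>). \<Delta>\<^sub>1 / T n (restrict \<beta> {1..n - 1})"
  let ?L = "\<lambda>x x'. privacy_loss M finite_sequences (lnr_stopped f T Z N x) (lnr_stopped f T Z N x')"
  have "{\<omega>\<in>space M. ?L x x' \<omega> > ereal (?E (lnr_stopped f T Z N x \<omega>))} \<in> sets M \<and>
    measure M {\<omega>\<in>space M. ?L x x' \<omega> > ereal (?E (lnr_stopped f T Z N x \<omega>))} = 0" if "nbr x x'" for x x'
  proof -
    have \<Delta>: "(\<Sum>i\<in>UNIV. \<bar>f x $ i - f x' $ i\<bar>) \<le> \<Delta>\<^sub>1"
      using assms(4) that by (simp add: l1_sensitivity_le_def)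
    have le: "emeasure (distr M finite_sequences (lnr_stopped f T Z N x)) A \<le>
        ennreal (exp c) * emeasure (distr M finite_sequences (lnr_stopped f T Z N x')) A"
      if "A \<in> sets finite_sequences" "\<And>y. y \<in> A \<Longrightarrow> ?E y \<le> c" for c A
      using that by (intro distr_stopped_le[OF \<Delta>]) fastforce+
    note pl = privacy_loss_gt[OF prob_space_axioms lnr_stopped_measurable lnr_stopped_measurable measurable_budget le]
    from pl show ?thesis
      by blast
  qed
  note * = this
  \<comment> \<open>Cut to its first n - 1 entries, the stopped tuple is the argument from which the
    time of the last output was computed.\<close>
  moreover have "?E (lnr_stopped f T Z N x \<omega>) = \<Delta>\<^sub>1 / lnr_time f T Z x (Nx x \<omega>) \<omega>" for x \<omega>
  proof -
    have "restrict (Tup x n \<omega>) {1..n - 1} = (\<lambda>i\<in>{1..n - 1}. lnr f T Z x i \<omega>)" for n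
      by (auto simp: restrict_def fun_eq_iff)
    then show ?thesis
      by (simp only: lnr_stopped_eq lnr_time_def prod.case)
  qed
  ultimately show ?thesis
    unfolding ex_post_private_def using lnr_stopped_measurable by (simp only:) auto
qed

end
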